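(* Consider a graphon game $\mathcal G(\mathcal A_{ad}^\infty,U,\theta,W)$ in which the players have homogeneous action sets, i.e. $\mathcal A^x=\mathcal A^0$ for all $x\in[0,1]$. Suppose that: (A1) For all $\tilde z,\tilde\theta\in\mathcal A$, $\tilde a\mapsto U(\tilde a,\tilde z,\tilde\theta)$ is continuously Gâteaux differentiable and $U(\tilde a,\tilde z,\tilde\theta)+\frac{\alpha_U}{2}\|\tilde a\|_{\mathcal A}^2$ is concave in $\tilde a$, with $\alpha_U>0$; and $\nabla_{\tilde a}U(\cdot,\tilde z,\tilde\theta)$ is Lipschitz in $\tilde z,\tilde\theta$ with constants $\ell_U,\ell_\theta$, i.e. $\|\nabla_{\tilde a}U(\tilde a,\tilde z_1,\tilde\theta_1)-\nabla_{\tilde a}U(\tilde a,\tilde z_2,\tilde\theta_2)\|_{\mathcal A}\le \ell_U\|\tilde z_1-\tilde z_2\|_{\mathcal A}+\ell_\theta\|\tilde\theta_1-\tilde\theta_2\|_{\mathcal A}$. (A2) $\mathcal A^0$ is nonempty, convex and closed, and there exist $\tilde z_0,\tilde\theta_0\in\mathcal A$ such that $(\arg\max_{\tilde a\in\mathcal A^x}U(\tilde a,\tilde z_0,\tilde\theta_0))_{x\in[0,1]}\in\mathcal A^\infty$. (A3) There is a constant $M$ such that $\|\tilde a\|_{\mathcal A}\le M$ for all $\tilde a\in\mathcal A^0$. (A4) $W$ is blockwise Lipschitz: there exist a constant $L$ and a finite partition $\{I_1,\dots,I_{K+1}\}$ of $[0,1]$ such that for all $1\le k,l\le K+1$ and $(x,y),(x',y')\in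 I_k\times I_l$, $|W(x,y)-W(x',y')|\le L(|x-x'|+|y-y'|)$. (A5) $\ell_U<\alpha_U$. Denote by $\bar a$ the unique Nash equilibrium of this graphon game. Let $(\kappa_N)_{N\in\mathbb N}\subset(0,1]$ be density parameters with $\frac{\log N}{\kappa_NN}\to0$ as $N\to\infty$. For any $N$ let $\theta^N\in\mathcal A^N$ be a vector of heterogeneity processes, and assume $\|\theta-\theta^N_{\mathrm{step}}\|_{\mathcal A^\infty}\to0$ as $N\to\infty$. Let $G_w^N(W)$ and $G_s^N(W)$ be the weighted and simple random graphs sampled from $W$ (the latter with density parameter $\kappa_N$). Then: (i) (Weighted graphs.) The sampled network game $\mathcal G((\mathcal A^0)^N,U,\theta^N,G_w^N(W))$ admits a unique Nash equilibrium $\bar a^N$ for every $N\in\mathbb N$. Moreover, for any $0<\delta<e^{-1}$, with $\mathbb Q$-probability at least $1-\delta$, $$\|\bar a-\bar a^N_{\mathrm{step}}\|_{\mathcal A^\infty}=\mathcal O\left(\Big(\frac{\log(N/\delta)}{N}\Big)^{1/4}\vee\|\theta-\theta^N_{\mathrm{step}}\|_{\mathcal A^\infty}\right).$$ In particular, $\|\bar a-\bar a^N_{\mathrm{step}}\|_{\mathcal A^\infty}$ converges $\mathbb Q$-almost surely to $0$ as $N\to\infty$. (ii) (Simple graphs.) For any $0<\delta<e^{-1}$ there exists $N_\delta\in\mathbb N$ such that the sampled network game $\mathcal G((\mathcal A^0)^N,U,\theta^N,\kappa_N^{-1}G_s^N(W))$ admits a unique Nash equilibrium $\bar b^N$ with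 $\mathbb Q$-probability at least $1-2\delta$ for all $N\ge N_\delta$. Moreover, with $\mathbb Q$-probability at least $1-2\delta$, $$\|\bar a-\bar b^N_{\mathrm{step}}\|_{\mathcal A^\infty}=\mathcal O\left(\Big(\frac{\log(N/\delta)}{N}\Big)^{1/4}\vee\Big(\frac{\log(N/\delta)}{\kappa_NN}\Big)^{1/2}\vee\|\theta-\theta^N_{\mathrm{step}}\|_{\mathcal A^\infty}\right).$$ In particular, $\|\bar a-\bar b^N_{\mathrm{step}}\|_{\mathcal A^\infty}$ converges $\mathbb Q$-almost surely to $0$ as $N\to\infty$.
   Context: Probabilistic setting. Fix $T>0$, a probability space $(\Omega,\mathcal F,\mathbb P)$, a probability space $([0,1],\mathcal I,\nu)$ extending the Lebesgue space on $[0,1]$, and a rich Fubini extension $([0,1]\times\Omega,\mathcal I\boxtimes\mathcal F,\nu\boxtimes\mathbb P)$ of the product space (an extension on which Fubini's theorem holds for all integrable functions and which supports essentially pairwise independent families of processes). Write $dx$ for $\nu(dx)$. $\mathbb F=(\mathcal F_t)_{0\le t\le T}$ is the augmentation of the filtration generated by $(\theta^x)_{x\in[0,1]}$; the augmented filtrations generated by the finite-player heterogeneity processes are assumed to be contained in $\mathbb F$. $\mathcal A$ is the Hilbert space of $\mathbb F$-progressively measurable $\tilde a:\Omega\times[0,T]\to\mathbb R$ with $\|\tilde a\|_{\mathcal A}^2=\int_0^T\mathbb E[\tilde a_t^2]dt<\infty$. An action profile is a family $a=(a^x)_{x\in[0,1]}$, $a^x\in\mathcal A$, with $(x,t,\omega)\mapsto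 a^x_t(\omega)$ being $\mathcal I\otimes\mathcal B([0,T])\otimes\mathcal F$-measurable; $\mathcal A^\infty$ is the Hilbert space of action profiles with $\|a\|_{\mathcal A^\infty}^2=\int_0^1\int_0^T\mathbb E[(a_t^x)^2]dtdx<\infty$. $U:\mathcal A^3\to\mathbb R$ is a given utility functional. Graphon game $\mathcal G(\mathcal A_{ad}^\infty,U,\theta,W)$: $\theta\in\mathcal A^\infty$; $W$ is a graphon (symmetric measurable $[0,1]^2\to[0,1]$); $(\boldsymbol Wa)(x)=\int_0^1W(x,y)a^ydy$; $\mathcal A_{ad}^\infty=\{a\in\mathcal A^\infty:a^x\in\mathcal A^x\ \forall x\}$. A Nash equilibrium is $\bar a\in\mathcal A_{ad}^\infty$ with $\bar a^x=\arg\max_{\tilde a\in\mathcal A^x}U(\tilde a,(\boldsymbol W\bar a)(x),\theta^x)$ for every $x\in[0,1]$. (Under (A1), (A2), (A5) it exists and is unique.) Network game $\mathcal G((\mathcal A^0)^N,U,\theta^N,H)$ for a symmetric nonnegative matrix $H\in\mathbb R^{N\times N}$ (e.g. $H=G_w^N(W)$ or $H=\kappa_N^{-1}G_s^N(W)$): a Nash equilibrium is $\bar a^N\in(\mathcal A^0)^N$ with $\bar a^{i,N}=\arg\max_{\tilde a\in\mathcal A^0}U(\tilde a,\frac1N\sum_jH_{ij}\bar a^{j,N},\theta^{i,N})$ for all $i$. Step profiles. $\mathcal P_i^N=[\frac{i-1}N,\frac iN)$ for $i<N$, $\mathcal P_N^N=[\frac{N-1}N,1]$; for $a^N\in\mathcal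 A^N$, $a^N_{\mathrm{step}}\in\mathcal A^\infty$ is $a^{x,N}_{\mathrm{step}}=a^{i,N}$ for $x\in\mathcal P_i^N$. Sampling. On a separate probability space $(\Omega',\mathcal F',\mathbb Q)$, independently of the randomness of $\mathbb P$, let $(x_1,\dots,x_N)$ be an ordered $N$-tuple of independent uniform random points of $[0,1]$. The weighted graph $G_w^N(W)$ has nodes $1,\dots,N$ and edge weights $W(x_i,x_j)$, $i,j=1,\dots,N$. The simple graph $G_s^N(W)$ is obtained from $N$ isolated nodes by adding undirected edges between $i$ and $j$ at random with probability $\kappa_NW(x_i,x_j)$ for $1\le i<j\le N$. "With $\mathbb Q$-probability at least $p$, $X_N=\mathcal O(r_N)$" means: there is a constant $C$ independent of $N$ such that, for all sufficiently large $N$, $X_N\le Cr_N$ with $\mathbb Q$-probability at least $p$.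
   Formalization: In (A4) the blocks I_k of the finite partition of [0,1] are taken to be intervals (of any kind, singletons allowed); for arbitrary sets as blocks, e.g. W the indicator of S×S with S a fat Cantor set, the stated N^{-1/4} rate fails. *)

theory Defs
  imports "HOL-Probability.Probability"
begin

section \<open>The probabilistic setting\<close>

text \<open>
  Processes are functions \<open>a t \<omega>\<close>, families of processes are functions \<open>a x t \<omega>\<close>; only the values
  with \<open>x \<in> [0,1]\<close>, \<open>t \<in> [0,T]\<close>, \<open>\<omega> \<in> space P\<close> matter. The Hilbert spaces of processes are
  spaces of classes modulo \<open>dt \<otimes> P\<close>-a.e. equality; here their elements are represented by
  functions, and uniqueness is always understood up to \<open>proc_eq\<close>.
\<close>

type_synonym 'w process = "real \<Rightarrow> 'w \<Rightarrow> real"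
type_synonym 'w profile = "real \<Rightarrow> 'w process"

definition extends_lebesgue_unit_interval :: "real measure \<Rightarrow> bool" where
  "extends_lebesgue_unit_interval \<nu> \<longleftrightarrow>
     prob_space \<nu> \<and> space \<nu> = {0..1} \<and>
     sets (lebesgue_on {0..1}) \<subseteq> sets \<nu> \<and>
     (\<forall>A\<in>sets (lebesgue_on {0..1}). emeasure \<nu> A = emeasure lebesgue A)"

definition fubini_extension :: "real measure \<Rightarrow> 'w measure \<Rightarrow> (real \<times> 'w) measure \<Rightarrow> bool" where
  "fubini_extension \<nu> P R \<longleftrightarrow>
     space R = space \<nu> \<times> space P \<and>
     sets (\<nu> \<Otimes>\<^sub>M P) \<subseteq> sets R \<and>
     (\<forall>A\<in>sets (\<nu> \<Otimes>\<^sub>M P). emeasure R A = emeasure (\<nu> \<Otimes>\<^sub>M P) A) \<and>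
     (\<forall>f :: real \<times> 'w \<Rightarrow> real. integrable R f \<longrightarrow>
        (AE x in \<nu>. integrable P (\<lambda>w. f (x, w))) \<and>
        (AE w in P. integrable \<nu> (\<lambda>x. f (x, w))) \<and>
        integrable \<nu> (\<lambda>x. LINT w|P. f (x, w)) \<and>
        integrable P (\<lambda>w. LINT x|\<nu>. f (x, w)) \<and>
        (LINT p|R. f p) = (LINT x|\<nu>. LINT w|P. f (x, w)) \<and>
        (LINT p|R. f p) = (LINT w|P. LINT x|\<nu>. f (x, w)))"

text \<open>
  Richness in the sense of Sun: there is an essentially pairwise independent measurable process
  with uniform marginals. Such a process yields essentially pairwise independent processes with
  arbitrary marginal laws on Polish spaces.
\<close>
definition rich_fubini_extension :: "real measure \<Rightarrow> 'w measure \<Rightarrow> (real \<times> 'w) measure \<Rightarrow> bool" where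
  "rich_fubini_extension \<nu> P R \<longleftrightarrow>
     fubini_extension \<nu> P R \<and>
     (\<exists>f :: real \<times> 'w \<Rightarrow> real. f \<in> borel_measurable R \<and>
        (AE x in \<nu>. (\<lambda>w. f (x, w)) \<in> borel_measurable P \<and>
                    distr P borel (\<lambda>w. f (x, w)) = uniform_measure lborel {0..1}) \<and>
        (AE x in \<nu>. AE y in \<nu>.
           prob_space.indep_var P borel (\<lambda>w. f (x, w)) borel (\<lambda>w. f (y, w))))"

text \<open>
  The filtration generated by the family \<open>(\<theta>\<^sup>x)\<close>, \<open>x \<in> I\<close>, augmented by the null sets. Only the
  \<sigma>-algebra of the resulting measure is meaningful.
\<close>
definition augmented_filtration ::
  "'w measure \<Rightarrow> 'i set \<Rightarrow> ('i \<Rightarrow> 'w process) \<Rightarrow> real \<Rightarrow> 'w measure" where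
  "augmented_filtration P I \<theta> t =
     sigma (space P)
       ({\<theta> x s -` B \<inter> space P | x s B. x \<in> I \<and> 0 \<le> s \<and> s \<le> t \<and> B \<in> sets borel} \<union> null_sets P)"

definition progressively_measurable :: "real \<Rightarrow> (real \<Rightarrow> 'w measure) \<Rightarrow> 'w process \<Rightarrow> bool" where
  "progressively_measurable T F a \<longleftrightarrow>
     (\<forall>t\<in>{0..T}. (\<lambda>(s, w). a s w) \<in> borel_measurable (restrict_space borel {0..t} \<Otimes>\<^sub>M F t))"

definition proc_eq :: "real \<Rightarrow> 'w measure \<Rightarrow> 'w process \<Rightarrow> 'w process \<Rightarrow> bool" where
  "proc_eq T P a b \<longleftrightarrow> (AE (t, w) in restrict_space lborel {0..T} \<Otimes>\<^sub>M P. a t w = b t w)"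

definition proc_space :: "real \<Rightarrow> 'w measure \<Rightarrow> (real \<Rightarrow> 'w measure) \<Rightarrow> 'w process set" where
  "proc_space T P F =
     {a. progressively_measurable T F a \<and>
         (\<integral>\<^sup>+t\<in>{0..T}. (\<integral>\<^sup>+w. ennreal ((a t w)\<^sup>2) \<partial>P) \<partial>lborel) < \<infinity>}"

definition proc_inner :: "real \<Rightarrow> 'w measure \<Rightarrow> 'w process \<Rightarrow> 'w process \<Rightarrow> real" where
  "proc_inner T P a b = (LINT t:{0..T}|lborel. (LINT w|P. a t w * b t w))"

definition proc_norm :: "real \<Rightarrow> 'w measure \<Rightarrow> 'w process \<Rightarrow> real" where
  "proc_norm T P a = sqrt (LINT t:{0..T}|lborel. (LINT w|P. (a t w)\<^sup>2))"

definition action_profiles ::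
  "real \<Rightarrow> 'w measure \<Rightarrow> (real \<Rightarrow> 'w measure) \<Rightarrow> real measure \<Rightarrow> 'w profile set" where
  "action_profiles T P F \<nu> =
     {a. (\<forall>x\<in>{0..1}. a x \<in> proc_space T P F) \<and>
         (\<lambda>(x, t, w). a x t w) \<in> borel_measurable (\<nu> \<Otimes>\<^sub>M (restrict_space borel {0..T} \<Otimes>\<^sub>M P)) \<and>
         (\<integral>\<^sup>+x. (\<integral>\<^sup>+t\<in>{0..T}. (\<integral>\<^sup>+w. ennreal ((a x t w)\<^sup>2) \<partial>P) \<partial>lborel) \<partial>\<nu>) < \<infinity>}"

definition profile_norm :: "real \<Rightarrow> 'w measure \<Rightarrow> real measure \<Rightarrow> 'w profile \<Rightarrow> real" where
  "profile_norm T P \<nu> a =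
     sqrt (LINT x|\<nu>. (LINT t:{0..T}|lborel. (LINT w|P. (a x t w)\<^sup>2)))"

definition profile_dist ::
  "real \<Rightarrow> 'w measure \<Rightarrow> real measure \<Rightarrow> 'w profile \<Rightarrow> 'w profile \<Rightarrow> real" where
  "profile_dist T P \<nu> a b = profile_norm T P \<nu> (\<lambda>x t w. a x t w - b x t w)"


section \<open>Graphon games and network games\<close>

type_synonym 'w utility = "'w process \<Rightarrow> 'w process \<Rightarrow> 'w process \<Rightarrow> real"

text \<open>
  A functional on (triples of) classes of processes is a functional on representatives that does
  not distinguish between a.e. equal processes. No measurability is demanded of the
  representatives, since the pointwise aggregate \<open>graphon_op\<close> below need only be a.e. equal to a
  progressively measurable process.
\<close>
definition respects_proc_eq :: "real \<Rightarrow> 'w measure \<Rightarrow> 'w utility \<Rightarrow> bool" where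
  "respects_proc_eq T P U \<longleftrightarrow>
     (\<forall>a a' z z' \<theta> \<theta>'. proc_eq T P a a' \<longrightarrow> proc_eq T P z z' \<longrightarrow> proc_eq T P \<theta> \<theta>' \<longrightarrow>
        U a z \<theta> = U a' z' \<theta>')"

definition graphon :: "(real \<Rightarrow> real \<Rightarrow> real) \<Rightarrow> bool" where
  "graphon W \<longleftrightarrow>
     (\<lambda>(x, y). W x y) \<in> borel_measurable (lebesgue_on ({0..1} \<times> {0..1})) \<and>
     (\<forall>x\<in>{0..1}. \<forall>y\<in>{0..1}. W x y = W y x \<and> 0 \<le> W x y \<and> W x y \<le> 1)"

definition graphon_op :: "real measure \<Rightarrow> (real \<Rightarrow> real \<Rightarrow> real) \<Rightarrow> 'w profile \<Rightarrow> 'w profile" where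
  "graphon_op \<nu> W a = (\<lambda>x t w. LINT y|\<nu>. W x y * a y t w)"

definition graphon_nash ::
  "real \<Rightarrow> 'w measure \<Rightarrow> (real \<Rightarrow> 'w measure) \<Rightarrow> real measure \<Rightarrow> (real \<Rightarrow> 'w process set) \<Rightarrow>
   'w utility \<Rightarrow> 'w profile \<Rightarrow> (real \<Rightarrow> real \<Rightarrow> real) \<Rightarrow> 'w profile \<Rightarrow> bool" where
  "graphon_nash T P F \<nu> Ax U \<theta> W a \<longleftrightarrow>
     a \<in> action_profiles T P F \<nu> \<and>
     (\<forall>x\<in>{0..1}. is_arg_max (\<lambda>b. U b (graphon_op \<nu> W a x) (\<theta> x)) (\<lambda>b. b \<in> Ax x) (a x))"

definition network_nash ::
  "'w process set \<Rightarrow> 'w utility \<Rightarrow> nat \<Rightarrow> (nat \<Rightarrow> 'w process) \<Rightarrow> (nat \<Rightarrow> nat \<Rightarrow> real) \<Rightarrow>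
   (nat \<Rightarrow> 'w process) \<Rightarrow> bool" where
  "network_nash A0 U N \<theta> H a \<longleftrightarrow>
     (\<forall>i\<in>{1..N}. is_arg_max
        (\<lambda>b. U b (\<lambda>t w. 1 / real N * (\<Sum>j=1..N. H i j * a j t w)) (\<theta> i)) (\<lambda>b. b \<in> A0) (a i))"

definition unique_network_nash ::
  "real \<Rightarrow> 'w measure \<Rightarrow> 'w process set \<Rightarrow> 'w utility \<Rightarrow> nat \<Rightarrow> (nat \<Rightarrow> 'w process) \<Rightarrow>
   (nat \<Rightarrow> nat \<Rightarrow> real) \<Rightarrow> (nat \<Rightarrow> 'w process) \<Rightarrow> bool" where
  "unique_network_nash T P A0 U N \<theta> H a \<longleftrightarrow>
     network_nash A0 U N \<theta> H a \<and>
     (\<forall>b. network_nash A0 U N \<theta> H b \<longrightarrow> (\<forall>i\<in>{1..N}. proc_eq T P (b i) (a i)))"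

definition cell :: "nat \<Rightarrow> nat \<Rightarrow> real set" where
  "cell N i = (if i < N then {(real i - 1) / real N ..< real i / real N}
               else {(real N - 1) / real N .. 1})"

definition step_profile :: "nat \<Rightarrow> (nat \<Rightarrow> 'w process) \<Rightarrow> 'w profile" where
  "step_profile N a = (\<lambda>x t w. \<Sum>i=1..N. indicator (cell N i) x * a i t w)"


section \<open>Assumptions on the game\<close>

definition gateaux_gradient ::
  "real \<Rightarrow> 'w measure \<Rightarrow> (real \<Rightarrow> 'w measure) \<Rightarrow> ('w process \<Rightarrow> real) \<Rightarrow>
   ('w process \<Rightarrow> 'w process) \<Rightarrow> bool" where
  "gateaux_gradient T P F V G \<longleftrightarrow>
     (\<forall>a\<in>proc_space T P F. G a \<in> proc_space T P F \<and>
        (\<forall>h\<in>proc_space T P F.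
           ((\<lambda>\<epsilon>. (V (\<lambda>t w. a t w + \<epsilon> * h t w) - V a) / \<epsilon>)
              \<longlongrightarrow> proc_inner T P (G a) h) (at 0)))"

definition proc_continuous ::
  "real \<Rightarrow> 'w measure \<Rightarrow> (real \<Rightarrow> 'w measure) \<Rightarrow> ('w process \<Rightarrow> 'w process) \<Rightarrow> bool" where
  "proc_continuous T P F G \<longleftrightarrow>
     (\<forall>a\<in>proc_space T P F. \<forall>s. (\<forall>n. s n \<in> proc_space T P F) \<longrightarrow>
        (\<lambda>n. proc_norm T P (\<lambda>t w. s n t w - a t w)) \<longlonglongrightarrow> 0 \<longrightarrow>
        (\<lambda>n. proc_norm T P (\<lambda>t w. G (s n) t w - G a t w)) \<longlonglongrightarrow> 0)"

definition proc_concave ::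
  "real \<Rightarrow> 'w measure \<Rightarrow> (real \<Rightarrow> 'w measure) \<Rightarrow> ('w process \<Rightarrow> real) \<Rightarrow> bool" where
  "proc_concave T P F V \<longleftrightarrow>
     (\<forall>a\<in>proc_space T P F. \<forall>b\<in>proc_space T P F. \<forall>u\<in>{0..1}.
        V (\<lambda>t w. (1 - u) * a t w + u * b t w) \<ge> (1 - u) * V a + u * V b)"

definition cond_utility ::
  "real \<Rightarrow> 'w measure \<Rightarrow> (real \<Rightarrow> 'w measure) \<Rightarrow> 'w utility \<Rightarrow> real \<Rightarrow> real \<Rightarrow> real \<Rightarrow> bool" where
  "cond_utility T P F U \<alpha>\<^sub>U l\<^sub>U l\<^sub>\<theta> \<longleftrightarrow>
     \<alpha>\<^sub>U > 0 \<and>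
     (\<forall>z\<in>proc_space T P F. \<forall>\<theta>\<in>proc_space T P F.
        proc_concave T P F (\<lambda>a. U a z \<theta> + \<alpha>\<^sub>U / 2 * (proc_norm T P a)\<^sup>2)) \<and>
     (\<exists>G. (\<forall>z\<in>proc_space T P F. \<forall>\<theta>\<in>proc_space T P F.
             gateaux_gradient T P F (\<lambda>a. U a z \<theta>) (\<lambda>a. G a z \<theta>) \<and>
             proc_continuous T P F (\<lambda>a. G a z \<theta>)) \<and>
          (\<forall>a\<in>proc_space T P F. \<forall>z1\<in>proc_space T P F. \<forall>z2\<in>proc_space T P F.
           \<forall>\<theta>1\<in>proc_space T P F. \<forall>\<theta>2\<in>proc_space T P F.
             proc_norm T P (\<lambda>t w. G a z1 \<theta>1 t w - G a z2 \<theta>2 t w)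
               \<le> l\<^sub>U * proc_norm T P (\<lambda>t w. z1 t w - z2 t w)
                 + l\<^sub>\<theta> * proc_norm T P (\<lambda>t w. \<theta>1 t w - \<theta>2 t w)))"

text \<open>
  Sequential closedness in the seminorm also makes a set of representatives saturated under a.e.
  equality, hence a set of classes.
\<close>
definition proc_closed ::
  "real \<Rightarrow> 'w measure \<Rightarrow> (real \<Rightarrow> 'w measure) \<Rightarrow> 'w process set \<Rightarrow> bool" where
  "proc_closed T P F S \<longleftrightarrow>
     (\<forall>s. \<forall>a\<in>proc_space T P F. (\<forall>n. s n \<in> S) \<longrightarrow>
        (\<lambda>n. proc_norm T P (\<lambda>t w. s n t w - a t w)) \<longlonglongrightarrow> 0 \<longrightarrow> a \<in> S)"

definition proc_convex :: "'w process set \<Rightarrow> bool" where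
  "proc_convex S \<longleftrightarrow>
     (\<forall>a\<in>S. \<forall>b\<in>S. \<forall>u\<in>{0..1}. (\<lambda>t w. (1 - u) * a t w + u * b t w) \<in> S)"

definition cond_action_sets ::
  "real \<Rightarrow> 'w measure \<Rightarrow> (real \<Rightarrow> 'w measure) \<Rightarrow> real measure \<Rightarrow> 'w utility \<Rightarrow>
   (real \<Rightarrow> 'w process set) \<Rightarrow> bool" where
  "cond_action_sets T P F \<nu> U Ax \<longleftrightarrow>
     (\<forall>x\<in>{0..1}. Ax x \<subseteq> proc_space T P F \<and> Ax x \<noteq> {} \<and>
                  proc_convex (Ax x) \<and> proc_closed T P F (Ax x)) \<and>
     (\<exists>z0\<in>proc_space T P F. \<exists>\<theta>0\<in>proc_space T P F. \<exists>p\<in>action_profiles T P F \<nu>.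
        \<forall>x\<in>{0..1}. is_arg_max (\<lambda>b. U b z0 \<theta>0) (\<lambda>b. b \<in> Ax x) (p x))"

text \<open>
  The blocks are intervals (of any kind), as in a partition of the interval \<open>[0,1]\<close>. With
  arbitrary sets as blocks, the indicator of every square \<open>S \<times> S\<close> would qualify with \<open>L = 0\<close>.
\<close>
definition blockwise_lipschitz :: "(real \<Rightarrow> real \<Rightarrow> real) \<Rightarrow> bool" where
  "blockwise_lipschitz W \<longleftrightarrow>
     (\<exists>L. \<exists>\<I>. finite \<I> \<and> partition_on {0..1} \<I> \<and> (\<forall>I\<in>\<I>. is_interval I) \<and>
        (\<forall>I\<in>\<I>. \<forall>J\<in>\<I>. \<forall>x\<in>I. \<forall>x'\<in>I. \<forall>y\<in>J. \<forall>y'\<in>J.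
           \<bar>W x y - W x' y'\<bar> \<le> L * (\<bar>x - x'\<bar> + \<bar>y - y'\<bar>)))"


section \<open>Random graphs sampled from a graphon\<close>

definition iid_uniform :: "'q measure \<Rightarrow> nat \<Rightarrow> (nat \<Rightarrow> 'q \<Rightarrow> real) \<Rightarrow> bool" where
  "iid_uniform Q N Y \<longleftrightarrow>
     prob_space.indep_vars Q (\<lambda>_. borel) Y {1..N} \<and>
     (\<forall>i\<in>{1..N}. distr Q borel (Y i) = uniform_measure lborel {0..1} \<and>
                  (\<forall>\<omega>\<in>space Q. Y i \<omega> \<in> {0..1}))"

text \<open>The \<open>i\<close>-th order statistic (\<open>1 \<le> i \<le> N\<close>) of the points \<open>Y\<^sub>1, \<dots>, Y\<^sub>N\<close>.\<close>
definition ordered_points :: "nat \<Rightarrow> (nat \<Rightarrow> 'q \<Rightarrow> real) \<Rightarrow> nat \<Rightarrow> 'q \<Rightarrow> real" where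
  "ordered_points N Y i \<omega> = sort (map (\<lambda>j. Y j \<omega>) [1..<Suc N]) ! (i - 1)"

definition weighted_graph ::
  "(real \<Rightarrow> real \<Rightarrow> real) \<Rightarrow> (nat \<Rightarrow> 'q \<Rightarrow> real) \<Rightarrow> 'q \<Rightarrow> nat \<Rightarrow> nat \<Rightarrow> real" where
  "weighted_graph W x \<omega> = (\<lambda>i j. W (x i \<omega>) (x j \<omega>))"

text \<open>
  \<open>E i j\<close>, for \<open>1 \<le> i < j \<le> N\<close>, is the event that \<open>{i, j}\<close> is an edge: given the points
  \<open>x\<^sub>1, \<dots>, x\<^sub>N\<close>, the edges are independent, and \<open>{i, j}\<close> is present with probability
  \<open>\<kappa> W(x\<^sub>i, x\<^sub>j)\<close>.
\<close>
definition simple_graph_edges ::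
  "'q measure \<Rightarrow> (real \<Rightarrow> real \<Rightarrow> real) \<Rightarrow> real \<Rightarrow> nat \<Rightarrow> (nat \<Rightarrow> 'q \<Rightarrow> real) \<Rightarrow>
   (nat \<Rightarrow> nat \<Rightarrow> 'q \<Rightarrow> bool) \<Rightarrow> bool" where
  "simple_graph_edges Q W \<kappa> N x E \<longleftrightarrow>
     (\<forall>i\<in>{1..N}. \<forall>j\<in>{i<..N}. E i j \<in> measurable Q (count_space UNIV)) \<and>
     (\<forall>B\<in>sets (PiM {1..N} (\<lambda>_. borel)). \<forall>e :: nat \<Rightarrow> nat \<Rightarrow> bool.
        measure Q {\<omega>\<in>space Q. (\<lambda>i\<in>{1..N}. x i \<omega>) \<in> B \<and>
                               (\<forall>i\<in>{1..N}. \<forall>j\<in>{i<..N}. E i j \<omega> = e i j)} =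
        (LINT \<omega>|Q. indicator B (\<lambda>i\<in>{1..N}. x i \<omega>) *
           (\<Prod>i=1..N. \<Prod>j\<in>{i<..N}. if e i j then \<kappa> * W (x i \<omega>) (x j \<omega>)
                                      else 1 - \<kappa> * W (x i \<omega>) (x j \<omega>))))"

definition simple_graph :: "(nat \<Rightarrow> nat \<Rightarrow> 'q \<Rightarrow> bool) \<Rightarrow> 'q \<Rightarrow> nat \<Rightarrow> nat \<Rightarrow> real" where
  "simple_graph E \<omega> = (\<lambda>i j. of_bool (i < j \<and> E i j \<omega> \<or> j < i \<and> E j i \<omega>))"

end

theory Submission
  imports Defs "HOL-Library.Function_Algebras"
begin

text \<open>
  Best responses are Lipschitz in the aggregate and in the heterogeneity process, with constants
  \<open>l\<^sub>U / \<alpha>\<^sub>U < 1\<close> and \<open>l\<^sub>\<theta> / \<alpha>\<^sub>U\<close>, since the utility is strongly concave. Network equilibria are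
  therefore fixed points of a contraction as soon as the operator norm of the normalised
  interaction matrix is close to at most one, and the distance between the graphon and the network
  equilibrium is controlled by the error of replacing the graphon by the sampled matrix.

  For the weighted graph this error is deterministic once the order statistics are close to the
  grid points \<open>i / N\<close>, which Hoeffding's inequality gives at scale \<open>d = (ln N / N)\<^bsup>1/2\<^esup>\<close>: away from a
  \<open>d\<close>-neighbourhood of the block end points the graphon is Lipschitz, and this neighbourhood
  contributes \<open>d\<^bsup>1/2\<^esup>\<close> to the \<open>L\<^sup>2\<close> error.

  For the simple graph the centred adjacency matrix is controlled by the expected trace of its
  \<open>2 k\<close>-th power with \<open>k\<close> of order \<open>ln N\<close>. Only closed walks using every edge at least twice contribute, at
  most \<open>\<kappa>\<close> per distinct edge. A step along a new edge has at most \<open>N\<close> choices and any other step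
  at most \<open>2 k\<close>, which bounds the expectation by \<open>N (8 k N \<kappa>)\<^sup>k\<close>.
\<close>

section \<open>Strongly concave maximisation in semi-inner-product spaces\<close>

text \<open>Processes are functions standing for classes, so only seminorms are available and limits
  or uniqueness hold up to \<open>proc_eq\<close>. Completeness, projection and fixed point
  arguments are therefore done by hand relative to a carrier set. There are two carriers, because
  the graphon aggregate is jointly but perhaps not progressively measurable: the ambient
  \<open>L2\<close> and its complete subspace \<open>proc_space T P F\<close>. Edge noise of a
  simple graph is in general small in operator norm only, not entrywise or in L1. The error is thus
  split through the step kernel with the sampled weights: row-wise L1 up to it, operator norm beyond
  it. The trace exceeds the squared norm power by up to a factor \<open>N\<close>, and Markov's
  inequality costs another \<open>N\<close> squared; with \<open>k\<close> of order
  \<open>ln N\<close> the \<open>k\<close>-th root of \<open>N\<close> cubed stays bounded. All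
  exceptional sets have probability of order \<open>1 / N\<close> squared. This is summable, so
  Borel-Cantelli applies, and it is eventually below any \<delta>, so one estimate with
  \<open>ln N\<close> serves all claims. Equilibria are picked by choice, and \<open>measure\<close>
  is 0 on nonmeasurable sets, so measurability of the equilibrium events needs its own
  argument.\<close>

instantiation "fun" :: (type, real_vector) real_vector
begin
definition scaleR_fun :: "real \<Rightarrow> ('a \<Rightarrow> 'b) \<Rightarrow> 'a \<Rightarrow> 'b" where "scaleR_fun c f = (\<lambda>x. c *\<^sub>R f x)"
instance by standard (auto simp: scaleR_fun_def fun_eq_iff algebra_simps)
end

lemma scaleR_fun_apply: "(c *\<^sub>R f) x = c *\<^sub>R f x"
  by (simp add: scaleR_fun_def)

lemma sum_fun_apply: "(\<Sum>i\<in>A. f i) x = (\<Sum>i\<in>A. f i x)"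
  for f :: "'i \<Rightarrow> 'a \<Rightarrow> 'b::comm_monoid_add"
  by (induction A rule: infinite_finite_induct) auto

text \<open>As default simp rules these would also rewrite eta-expanded occurrences of functions.\<close>

declare minus_apply [simp del] plus_fun_apply [simp del] zero_fun_apply [simp del]

lemmas fun_apply_simps = minus_apply plus_fun_apply zero_fun_apply scaleR_fun_apply sum_fun_apply

text \<open>The linearity laws are demanded only on the carrier \<open>S\<close>, because an
  integral that does not exist has the default value 0. Definiteness is absent: a.e. equal functions
  are at distance 0.\<close>

locale semi_inner =
  fixes S :: "'v::real_vector set" and ip :: "'v \<Rightarrow> 'v \<Rightarrow> real"
  assumes sub: "subspace S"
    and ip_commute: "ip x y = ip y x"
    and ip_add_left: "\<lbrakk>x \<in> S; y \<in> S; z \<in> S\<rbrakk> \<Longrightarrow> ip (x + y) z = ip x z + ip y z"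
    and ip_scale_left: "\<lbrakk>x \<in> S; z \<in> S\<rbrakk> \<Longrightarrow> ip (c *\<^sub>R x) z = c * ip x z"
    and ip_nonneg: "x \<in> S \<Longrightarrow> 0 \<le> ip x x"
begin

definition nrm :: "'v \<Rightarrow> real" where "nrm x = sqrt (ip x x)"

lemma closedS [simp, intro]:
  "x \<in> S \<Longrightarrow> y \<in> S \<Longrightarrow> x + y \<in> S" "x \<in> S \<Longrightarrow> c *\<^sub>R x \<in> S"
  "x \<in> S \<Longrightarrow> y \<in> S \<Longrightarrow> x - y \<in> S" "0 \<in> S" "x \<in> S \<Longrightarrow> - x \<in> S"
  using sub by (auto simp: subspace_add subspace_scale subspace_diff subspace_0 subspace_neg)

lemma ip_add_right: "\<lbrakk>x \<in> S; y \<in> S; z \<in> S\<rbrakk> \<Longrightarrow> ip z (x + y) = ip z x + ip z y"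
  by (metis ip_commute ip_add_left)

lemma ip_scale_right: "\<lbrakk>x \<in> S; z \<in> S\<rbrakk> \<Longrightarrow> ip z (c *\<^sub>R x) = c * ip z x"
  by (metis ip_commute ip_scale_left)

lemma ip_diff_left: "\<lbrakk>x \<in> S; y \<in> S; z \<in> S\<rbrakk> \<Longrightarrow> ip (x - y) z = ip x z - ip y z"
  using ip_add_left[of "x - y" y z] by simp

lemma ip_diff_right: "\<lbrakk>x \<in> S; y \<in> S; z \<in> S\<rbrakk> \<Longrightarrow> ip z (x - y) = ip z x - ip z y"
  by (metis ip_commute ip_diff_left)

lemmas ip_simps = ip_add_left ip_add_right ip_scale_left ip_scale_right ip_diff_left ip_diff_right

lemma nrm_sq: "x \<in> S \<Longrightarrow> (nrm x)\<^sup>2 = ip x x"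
  by (simp add: nrm_def ip_nonneg)

lemma nrm_nonneg [simp]: "x \<in> S \<Longrightarrow> 0 \<le> nrm x"
  by (simp add: nrm_def ip_nonneg)

lemma cauchy_schwarz: assumes "x \<in> S" "y \<in> S" shows "ip x y \<le> nrm x * nrm y"
proof -
  have *: "0 \<le> t\<^sup>2 * ip x x - 2 * t * ip x y + ip y y" for t
    using ip_nonneg[of "t *\<^sub>R x - y"] assms
    by (simp add: ip_simps ip_commute[of y x] power2_eq_square algebra_simps)
  have "(ip x y)\<^sup>2 \<le> ip x x * ip y y"
  proof (cases "ip x x = 0")
    case True
    \<comment> \<open>With \<open>ip x x = 0\<close> the quadratic in \<open>t\<close> is affine and
      stays nonnegative only if its slope vanishes; \<open>x = 0\<close> cannot be concluded
      here.\<close>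
    have "ip x y = 0"
    proof (rule ccontr)
      assume "ip x y \<noteq> 0"
      then show False using *[of "(ip y y + 1) / (2 * ip x y)"] True by simp
    qed
    then show ?thesis using True by simp
  next
    case False
    then have "ip x x > 0" using ip_nonneg[of x] assms by simp
    then show ?thesis using *[of "ip x y / ip x x"]
      by (simp add: field_simps power2_eq_square)
  qed
  then have "\<bar>ip x y\<bar> \<le> sqrt (ip x x * ip y y)"
    by (metis real_sqrt_abs real_sqrt_le_mono)
  then show ?thesis by (simp add: nrm_def real_sqrt_mult)
qed

lemma nrm_triangle: assumes "x \<in> S" "y \<in> S" shows "nrm (x + y) \<le> nrm x + nrm y"
proof -
  have "ip (x + y) (x + y) = ip x x + ip y y + 2 * ip x y"
    using assms by (simp add: ip_add_left ip_add_right ip_commute[of y x])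
  then have "(nrm (x + y))\<^sup>2 = (nrm x)\<^sup>2 + (nrm y)\<^sup>2 + 2 * ip x y"
    using assms by (simp add: nrm_sq)
  then have "(nrm (x + y))\<^sup>2 \<le> (nrm x + nrm y)\<^sup>2"
    using cauchy_schwarz[OF assms] by (simp add: power2_sum)
  then show ?thesis by (rule power2_le_imp_le) (use assms in auto)
qed

lemma nrm_scale: "x \<in> S \<Longrightarrow> nrm (c *\<^sub>R x) = \<bar>c\<bar> * nrm x"
  using real_sqrt_mult[of "c\<^sup>2" "ip x x"]
  by (simp add: nrm_def ip_scale_left ip_scale_right power2_eq_square mult.assoc)

lemma nrm_minus: "x \<in> S \<Longrightarrow> y \<in> S \<Longrightarrow> nrm (x - y) = nrm (y - x)"
  using nrm_scale[of "x - y" "-1"] by simp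

lemma nrm_diff_triangle: "x \<in> S \<Longrightarrow> y \<in> S \<Longrightarrow> z \<in> S \<Longrightarrow> nrm (x - z) \<le> nrm (x - y) + nrm (y - z)"
  using nrm_triangle[of "x - y" "y - z"] by simp

lemma ip_abs_le: "x \<in> S \<Longrightarrow> y \<in> S \<Longrightarrow> \<bar>ip x y\<bar> \<le> nrm x * nrm y"
  using cauchy_schwarz[of x y] cauchy_schwarz[of "(-1) *\<^sub>R x" y]
  by (simp only: nrm_scale ip_scale_left closedS) auto

text \<open>Direct method: \<open>mid\<close> makes a maximising sequence Cauchy, while
  \<open>sup\<close> bounds \<open>V\<close> above and also stands in for upper semicontinuity at
  the limit. Nearest points and best responses are both instances.\<close>

lemma strongly_concave_attains_max:
  assumes C: "C \<subseteq> S" "C \<noteq> {}"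
    and mid: "\<And>a b. a \<in> C \<Longrightarrow> b \<in> C \<Longrightarrow>
       \<exists>m\<in>C. V m \<ge> (V a + V b) / 2 + \<beta> * (nrm (a - b))\<^sup>2"
    and \<beta>: "\<beta> > 0"
    and sup: "\<And>a. a \<in> C \<Longrightarrow> \<exists>K\<ge>0. \<forall>b\<in>C. V b \<le> V a + K * nrm (b - a) - \<beta> * (nrm (b - a))\<^sup>2"
    and compl: "\<And>s. (\<And>n. s n \<in> C) \<Longrightarrow>
       (\<And>e. e > 0 \<Longrightarrow> \<exists>M. \<forall>m\<ge>M. \<forall>n\<ge>M. nrm (s m - s n) < e) \<Longrightarrow>
       \<exists>a\<in>C. (\<lambda>n. nrm (s n - a)) \<longlonglongrightarrow> 0"
  shows "\<exists>a\<in>C. \<forall>b\<in>C. V b \<le> V a"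
proof -
  obtain a0 where a0: "a0 \<in> C" using C by auto
  obtain K where K: "K \<ge> 0" "\<And>b. b \<in> C \<Longrightarrow> V b \<le> V a0 + K * nrm (b - a0) - \<beta> * (nrm (b - a0))\<^sup>2"
    using sup[OF a0] by auto
  have "V b \<le> V a0 + K\<^sup>2 / (4 * \<beta>)" if "b \<in> C" for b
  proof -
    have "K * r - \<beta> * r\<^sup>2 \<le> K\<^sup>2 / (4 * \<beta>)" for r
    proof -
      have "0 \<le> (2 * \<beta> * r - K)\<^sup>2" by simp
      then show ?thesis using \<beta> by (simp add: field_simps power2_eq_square)
    qed
    then show ?thesis using K(2)[OF that] by (smt (verit))
  qed
  then have bdd: "bdd_above (V ` C)" by (intro bdd_aboveI2) auto
  define v where "v = (SUP b\<in>C. V b)"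
  have le: "V b \<le> v" if "b \<in> C" for b unfolding v_def by (rule cSUP_upper[OF that bdd])
  have "\<exists>b\<in>C. V b > v - 1 / Suc n" for n :: nat
    using less_cSUP_iff[OF C(2) bdd, of "v - 1 / Suc n"] by (auto simp: v_def)
  then obtain s where s: "\<And>n. s n \<in> C" "\<And>n. V (s n) > v - 1 / Suc n" by metis
  have "\<exists>M. \<forall>m\<ge>M. \<forall>n\<ge>M. nrm (s m - s n) < e" if "e > 0" for e
  proof -
    have "\<beta> * e\<^sup>2 > 0" using \<beta> that by simp
    then obtain M where M: "1 / Suc M < \<beta> * e\<^sup>2"
      using nat_approx_posE by (metis of_nat_Suc)
    have "nrm (s m - s n) < e" if mn: "m \<ge> M" "n \<ge> M" for m n
    proof -
      obtain c where c: "c \<in> C" "V c \<ge> (V (s m) + V (s n)) / 2 + \<beta> * (nrm (s m - s n))\<^sup>2"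
        using mid[OF s(1) s(1)] by blast
      have "1 / Suc m \<le> 1 / Suc M" "1 / Suc n \<le> 1 / Suc M" using mn by (auto simp: field_simps)
      \<comment> \<open>The value at \<open>c\<close> is at most \<open>v\<close> and both end
        values exceed \<open>v - 1 / Suc M\<close>, so the gain from strong concavity is below
        \<open>1 / Suc M\<close>.\<close>
      then have "\<beta> * (nrm (s m - s n))\<^sup>2 < \<beta> * e\<^sup>2"
        using c le[OF c(1)] s(2)[of m] s(2)[of n] M by argo
      then have "(nrm (s m - s n))\<^sup>2 < e\<^sup>2" using \<beta> by simp
      then show ?thesis using \<open>e > 0\<close> using power2_less_imp_less by fastforce
    qed
    then show ?thesis by blast
  qed
  from compl[OF s(1) this] obtain a where a: "a \<in> C" "(\<lambda>n. nrm (s n - a)) \<longlonglongrightarrow> 0" by auto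
  obtain K' where K': "\<And>b. b \<in> C \<Longrightarrow> V b \<le> V a + K' * nrm (b - a) - \<beta> * (nrm (b - a))\<^sup>2"
    using sup[OF a(1)] by auto
  \<comment> \<open>The upper bound around the limit \<open>a\<close>, evaluated along the sequence,
    yields \<open>v \<le> V a\<close>.\<close>
  have "v - 1 / Suc n \<le> V a + K' * nrm (s n - a)" for n
  proof -
    have "0 \<le> \<beta> * (nrm (s n - a))\<^sup>2" using \<beta> by simp
    then show ?thesis using K'[OF s(1), of n] s(2)[of n] by linarith
  qed
  moreover have "(\<lambda>n. v - 1 / Suc n) \<longlonglongrightarrow> v - 0"
    by (intro tendsto_intros LIMSEQ_Suc lim_1_over_n[THEN LIMSEQ_Suc])
  moreover have "(\<lambda>n. V a + K' * nrm (s n - a)) \<longlonglongrightarrow> V a + K' * 0"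
    by (intro tendsto_intros a)
  ultimately have "v \<le> V a" using LIMSEQ_le[of "\<lambda>n. v - 1 / Suc n" "v - 0"] by auto
  then show ?thesis using le a(1) by force
qed

end

text \<open>Completeness is asked of \<open>H\<close>, while \<open>S\<close> may be larger:
  aggregates live in \<open>S\<close> and are projected onto \<open>H\<close>.\<close>

locale semi_hilbert = semi_inner S ip
  for S :: "'v::real_vector set" and ip +
  fixes H :: "'v set"
  assumes subH: "subspace H" and HS: "H \<subseteq> S"
    and complete: "(\<And>n. s n \<in> H) \<Longrightarrow>
       (\<And>e. e > 0 \<Longrightarrow> \<exists>M. \<forall>m\<ge>M. \<forall>n\<ge>M. nrm (s m - s n) < e) \<Longrightarrow>
       \<exists>a\<in>H. (\<lambda>n. nrm (s n - a)) \<longlonglongrightarrow> 0"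
begin

lemma closedH [simp, intro]:
  "x \<in> H \<Longrightarrow> y \<in> H \<Longrightarrow> x + y \<in> H" "x \<in> H \<Longrightarrow> c *\<^sub>R x \<in> H"
  "x \<in> H \<Longrightarrow> y \<in> H \<Longrightarrow> x - y \<in> H" "0 \<in> H"
  using subH by (auto simp: subspace_add subspace_scale subspace_diff subspace_0)

lemma H_imp_S [simp]: "x \<in> H \<Longrightarrow> x \<in> S" using HS by auto

text \<open>The nearest point of \<open>H\<close> maximises the strongly concave functional \<open>- \<parallel>\<cdot> - z\<parallel>\<^sup>2\<close>.\<close>

lemma orthogonal_projection:
  assumes z: "z \<in> S"
  shows "\<exists>p\<in>H. \<forall>h\<in>H. ip (z - p) h = 0"
proof -
  define V where "V a = - (nrm (a - z))\<^sup>2" for a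
  have "\<exists>a\<in>H. \<forall>b\<in>H. V b \<le> V a"
  proof (rule strongly_concave_attains_max[where \<beta> = "1/4"])
    fix a b assume ab: "a \<in> H" "b \<in> H"
    \<comment> \<open>The parallelogram law at the midpoint, with equality; hence the modulus
      \<open>1/4\<close>.\<close>
    show "\<exists>m\<in>H. V m \<ge> (V a + V b) / 2 + 1/4 * (nrm (a - b))\<^sup>2"
      by (rule bexI[of _ "(1/2) *\<^sub>R (a + b)"])
        (use ab z in \<open>simp_all add: V_def nrm_sq ip_simps ip_commute[of z a] ip_commute[of z b] ip_commute[of b a] field_simps\<close>)
  next
    fix a assume a: "a \<in> H"
    have "V b \<le> V a + 2 * nrm (a - z) * nrm (b - a) - 1/4 * (nrm (b - a))\<^sup>2" if b: "b \<in> H" for b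
    proof -
      have "V b = V a - 2 * ip (a - z) (b - a) - (nrm (b - a))\<^sup>2"
        using a b z by (simp add: V_def nrm_sq ip_simps ip_commute[of z a] ip_commute[of z b] ip_commute[of b a] field_simps)
      moreover have "\<bar>ip (a - z) (b - a)\<bar> \<le> nrm (a - z) * nrm (b - a)"
        using a b z by (intro ip_abs_le) auto
      moreover have "0 \<le> (nrm (b - a))\<^sup>2" by simp
      ultimately show ?thesis by linarith
    qed
    then show "\<exists>K\<ge>0. \<forall>b\<in>H. V b \<le> V a + K * nrm (b - a) - 1/4 * (nrm (b - a))\<^sup>2"
      using a z by (intro exI[of _ "2 * nrm (a - z)"]) auto
  qed (use HS complete in auto)
  then obtain p where p: "p \<in> H" "\<And>b. b \<in> H \<Longrightarrow> V b \<le> V p" by blast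
  have "ip (z - p) h = 0" if h: "h \<in> H" for h
  proof -
    \<comment> \<open>Moving the nearest point along \<open>h\<close> cannot bring it closer to
      \<open>z\<close>. A suitable \<open>e\<close> makes the linear term dominate; if
      \<open>ip h h = 0\<close>, the values 1 and -1 do.\<close>
    have *: "2 * e * ip (z - p) h \<le> e\<^sup>2 * ip h h" for e
    proof -
      have "(nrm (p + e *\<^sub>R h - z))\<^sup>2 = (nrm (p - z))\<^sup>2 - 2 * e * ip (z - p) h + e\<^sup>2 * ip h h"
        using p(1) h z
        by (simp add: nrm_sq ip_simps ip_commute[of z p] ip_commute[of z h] ip_commute[of h p] algebra_simps power2_eq_square[of e])
      then show ?thesis using p(2)[of "p + e *\<^sub>R h"] p(1) h by (simp add: V_def)
    qed
    show ?thesis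
    proof (cases "ip h h = 0")
      case True
      then show ?thesis using *[of 1] *[of "-1"] by simp
    next
      case False
      then have "ip h h > 0" using ip_nonneg[of h] h by simp
      then show ?thesis using *[of "ip (z - p) h / ip h h"]
        by (simp add: field_simps power2_eq_square mult_le_0_iff)
          (metis linorder_neqE_linordered_idom mult_neg_neg mult_pos_pos not_le)
    qed
  qed
  then show ?thesis using p(1) by blast
qed

section \<open>First-order conditions, existence and stability of maximisers\<close>

definition is_gradient :: "('v \<Rightarrow> real) \<Rightarrow> ('v \<Rightarrow> 'v) \<Rightarrow> bool" where
  "is_gradient V G \<longleftrightarrow> (\<forall>a\<in>H. G a \<in> H \<and>
      (\<forall>h\<in>H. ((\<lambda>e. (V (a + e *\<^sub>R h) - V a) / e) \<longlongrightarrow> ip (G a) h) (at 0)))"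

definition strongly_concave :: "real \<Rightarrow> ('v \<Rightarrow> real) \<Rightarrow> bool" where
  "strongly_concave \<alpha> V \<longleftrightarrow> (\<forall>a\<in>H. \<forall>b\<in>H. \<forall>u\<in>{0..1}.
     V ((1 - u) *\<^sub>R a + u *\<^sub>R b) + \<alpha> / 2 * (nrm ((1 - u) *\<^sub>R a + u *\<^sub>R b))\<^sup>2 \<ge>
       (1 - u) * (V a + \<alpha> / 2 * (nrm a)\<^sup>2) + u * (V b + \<alpha> / 2 * (nrm b)\<^sup>2))"

text \<open>Along a segment the squared norm falls short of its linear interpolation by
  \<open>u * (1 - u) * (nrm (b - a))\<^sup>2\<close>, which converts concavity of \<open>V\<close>
  plus the quadratic into concavity of \<open>V\<close> with a modulus.\<close>

lemma strongly_concaveD: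
  assumes "strongly_concave \<alpha> V" "a \<in> H" "b \<in> H" "0 \<le> u" "u \<le> 1"
  shows "V (a + u *\<^sub>R (b - a)) \<ge> (1 - u) * V a + u * V b + \<alpha> / 2 * u * (1 - u) * (nrm (b - a))\<^sup>2"
proof -
  have eq: "(1 - u) *\<^sub>R a + u *\<^sub>R b = a + u *\<^sub>R (b - a)" by (simp add: algebra_simps)
  have n: "(nrm (a + u *\<^sub>R (b - a)))\<^sup>2 = (1 - u) * (nrm a)\<^sup>2 + u * (nrm b)\<^sup>2 - u * (1 - u) * (nrm (b - a))\<^sup>2"
    using assms by (simp add: nrm_sq ip_simps ip_commute[of b a] algebra_simps)
  have "V (a + u *\<^sub>R (b - a)) + \<alpha> / 2 * (nrm (a + u *\<^sub>R (b - a)))\<^sup>2 \<ge>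
       (1 - u) * (V a + \<alpha> / 2 * (nrm a)\<^sup>2) + u * (V b + \<alpha> / 2 * (nrm b)\<^sup>2)"
    using assms unfolding strongly_concave_def eq[symmetric] by auto
  moreover have "(1 - u) * (V a + \<alpha> / 2 * A) + u * (V b + \<alpha> / 2 * B) - \<alpha> / 2 * ((1 - u) * A + u * B - u * (1 - u) * D)
      = (1 - u) * V a + u * V b + \<alpha> / 2 * u * (1 - u) * D" for A B D
    by (simp add: field_simps)
  ultimately show ?thesis unfolding n by (smt (verit))
qed

text \<open>The modulus inequality bounds the difference quotient at step \<open>e\<close> from
  below; the claim is its limit as \<open>e\<close> decreases to 0.\<close>

lemma supergradient:
  assumes "strongly_concave \<alpha> V" "is_gradient V G" "a \<in> H" "b \<in> H"
  shows "V b \<le> V a + ip (G a) (b - a) - \<alpha> / 2 * (nrm (b - a))\<^sup>2"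
proof -
  have lim: "((\<lambda>e. (V (a + e *\<^sub>R (b - a)) - V a) / e) \<longlongrightarrow> ip (G a) (b - a)) (at_right 0)"
    using assms unfolding is_gradient_def by (auto intro: tendsto_mono[OF at_le])
  have lim2: "((\<lambda>e. V b - V a + \<alpha> / 2 * (1 - e) * (nrm (b - a))\<^sup>2) \<longlongrightarrow> V b - V a + \<alpha> / 2 * (1 - 0) * (nrm (b - a))\<^sup>2) (at_right 0)"
    by (intro tendsto_intros)
  have "eventually (\<lambda>e. V b - V a + \<alpha> / 2 * (1 - e) * (nrm (b - a))\<^sup>2 \<le> (V (a + e *\<^sub>R (b - a)) - V a) / e) (at_right 0)"
  proof -
    have "eventually (\<lambda>e::real. 0 < e \<and> e < 1) (at_right 0)"
      by (auto simp: eventually_at_right_field intro!: exI[of _ 1])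
    then show ?thesis
    proof eventually_elim
      case (elim e)
      then have "V (a + e *\<^sub>R (b - a)) - V a \<ge> e * (V b - V a + \<alpha> / 2 * (1 - e) * (nrm (b - a))\<^sup>2)"
        using strongly_concaveD[OF assms(1,3,4), of e] by (simp add: algebra_simps)
      then show ?case using elim by (simp add: pos_le_divide_eq mult.commute)
    qed
  qed
  from tendsto_le[OF _ lim lim2 this] show ?thesis by simp
qed

lemma max_variational:
  assumes "is_gradient V G" "C \<subseteq> H" "a \<in> C" "b \<in> C" "\<And>c. c \<in> C \<Longrightarrow> V c \<le> V a"
    and conv: "\<And>u. u \<in> {0..1} \<Longrightarrow> (1 - u) *\<^sub>R a + u *\<^sub>R b \<in> C"
  shows "ip (G a) (b - a) \<le> 0"
proof -
  have H: "a \<in> H" "b \<in> H" using assms by auto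
  have lim: "((\<lambda>e. (V (a + e *\<^sub>R (b - a)) - V a) / e) \<longlongrightarrow> ip (G a) (b - a)) (at_right 0)"
    using assms H unfolding is_gradient_def by (auto intro: tendsto_mono[OF at_le])
  have "eventually (\<lambda>e::real. 0 < e \<and> e < 1) (at_right 0)"
    by (auto simp: eventually_at_right_field intro!: exI[of _ 1])
  then have "eventually (\<lambda>e. (V (a + e *\<^sub>R (b - a)) - V a) / e \<le> 0) (at_right 0)"
  proof eventually_elim
    case (elim e)
    have "(1 - e) *\<^sub>R a + e *\<^sub>R b = a + e *\<^sub>R (b - a)" by (simp add: algebra_simps)
    then have "V (a + e *\<^sub>R (b - a)) \<le> V a" using conv[of e] elim assms(5) by auto
    then show ?case using elim by (simp add: divide_nonpos_pos)
  qed
  from tendsto_upperbound[OF lim this] show ?thesis by simp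
qed

lemma argmax_exists:
  assumes V: "strongly_concave \<alpha> V" "is_gradient V G" "\<alpha> > 0"
    and C: "C \<subseteq> H" "C \<noteq> {}" "\<And>a b u. a \<in> C \<Longrightarrow> b \<in> C \<Longrightarrow> u \<in> {0..1} \<Longrightarrow> (1 - u) *\<^sub>R a + u *\<^sub>R b \<in> C"
    and closed: "\<And>s a. (\<And>n. s n \<in> C) \<Longrightarrow> a \<in> H \<Longrightarrow> (\<lambda>n. nrm (s n - a)) \<longlonglongrightarrow> 0 \<Longrightarrow> a \<in> C"
  shows "\<exists>a\<in>C. \<forall>b\<in>C. V b \<le> V a"
proof (rule strongly_concave_attains_max[where \<beta> = "\<alpha> / 8"])
  show "C \<subseteq> S" using C HS by auto
  fix a b assume ab: "a \<in> C" "b \<in> C"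
  have eq: "(1/2) *\<^sub>R (a + b) = a + (1/2) *\<^sub>R (b - a)" "(1/2) *\<^sub>R (a + b) = (1 - 1/2) *\<^sub>R a + (1/2) *\<^sub>R b"
    by (simp_all add: algebra_simps flip: scaleR_left_distrib)
  have "(1/2) *\<^sub>R (a + b) \<in> C" unfolding eq(2) using C(3)[OF ab, of "1/2"] by simp
  \<comment> \<open>The modulus \<open>\<alpha> / 2 * u * (1 - u)\<close> at \<open>u = 1/2\<close>
    is \<open>\<alpha> / 8\<close>.\<close>
  moreover have "V ((1/2) *\<^sub>R (a + b)) \<ge> (V a + V b) / 2 + \<alpha> / 8 * (nrm (a - b))\<^sup>2"
  proof -
    have "nrm (a - b) = nrm (b - a)" using ab C(1) by (intro nrm_minus) auto
    then show ?thesis unfolding eq(1) using strongly_concaveD[OF V(1), of a b "1/2"] ab C(1) by (auto simp: field_simps)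
  qed
  ultimately show "\<exists>m\<in>C. V m \<ge> (V a + V b) / 2 + \<alpha> / 8 * (nrm (a - b))\<^sup>2" by blast
next
  fix a assume a: "a \<in> C"
  then have aH: "a \<in> H" "G a \<in> H" using C(1) V(2) unfolding is_gradient_def by auto
  have "V b \<le> V a + nrm (G a) * nrm (b - a) - \<alpha> / 8 * (nrm (b - a))\<^sup>2" if "b \<in> C" for b
  proof -
    have "V b \<le> V a + ip (G a) (b - a) - \<alpha> / 2 * (nrm (b - a))\<^sup>2"
      using supergradient[OF V(1,2) aH(1)] that C(1) by auto
    moreover have "ip (G a) (b - a) \<le> nrm (G a) * nrm (b - a)"
      using aH that C(1) by (intro cauchy_schwarz) auto
    moreover have "\<alpha> / 8 * (nrm (b - a))\<^sup>2 \<le> \<alpha> / 2 * (nrm (b - a))\<^sup>2"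
      using V(3) by (intro mult_right_mono) auto
    ultimately show ?thesis by linarith
  qed
  then show "\<exists>K\<ge>0. \<forall>b\<in>C. V b \<le> V a + K * nrm (b - a) - \<alpha> / 8 * (nrm (b - a))\<^sup>2"
    using aH by (intro exI[of _ "nrm (G a)"]) auto
next
  fix s :: "nat \<Rightarrow> 'v" assume s: "\<And>n. s n \<in> C" and ca: "\<And>e. e > 0 \<Longrightarrow> \<exists>M. \<forall>m\<ge>M. \<forall>n\<ge>M. nrm (s m - s n) < e"
  have "s n \<in> H" for n using s C(1) by auto
  from complete[OF this ca] obtain a where a: "a \<in> H" "(\<lambda>n. nrm (s n - a)) \<longlonglongrightarrow> 0" by auto
  show "\<exists>a\<in>C. (\<lambda>n. nrm (s n - a)) \<longlonglongrightarrow> 0" using closed[OF s a] a(2) by (rule_tac bexI)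
qed (use V C in auto)

text \<open>The supergradient inequalities of \<open>V1\<close> at \<open>a1\<close> and
  \<open>a2\<close> add up to strong monotonicity. The variational inequality of \<open>V1\<close>
  removes the term with \<open>G1 a1\<close>, that of \<open>V2\<close> allows \<open>G2 a2\<close>
  to be subtracted, and dividing by \<open>nrm (a1 - a2)\<close> leaves the two gradients compared
  at the single point \<open>a2\<close>.\<close>

lemma argmax_stability:
  assumes V1: "strongly_concave \<alpha> V1" "is_gradient V1 G1"
    and V2: "is_gradient V2 G2" and \<alpha>: "\<alpha> > 0"
    and C: "C \<subseteq> H" "\<And>a b u. a \<in> C \<Longrightarrow> b \<in> C \<Longrightarrow> u \<in> {0..1} \<Longrightarrow> (1 - u) *\<^sub>R a + u *\<^sub>R b \<in> C"
    and a1: "a1 \<in> C" "\<And>b. b \<in> C \<Longrightarrow> V1 b \<le> V1 a1"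
    and a2: "a2 \<in> C" "\<And>b. b \<in> C \<Longrightarrow> V2 b \<le> V2 a2"
  shows "\<alpha> * nrm (a1 - a2) \<le> nrm (G1 a2 - G2 a2)"
proof -
  have H: "a1 \<in> H" "a2 \<in> H" "G1 a1 \<in> H" "G1 a2 \<in> H" "G2 a2 \<in> H"
    using a1 a2 C V1 V2 unfolding is_gradient_def by auto
  have 1: "ip (G1 a1) (a2 - a1) \<le> 0"
    by (rule max_variational[OF V1(2) C(1) a1(1) a2(1) a1(2)]) (use C a1 a2 in auto)
  have 2: "ip (G2 a2) (a1 - a2) \<le> 0"
    by (rule max_variational[OF V2 C(1) a2(1) a1(1) a2(2)]) (use C a1 a2 in auto)
  have m: "nrm (a2 - a1) = nrm (a1 - a2)" using H by (intro nrm_minus) auto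
  have "V1 a2 \<le> V1 a1 + ip (G1 a1) (a2 - a1) - \<alpha> / 2 * (nrm (a1 - a2))\<^sup>2"
    using supergradient[OF V1 H(1,2)] m by simp
  moreover have "V1 a1 \<le> V1 a2 + ip (G1 a2) (a1 - a2) - \<alpha> / 2 * (nrm (a1 - a2))\<^sup>2"
    using supergradient[OF V1 H(2,1)] by simp
  ultimately have "\<alpha> * (nrm (a1 - a2))\<^sup>2 \<le> ip (G1 a2) (a1 - a2)" using 1 by (simp add: field_simps)
  also have "\<dots> \<le> ip (G1 a2 - G2 a2) (a1 - a2)" using 2 H by (simp add: ip_simps)
  also have "\<dots> \<le> nrm (G1 a2 - G2 a2) * nrm (a1 - a2)" using H by (intro cauchy_schwarz) auto
  finally have *: "\<alpha> * nrm (a1 - a2) * nrm (a1 - a2) \<le> nrm (G1 a2 - G2 a2) * nrm (a1 - a2)"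
    by (simp add: power2_eq_square mult.assoc)
  show ?thesis
  proof (cases "nrm (a1 - a2) = 0")
    case True then show ?thesis using H by simp
  next
    case False
    moreover have "0 \<le> nrm (a1 - a2)" using H by (intro nrm_nonneg) auto
    ultimately have "nrm (a1 - a2) > 0" by simp
    then show ?thesis using * by simp
  qed
qed

end

section \<open>The Hilbert space of progressively measurable processes\<close>

lemma case_prod_fun_simps [simp]:
  "case_prod (f + g) p = case_prod f p + case_prod g p"
  "case_prod (f - g) p = case_prod f p - case_prod g p"
  "case_prod (c *\<^sub>R f) p = c * case_prod f p"
  "case_prod (0 :: 'a \<Rightarrow> 'b \<Rightarrow> real) = (\<lambda>p. 0)"
  for f g :: "'a \<Rightarrow> 'b \<Rightarrow> real"
  by (auto simp: fun_apply_simps split: prod.split)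

lemma case_prod_sum [simp]: "case_prod (\<Sum>i\<in>A. f i) p = (\<Sum>i\<in>A. case_prod (f i) p)"
  for f :: "'i \<Rightarrow> 'a \<Rightarrow> 'b \<Rightarrow> real"
  by (auto simp: fun_apply_simps split: prod.split)

lemma abs_mult_le_sum_squares: "\<bar>x * y\<bar> \<le> x\<^sup>2 + y\<^sup>2" for x y :: real
proof -
  have "2 * (\<bar>x\<bar> * \<bar>y\<bar>) \<le> x\<^sup>2 + y\<^sup>2" "0 \<le> \<bar>x\<bar> * \<bar>y\<bar>"
    using sum_squares_bound[of "\<bar>x\<bar>" "\<bar>y\<bar>"] by (simp_all add: mult.assoc)
  then show ?thesis unfolding abs_mult by linarith
qed

lemma sum_power2_le: "(x + y)\<^sup>2 \<le> 2 * x\<^sup>2 + 2 * y\<^sup>2" for x y :: real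
  using sum_squares_bound[of x y] by (simp add: power2_sum)

locale process_space =
  fixes T :: real and P :: "'w measure" and F :: "real \<Rightarrow> 'w measure"
  assumes T_pos: "T > 0" and prob_P: "prob_space P"
    and space_F: "t \<in> {0..T} \<Longrightarrow> space (F t) = space P"
    and sets_F: "t \<in> {0..T} \<Longrightarrow> sets (F t) \<subseteq> sets P"
begin

definition I :: "real measure" where "I = restrict_space lborel {0..T}"
definition Z :: "(real \<times> 'w) measure" where "Z = I \<Otimes>\<^sub>M P"

sublocale P: prob_space P by (rule prob_P)

sublocale I: finite_measure I
  by (rule finite_measureI) (use T_pos in \<open>simp add: I_def space_restrict_space emeasure_restrict_space\<close>)

sublocale IP: pair_sigma_finite I P ..

sublocale Z: finite_measure Z
  unfolding Z_def by (rule finite_measure_pair_measure) unfold_locales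

lemma sets_I: "sets I = sets (restrict_space borel {0..T})"
  unfolding I_def by (rule sets_restrict_space_cong) simp

lemma emeasure_Z: "emeasure Z (space Z) = ennreal T"
proof -
  have "space I \<in> sets I" by (rule sets.top)
  moreover have "emeasure I (space I) = ennreal T"
    using T_pos by (auto simp: I_def space_restrict_space emeasure_restrict_space)
  ultimately show ?thesis
    by (simp add: Z_def space_pair_measure P.emeasure_pair_measure_Times P.emeasure_space_1)
qed

lemma sets_Z: "sets Z = sets (restrict_space borel {0..T} \<Otimes>\<^sub>M P)"
  unfolding Z_def by (intro sets_pair_measure_cong sets_I refl)

text \<open>Joint instead of progressive measurability: this is the ambient space that contains the
  graphon aggregate.\<close>

definition L2 :: "'w process set" where
  "L2 = {f. case_prod f \<in> borel_measurable Z \<and> integrable Z (\<lambda>p. (case_prod f p)\<^sup>2)}"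

lemma L2_measurable [measurable_dest]: "f \<in> L2 \<Longrightarrow> case_prod f \<in> borel_measurable Z"
  and L2_integrable_sq: "f \<in> L2 \<Longrightarrow> integrable Z (\<lambda>p. (case_prod f p)\<^sup>2)"
  by (auto simp: L2_def)

lemma L2_integrable_mult:
  assumes "f \<in> L2" "g \<in> L2" shows "integrable Z (\<lambda>p. case_prod f p * case_prod g p)"
  by (rule Bochner_Integration.integrable_bound[of _ "\<lambda>p. (case_prod f p)\<^sup>2 + (case_prod g p)\<^sup>2"])
    (use assms L2_measurable L2_integrable_sq in \<open>auto simp: abs_mult_le_sum_squares\<close>)

lemma L2_bound:
  assumes "case_prod f \<in> borel_measurable Z" "integrable Z h" "AE p in Z. (case_prod f p)\<^sup>2 \<le> h p"
  shows "f \<in> L2"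
  unfolding L2_def using assms
  by (auto intro!: Bochner_Integration.integrable_bound[OF assms(2)])

lemma subspace_L2: "subspace L2"
proof (rule subspaceI)
  show "0 \<in> L2" by (simp add: L2_def)
next
  fix f g assume fg [measurable]: "f \<in> L2" "g \<in> L2"
  have "case_prod (f + g) = (\<lambda>p. case_prod f p + case_prod g p)" by (auto simp: fun_apply_simps)
  then show "f + g \<in> L2"
    by (intro L2_bound[of _ "\<lambda>p. 2 * (case_prod f p)\<^sup>2 + 2 * (case_prod g p)\<^sup>2"])
      (use fg in \<open>auto intro!: L2_integrable_sq simp: sum_power2_le\<close>)
next
  fix c f assume f [measurable]: "f \<in> L2"
  have "case_prod (c *\<^sub>R f) = (\<lambda>p. c * case_prod f p)" by (auto simp: fun_apply_simps)
  then show "c *\<^sub>R f \<in> L2"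
    by (intro L2_bound[of _ "\<lambda>p. c\<^sup>2 * (case_prod f p)\<^sup>2"])
      (use f in \<open>auto intro!: L2_integrable_sq simp: power_mult_distrib\<close>)
qed

lemma proc_inner_eq:
  assumes "f \<in> L2" "g \<in> L2"
  shows "proc_inner T P f g = (\<integral>p. case_prod f p * case_prod g p \<partial>Z)"
proof -
  have "(\<integral>p. case_prod f p * case_prod g p \<partial>Z) = (\<integral>t. (\<integral>w. f t w * g t w \<partial>P) \<partial>I)"
    using IP.integral_fst'[OF L2_integrable_mult[OF assms, unfolded Z_def]] by (simp add: Z_def)
  then show ?thesis
    by (simp add: proc_inner_def I_def integral_restrict_space set_lebesgue_integral_def)
qed

lemma proc_norm_def2: "proc_norm T P f = sqrt (proc_inner T P f f)"
  by (simp add: proc_norm_def proc_inner_def power2_eq_square)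

sublocale L2: semi_inner L2 "proc_inner T P"
proof
  show "subspace L2" by (rule subspace_L2)
  show "proc_inner T P x y = proc_inner T P y x" for x y
    by (simp add: proc_inner_def mult.commute)
  show "proc_inner T P (x + y) z = proc_inner T P x z + proc_inner T P y z"
    if "x \<in> L2" "y \<in> L2" "z \<in> L2" for x y z
  proof -
    have "x + y \<in> L2" using that subspace_L2 by (simp add: subspace_add)
    then show ?thesis using that by (simp add: proc_inner_eq L2_integrable_mult algebra_simps)
  qed
  show "proc_inner T P (c *\<^sub>R x) z = c * proc_inner T P x z"
    if "x \<in> L2" "z \<in> L2" for x z c
  proof -
    have "c *\<^sub>R x \<in> L2" using that subspace_L2 by (simp add: subspace_scale)
    then show ?thesis using that by (simp add: proc_inner_eq mult.assoc)
  qed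
  show "0 \<le> proc_inner T P x x" if "x \<in> L2" for x
    using that by (simp add: proc_inner_eq)
qed

lemma nrm_eq: "L2.nrm f = proc_norm T P f"
  by (simp add: L2.nrm_def proc_norm_def2)

lemma nrm_sq_eq: "f \<in> L2 \<Longrightarrow> (L2.nrm f)\<^sup>2 = (\<integral>p. (case_prod f p)\<^sup>2 \<partial>Z)"
  by (simp add: L2.nrm_sq proc_inner_eq) (simp add: power2_eq_square)

lemma nn_nrm_sq: "f \<in> L2 \<Longrightarrow> (\<integral>\<^sup>+p. ennreal ((case_prod f p)\<^sup>2) \<partial>Z) = ennreal ((L2.nrm f)\<^sup>2)"
  by (simp add: nrm_sq_eq nn_integral_eq_integral L2_integrable_sq)

lemma L2_iff_nn: "f \<in> L2 \<longleftrightarrow> case_prod f \<in> borel_measurable Z \<and>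
    (\<integral>\<^sup>+p. ennreal ((case_prod f p)\<^sup>2) \<partial>Z) < \<infinity>"
  by (auto simp: L2_def integrable_iff_bounded)

lemma nn_Z_iterated:
  assumes "case_prod f \<in> borel_measurable Z"
  shows "(\<integral>\<^sup>+t\<in>{0..T}. (\<integral>\<^sup>+w. ennreal ((f t w)\<^sup>2) \<partial>P) \<partial>lborel) = (\<integral>\<^sup>+p. ennreal ((case_prod f p)\<^sup>2) \<partial>Z)"
proof -
  have "(\<lambda>p. ennreal ((case_prod f p)\<^sup>2)) \<in> borel_measurable (I \<Otimes>\<^sub>M P)"
    using assms unfolding Z_def by measurable
  from P.nn_integral_fst[OF this] show ?thesis
    by (simp add: Z_def I_def nn_integral_restrict_space)
qed

text \<open>Progressivity at the final time \<open>T\<close> is enough, since \<open>F T\<close> is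
  contained in \<open>P\<close>.\<close>

lemma progressive_measurable_Z:
  assumes "progressively_measurable T F f" shows "case_prod f \<in> borel_measurable Z"
proof -
  have T: "T \<in> {0..T}" using T_pos by simp
  have 1: "case_prod f \<in> borel_measurable (restrict_space borel {0..T} \<Otimes>\<^sub>M F T)"
    using assms T unfolding progressively_measurable_def by auto
  have "(\<lambda>w. w) \<in> measurable P (F T)"
    using space_F[OF T] sets_F[OF T] by (intro measurableI) (auto intro: sets.Int_space_eq2 simp: Int_absorb2 sets.sets_into_space subset_iff)
  then have [measurable]: "snd \<in> measurable Z (F T)"
    unfolding Z_def using measurable_compose[OF measurable_snd] by fast
  have [measurable]: "fst \<in> measurable Z (restrict_space borel {0..T})"
    unfolding Z_def using sets_I measurable_fst[of I P] by (simp add: measurable_cong_sets[OF refl sets_I])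
  have "(\<lambda>p. (fst p, snd p)) \<in> measurable Z (restrict_space borel {0..T} \<Otimes>\<^sub>M F T)" by measurable
  from measurable_compose[OF this 1] show ?thesis by simp
qed

lemma proc_space_iff: "f \<in> proc_space T P F \<longleftrightarrow> progressively_measurable T F f \<and> f \<in> L2"
  using progressive_measurable_Z[of f] nn_Z_iterated[of f] by (auto simp: proc_space_def L2_iff_nn)

lemma subspace_proc_space: "subspace (proc_space T P F)"
proof (rule subspaceI)
  show "0 \<in> proc_space T P F"
    using subspace_0[OF subspace_L2] unfolding proc_space_iff progressively_measurable_def by simp
next
  fix f g assume fg: "f \<in> proc_space T P F" "g \<in> proc_space T P F"
  have *: "case_prod (f + g) = (\<lambda>p. case_prod f p + case_prod g p)" by (auto simp: fun_apply_simps)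
  have "(\<lambda>(s, w). (f + g) s w) \<in> borel_measurable (restrict_space borel {0..t} \<Otimes>\<^sub>M F t)" if "t \<in> {0..T}" for t
    unfolding * using fg that unfolding proc_space_iff progressively_measurable_def
    by (intro borel_measurable_add) auto
  then show "f + g \<in> proc_space T P F"
    using fg subspace_add[OF subspace_L2] unfolding proc_space_iff progressively_measurable_def by blast
next
  fix c f assume f: "f \<in> proc_space T P F"
  have *: "case_prod (c *\<^sub>R f) = (\<lambda>p. c * case_prod f p)" by (auto simp: fun_apply_simps)
  have "(\<lambda>(s, w). (c *\<^sub>R f) s w) \<in> borel_measurable (restrict_space borel {0..t} \<Otimes>\<^sub>M F t)" if "t \<in> {0..T}" for t
    unfolding * using f that unfolding proc_space_iff progressively_measurable_def
    by (intro borel_measurable_times) auto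
  then show "c *\<^sub>R f \<in> proc_space T P F"
    using f subspace_scale[OF subspace_L2] unfolding proc_space_iff progressively_measurable_def by blast
qed

text \<open>Cauchy-Schwarz against the constant process 1, whose norm is \<open>sqrt T\<close>. It
  turns mean-square bounds on increments into L1 bounds that can be summed pointwise in
  \<open>proc_space_complete\<close>.\<close>

lemma nn_abs_le:
  assumes "f \<in> L2" shows "(\<integral>\<^sup>+p. ennreal \<bar>case_prod f p\<bar> \<partial>Z) \<le> ennreal (L2.nrm f * sqrt T)"
proof -
  let ?g = "\<lambda>t w. \<bar>f t w\<bar>" and ?o = "\<lambda>t w. 1 :: real"
  have cg: "case_prod ?g = (\<lambda>p. \<bar>case_prod f p\<bar>)" by auto
  have co: "case_prod ?o = (\<lambda>p. 1)" by auto
  have g: "?g \<in> L2" using assms by (auto simp: L2_def cg)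
  have o: "?o \<in> L2" by (auto simp: L2_def co)
  have int: "integrable Z (\<lambda>p. \<bar>case_prod f p\<bar>)" using L2_integrable_mult[OF g o] by (simp add: cg co)
  have "measure Z (space Z) = T" using emeasure_Z T_pos by (simp add: measure_def)
  then have "L2.nrm ?o = sqrt T"
    using nrm_sq_eq[OF o] o L2.nrm_nonneg[OF o] by (simp add: co real_sqrt_unique)
  moreover have "L2.nrm ?g = L2.nrm f"
  proof (rule power2_eq_imp_eq)
    show "(L2.nrm ?g)\<^sup>2 = (L2.nrm f)\<^sup>2"
      unfolding nrm_sq_eq[OF g] nrm_sq_eq[OF assms] cg by simp
  qed (use L2.nrm_nonneg[OF g] L2.nrm_nonneg[OF assms] in auto)
  moreover have "(\<integral>p. \<bar>case_prod f p\<bar> \<partial>Z) = proc_inner T P ?g ?o"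
    using proc_inner_eq[OF g o] by (simp add: cg co)
  ultimately have "(\<integral>p. \<bar>case_prod f p\<bar> \<partial>Z) \<le> L2.nrm f * sqrt T"
    using L2.cauchy_schwarz[OF g o] by simp
  then show ?thesis using int by (simp add: nn_integral_eq_integral ennreal_leI)
qed

lemma nrm_0_iff_proc_eq:
  assumes "f \<in> L2" "g \<in> L2" shows "L2.nrm (f - g) = 0 \<longleftrightarrow> proc_eq T P f g"
proof -
  have d: "f - g \<in> L2" using assms by auto
  have "L2.nrm (f - g) = 0 \<longleftrightarrow> (\<integral>p. (case_prod (f - g) p)\<^sup>2 \<partial>Z) = 0"
    using nrm_sq_eq[OF d] L2.nrm_nonneg[OF d] by (metis power_zero_numeral zero_eq_power2)
  also have "\<dots> \<longleftrightarrow> (AE p in Z. (case_prod (f - g) p)\<^sup>2 = 0)"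
    by (rule integral_nonneg_eq_0_iff_AE) (use L2_integrable_sq[OF d] in auto)
  also have "\<dots> \<longleftrightarrow> proc_eq T P f g"
    unfolding proc_eq_def Z_def I_def by (simp add: case_prod_unfold fun_apply_simps)
  finally show ?thesis .
qed

text \<open>The Riesz-Fischer argument is repeated here because the limit has to be measurable for
  every \<open>F t\<close> on \<open>[0, t]\<close>; it must be an everywhere defined pointwise
  limit, not merely a class.\<close>

lemma proc_space_complete:
  fixes s :: "nat \<Rightarrow> 'w process"
  assumes s: "\<And>n. s n \<in> proc_space T P F"
    and cauchy: "\<And>e. e > 0 \<Longrightarrow> \<exists>M. \<forall>m\<ge>M. \<forall>n\<ge>M. L2.nrm (s m - s n) < e"
  shows "\<exists>a\<in>proc_space T P F. (\<lambda>n. L2.nrm (s n - a)) \<longlonglongrightarrow> 0"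
proof -
  have sL: "s n \<in> L2" for n using s proc_space_iff by auto
  note [measurable] = L2_measurable[OF sL]
  have "\<exists>M. \<forall>m\<ge>M. \<forall>n\<ge>M. L2.nrm (s m - s n) < (1/2) ^ k" for k :: nat by (rule cauchy) simp
  then obtain M where M: "\<And>k m n. m \<ge> M k \<Longrightarrow> n \<ge> M k \<Longrightarrow> L2.nrm (s m - s n) < (1/2) ^ k"
    by metis
  \<comment> \<open>The partial sums are a monotone substitute for \<open>M\<close>, so that
    \<open>r k\<close> and \<open>r (Suc k)\<close> both lie beyond \<open>M k\<close>; the summand
    \<open>k\<close> makes the indices unbounded.\<close>
  define r where "r k = k + (\<Sum>i\<le>k. M i)" for k
  have "M k \<le> (\<Sum>i\<le>k. M i)" for k by (rule member_le_sum) auto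
  then have rM: "r k \<ge> M k" "r (Suc k) \<ge> M k" "r k \<ge> k" for k
    unfolding r_def by (auto intro: trans_le_add2 le_SucI trans_le_add1)
  define d where "d k = s (r (Suc k)) - s (r k)" for k
  have dL: "d k \<in> L2" for k unfolding d_def using sL by auto
  note [measurable] = L2_measurable[OF dL]
  have "(\<integral>\<^sup>+p. (\<Sum>k. ennreal \<bar>case_prod (d k) p\<bar>) \<partial>Z) = (\<Sum>k. \<integral>\<^sup>+p. ennreal \<bar>case_prod (d k) p\<bar> \<partial>Z)"
    by (rule nn_integral_suminf) measurable
  also have "\<dots> \<le> (\<Sum>k. ennreal (sqrt T * (1/2) ^ k))"
  proof (rule suminf_le)
    fix k show "(\<integral>\<^sup>+p. ennreal \<bar>case_prod (d k) p\<bar> \<partial>Z) \<le> ennreal (sqrt T * (1/2) ^ k)"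
      using nn_abs_le[OF dL, of k] M[of k "r (Suc k)" "r k"] rM[of k] T_pos
      by (elim order_trans) (auto intro!: ennreal_leI simp: d_def mult.commute mult_left_mono)
  qed auto
  also have "\<dots> < \<infinity>"
    using T_pos by (subst suminf_ennreal2) (auto intro!: summable_mult)
  finally have "AE p in Z. (\<Sum>k. ennreal \<bar>case_prod (d k) p\<bar>) \<noteq> \<infinity>"
    by (intro nn_integral_PInf_AE) auto
  then have conv: "AE p in Z. convergent (\<lambda>k. case_prod (s (r k)) p)"
  proof eventually_elim
    case (elim p)
    then have "summable (\<lambda>k. \<bar>case_prod (d k) p\<bar>)"
      by (intro summable_suminf_not_top) (auto simp: top_ennreal_def)
    then have "summable (\<lambda>k. case_prod (d k) p)" by (rule summable_rabs_cancel)
    then have "convergent (\<lambda>n. \<Sum>k<n. case_prod (d k) p)" by (simp add: summable_iff_convergent)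
    moreover have "(\<Sum>k<n. case_prod (d k) p) = case_prod (s (r n)) p - case_prod (s (r 0)) p" for n
      by (cases p; induction n) (auto simp: d_def fun_apply_simps)
    ultimately have "convergent (\<lambda>n. (case_prod (s (r n)) p - case_prod (s (r 0)) p) + case_prod (s (r 0)) p)"
      by (intro convergent_add convergent_const) simp
    then show ?case by (cases p) simp
  qed
  \<comment> \<open>Where the subsequence diverges, \<open>lim\<close> is a fixed default value, so
    measurability for each \<open>F t\<close> follows without removing an exceptional set.\<close>
  define a where "a t w = lim (\<lambda>k. s (r k) t w)" for t w
  have ca: "case_prod a = (\<lambda>p. lim (\<lambda>k. case_prod (s (r k)) p))" by (auto simp: a_def)
  have "(\<lambda>(u, w). a u w) \<in> borel_measurable (restrict_space borel {0..t} \<Otimes>\<^sub>M F t)" if "t \<in> {0..T}" for t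
    unfolding ca
  proof (rule borel_measurable_lim_metric)
    show "case_prod (s (r i)) \<in> borel_measurable (restrict_space borel {0..t} \<Otimes>\<^sub>M F t)" for i
      using s[of "r i"] that unfolding proc_space_def progressively_measurable_def by auto
  qed
  then have prog: "progressively_measurable T F a" unfolding progressively_measurable_def by auto
  note [measurable] = progressive_measurable_Z[OF prog]
  \<comment> \<open>Fatou's lemma along the subsequence carries the Cauchy bound to the limit.
    Extended integrals are used because \<open>s m - a\<close> is not yet known to lie in
    \<open>L2\<close>.\<close>
  have fatou: "(\<integral>\<^sup>+p. ennreal ((case_prod (s m - a) p)\<^sup>2) \<partial>Z) \<le> ennreal (e\<^sup>2)"
    if e: "e > 0" "\<And>n. n \<ge> K \<Longrightarrow> L2.nrm (s m - s n) < e" for m e K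
  proof -
    have lim: "AE p in Z. (\<lambda>k. ennreal ((case_prod (s m - s (r k)) p)\<^sup>2)) \<longlonglongrightarrow> ennreal ((case_prod (s m - a) p)\<^sup>2)"
      using conv
    proof eventually_elim
      case (elim p)
      then have "(\<lambda>k. case_prod (s (r k)) p) \<longlonglongrightarrow> case_prod a p" by (simp add: ca convergent_LIMSEQ_iff)
      then show ?case by (cases p) (auto simp: fun_apply_simps intro!: tendsto_intros)
    qed
    have "(\<integral>\<^sup>+p. ennreal ((case_prod (s m - a) p)\<^sup>2) \<partial>Z) =
        (\<integral>\<^sup>+p. liminf (\<lambda>k. ennreal ((case_prod (s m - s (r k)) p)\<^sup>2)) \<partial>Z)"
    proof (rule nn_integral_cong_AE)
      show "AE p in Z. ennreal ((case_prod (s m - a) p)\<^sup>2) = liminf (\<lambda>k. ennreal ((case_prod (s m - s (r k)) p)\<^sup>2))"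
        using lim by eventually_elim (rule sym, rule lim_imp_Liminf, simp)
    qed
    also have "\<dots> \<le> liminf (\<lambda>k. \<integral>\<^sup>+p. ennreal ((case_prod (s m - s (r k)) p)\<^sup>2) \<partial>Z)"
      by (intro nn_integral_liminf measurable_compose[OF L2_measurable[OF L2.closedS(3)[OF sL sL]]])
        measurable
    also have "\<dots> \<le> ennreal (e\<^sup>2)"
    proof (rule Liminf_le)
      have "(\<integral>\<^sup>+p. ennreal ((case_prod (s m - s (r k)) p)\<^sup>2) \<partial>Z) \<le> ennreal (e\<^sup>2)" if "k \<ge> K" for k
      proof -
        have "L2.nrm (s m - s (r k)) < e" using e(2) that rM(3)[of k] by auto
        then have "(L2.nrm (s m - s (r k)))\<^sup>2 \<le> e\<^sup>2" using sL by (intro power_mono) auto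
        moreover have "s m - s (r k) \<in> L2" using sL by auto
        ultimately show ?thesis using nn_nrm_sq ennreal_leI by metis
      qed
      then show "\<forall>\<^sub>F k in sequentially. (\<integral>\<^sup>+p. ennreal ((case_prod (s m - s (r k)) p)\<^sup>2) \<partial>Z) \<le> ennreal (e\<^sup>2)"
        by (auto simp: eventually_sequentially)
    qed simp
    finally show ?thesis .
  qed
  have cs: "case_prod (s m - a) = (\<lambda>p. case_prod (s m) p - case_prod a p)" for m by (auto simp: fun_apply_simps)
  have diffL: "s m - a \<in> L2" if e: "e > 0" "\<And>n. n \<ge> K \<Longrightarrow> L2.nrm (s m - s n) < e" for m e K
  proof -
    have "(\<integral>\<^sup>+p. ennreal ((case_prod (s m - a) p)\<^sup>2) \<partial>Z) < \<infinity>"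
      using fatou[OF that, of K] by (rule le_less_trans) auto
    moreover have "case_prod (s m - a) \<in> borel_measurable Z" unfolding cs by measurable
    ultimately show ?thesis unfolding L2_iff_nn by blast
  qed
  obtain K1 where K1: "\<And>m n. m \<ge> K1 \<Longrightarrow> n \<ge> K1 \<Longrightarrow> L2.nrm (s m - s n) < 1" using cauchy[of 1] by auto
  have "s K1 - a \<in> L2" by (rule diffL[of 1 K1 K1]) (use K1 in auto)
  then have "s K1 - (s K1 - a) \<in> L2" using sL by (rule_tac L2.closedS)
  then have aL: "a \<in> L2" by simp
  have "(\<lambda>n. L2.nrm (s n - a)) \<longlonglongrightarrow> 0"
  proof (rule LIMSEQ_I)
    fix e :: real assume "e > 0"
    then obtain K where K: "\<And>m n. m \<ge> K \<Longrightarrow> n \<ge> K \<Longrightarrow> L2.nrm (s m - s n) < e / 2" using cauchy[of "e / 2"] by auto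
    have "norm (L2.nrm (s m - a) - 0) < e" if "m \<ge> K" for m
    proof -
      have d: "s m - a \<in> L2" using sL aL by auto
      have "ennreal ((L2.nrm (s m - a))\<^sup>2) \<le> ennreal ((e/2)\<^sup>2)"
        using fatou[of "e/2" K m] K that \<open>e > 0\<close> nn_nrm_sq[OF d] by auto
      then have "(L2.nrm (s m - a))\<^sup>2 \<le> (e/2)\<^sup>2" by simp
      then have "L2.nrm (s m - a) \<le> e/2" by (rule power2_le_imp_le) (use \<open>e > 0\<close> in simp)
      then show ?thesis using L2.nrm_nonneg[OF d] \<open>e > 0\<close> by simp
    qed
    then show "\<exists>no. \<forall>n\<ge>no. norm (L2.nrm (s n - a) - 0) < e" by blast
  qed
  then show ?thesis using prog aL proc_space_iff by blast
qed

sublocale PS: semi_hilbert L2 "proc_inner T P" "proc_space T P F"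
proof
  show "subspace (proc_space T P F)" by (rule subspace_proc_space)
  show "proc_space T P F \<subseteq> L2" using proc_space_iff by auto
qed (rule proc_space_complete)

text \<open>The scalar bound is applied at each \<open>p\<close> to the numbers
  \<open>case_prod (b j) p\<close> and integrated, so an operator bound on real vectors holds for
  vectors of processes with the same constant.\<close>

lemma matrix_nrm_bound:
  fixes A :: "nat \<Rightarrow> nat \<Rightarrow> real"
  assumes A: "\<And>u :: nat \<Rightarrow> real. (\<Sum>i=1..N. (\<Sum>j=1..N. A i j * u j)\<^sup>2) \<le> \<tau>\<^sup>2 * (\<Sum>j=1..N. (u j)\<^sup>2)"
    and b: "\<And>j. j \<in> {1..N} \<Longrightarrow> b j \<in> L2"
  shows "(\<Sum>i=1..N. (L2.nrm (\<Sum>j=1..N. A i j *\<^sub>R b j))\<^sup>2) \<le> \<tau>\<^sup>2 * (\<Sum>j=1..N. (L2.nrm (b j))\<^sup>2)"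
proof -
  have c: "(\<Sum>j=1..N. A i j *\<^sub>R b j) \<in> L2" for i
    using b by (intro subspace_sum[OF subspace_L2] subspace_scale[OF subspace_L2]) auto
  have "(\<Sum>i=1..N. (L2.nrm (\<Sum>j=1..N. A i j *\<^sub>R b j))\<^sup>2)
      = (\<integral>p. (\<Sum>i=1..N. (\<Sum>j=1..N. A i j * case_prod (b j) p)\<^sup>2) \<partial>Z)"
  proof -
    have "(\<Sum>i=1..N. (L2.nrm (\<Sum>j=1..N. A i j *\<^sub>R b j))\<^sup>2)
      = (\<Sum>i=1..N. \<integral>p. (\<Sum>j=1..N. A i j * case_prod (b j) p)\<^sup>2 \<partial>Z)"
      by (intro sum.cong refl, subst nrm_sq_eq[OF c]) simp
    also have "\<dots> = (\<integral>p. (\<Sum>i=1..N. (\<Sum>j=1..N. A i j * case_prod (b j) p)\<^sup>2) \<partial>Z)"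
      using L2_integrable_sq[OF c] by (intro Bochner_Integration.integral_sum[symmetric]) simp
    finally show ?thesis .
  qed
  also have "\<dots> \<le> (\<integral>p. \<tau>\<^sup>2 * (\<Sum>j=1..N. (case_prod (b j) p)\<^sup>2) \<partial>Z)"
    using L2_integrable_sq[OF c] L2_integrable_sq[OF b] A by (intro integral_mono) auto
  also have "\<dots> = \<tau>\<^sup>2 * (\<Sum>j=1..N. (L2.nrm (b j))\<^sup>2)"
    using L2_integrable_sq[OF b] b by (simp add: nrm_sq_eq)
  finally show ?thesis .
qed

end

section \<open>Best responses and network equilibria\<close>

lemma (in semi_inner) geometric_imp_Cauchy:
  fixes s :: "nat \<Rightarrow> 'v"
  assumes s: "\<And>k. s k \<in> S" and q: "0 \<le> q" "q < 1" and D: "D \<ge> 0"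
    and step: "\<And>k. nrm (s (Suc k) - s k) \<le> q ^ k * D" and e: "e > 0"
  shows "\<exists>M. \<forall>m\<ge>M. \<forall>n\<ge>M. nrm (s m - s n) < e"
proof -
  have *: "nrm (s (n + k) - s n) \<le> (\<Sum>j<k. q ^ (n + j) * D)" for n k
  proof (induction k)
    case 0
    show ?case using s[of n] nrm_scale[of "s n" 0] by simp
  next
    case (Suc k)
    then show ?case using nrm_diff_triangle[OF s s s, of "n + Suc k" n "n + k"] step[of "n + k"] by simp
  qed
  have b: "nrm (s (n + k) - s n) \<le> q ^ n * (D / (1 - q))" for n k
  proof -
    have "(\<Sum>j<k. q ^ (n + j) * D) = q ^ n * D * (\<Sum>j<k. q ^ j)"
      by (simp add: power_add sum_distrib_left mult_ac)
    also have "\<dots> \<le> q ^ n * D * (1 / (1 - q))"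
      using q D by (intro mult_left_mono) (simp_all add: sum_gp_strict divide_right_mono)
    finally show ?thesis using *[of n k] by simp
  qed
  have "(\<lambda>n. q ^ n * (D / (1 - q))) \<longlonglongrightarrow> 0 * (D / (1 - q))"
    using q by (intro tendsto_intros LIMSEQ_realpow_zero)
  then obtain M where M: "\<And>n. n \<ge> M \<Longrightarrow> q ^ n * (D / (1 - q)) < e"
    using order_tendstoD(2)[of _ "0 * (D / (1 - q))" sequentially e] e
    unfolding eventually_sequentially mult_zero_left by blast
  have "nrm (s m - s n) < e" if "m \<ge> n" "n \<ge> M" for m n
    using b[of n "m - n"] M[of n] that by simp
  then have "nrm (s m - s n) < e" if "m \<ge> M" "n \<ge> M" for m n
    using that nrm_minus[OF s s, of m n] by (cases "m \<ge> n") force+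
  then show ?thesis by blast
qed

locale game = process_space T P F for T :: real and P :: "'w measure" and F +
  fixes U :: "'w utility" and \<alpha> lU l\<theta> M :: real and A0 :: "'w process set"
  assumes respects: "respects_proc_eq T P U"
    and A1: "cond_utility T P F U \<alpha> lU l\<theta>"
    and A0_sub: "A0 \<subseteq> proc_space T P F" and A0_ne: "A0 \<noteq> {}"
    and A0_convex: "proc_convex A0" and A0_closed: "proc_closed T P F A0"
    and A0_bound: "a \<in> A0 \<Longrightarrow> proc_norm T P a \<le> M"
    and A5: "lU < \<alpha>"
begin

abbreviation HH :: "'w process set" where "HH \<equiv> proc_space T P F"
abbreviation nrm :: "'w process \<Rightarrow> real" where "nrm \<equiv> L2.nrm"

lemma HH_L2 [simp]: "a \<in> HH \<Longrightarrow> a \<in> L2" using proc_space_iff by blast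
lemma A0_HH [simp]: "a \<in> A0 \<Longrightarrow> a \<in> HH" using A0_sub by blast
lemma A0_nrm: "a \<in> A0 \<Longrightarrow> nrm a \<le> M" using A0_bound by (simp add: nrm_eq)

lemma M_nonneg: "0 \<le> M"
proof -
  obtain a where "a \<in> A0" using A0_ne by blast
  then have "0 \<le> nrm a" "nrm a \<le> M" using A0_nrm by (auto intro!: L2.nrm_nonneg)
  then show ?thesis by linarith
qed

lemma nrm_zero [simp]: "nrm 0 = 0" using L2.nrm_scale[of 0 0] by simp

lemma \<alpha>_pos: "\<alpha> > 0" using A1 by (simp add: cond_utility_def)

lemma convexA0: "\<lbrakk>a \<in> A0; b \<in> A0; u \<in> {0..1}\<rbrakk> \<Longrightarrow> (1 - u) *\<^sub>R a + u *\<^sub>R b \<in> A0"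
proof -
  assume ab: "a \<in> A0" "b \<in> A0" "u \<in> {0..1}"
  have e: "(1 - u) *\<^sub>R a + u *\<^sub>R b = (\<lambda>t w. (1 - u) * a t w + u * b t w)" by (auto simp: fun_eq_iff fun_apply_simps)
  show ?thesis unfolding e by (rule A0_convex[unfolded proc_convex_def, rule_format, OF ab])
qed

lemma closedA0: "\<lbrakk>\<And>n. s n \<in> A0; a \<in> HH; (\<lambda>n. nrm (s n - a)) \<longlonglongrightarrow> 0\<rbrakk> \<Longrightarrow> a \<in> A0"
proof -
  assume a: "\<And>n. s n \<in> A0" "a \<in> HH" "(\<lambda>n. nrm (s n - a)) \<longlonglongrightarrow> 0"
  have "s n - a = (\<lambda>t w. s n t w - a t w)" for n by (auto simp: fun_eq_iff fun_apply_simps)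
  then have "(\<lambda>n. proc_norm T P (\<lambda>t w. s n t w - a t w)) \<longlonglongrightarrow> 0" using a(3) by (simp add: nrm_eq)
  then show ?thesis using A0_closed a unfolding proc_closed_def by blast
qed

lemma concave_U: "\<lbrakk>z \<in> HH; \<theta> \<in> HH\<rbrakk> \<Longrightarrow> PS.strongly_concave \<alpha> (\<lambda>a. U a z \<theta>)"
proof -
  assume "z \<in> HH" "\<theta> \<in> HH"
  then have *: "proc_concave T P F (\<lambda>a. U a z \<theta> + \<alpha> / 2 * (proc_norm T P a)\<^sup>2)"
    using A1 unfolding cond_utility_def by blast
  show ?thesis unfolding PS.strongly_concave_def
  proof (intro ballI)
    fix a b u assume ab: "a \<in> HH" "b \<in> HH" "u \<in> {0..1::real}"
    have e: "(1 - u) *\<^sub>R a + u *\<^sub>R b = (\<lambda>t w. (1 - u) * a t w + u * b t w)" by (auto simp: fun_eq_iff fun_apply_simps)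
    show "U ((1 - u) *\<^sub>R a + u *\<^sub>R b) z \<theta> + \<alpha> / 2 * (nrm ((1 - u) *\<^sub>R a + u *\<^sub>R b))\<^sup>2 \<ge>
       (1 - u) * (U a z \<theta> + \<alpha> / 2 * (nrm a)\<^sup>2) + u * (U b z \<theta> + \<alpha> / 2 * (nrm b)\<^sup>2)"
      unfolding e nrm_eq by (rule *[unfolded proc_concave_def, rule_format, OF ab])
  qed
qed

lemma gradient_U:
  "\<exists>G. (\<forall>z\<in>HH. \<forall>\<theta>\<in>HH. PS.is_gradient (\<lambda>a. U a z \<theta>) (\<lambda>a. G a z \<theta>)) \<and>
     (\<forall>a\<in>HH. \<forall>z1\<in>HH. \<forall>z2\<in>HH. \<forall>\<theta>1\<in>HH. \<forall>\<theta>2\<in>HH.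
        nrm (G a z1 \<theta>1 - G a z2 \<theta>2) \<le> lU * nrm (z1 - z2) + l\<theta> * nrm (\<theta>1 - \<theta>2))"
proof -
  obtain G where G1: "\<And>z \<theta>. z \<in> HH \<Longrightarrow> \<theta> \<in> HH \<Longrightarrow> gateaux_gradient T P F (\<lambda>a. U a z \<theta>) (\<lambda>a. G a z \<theta>)"
    and G2: "\<forall>a\<in>HH. \<forall>z1\<in>HH. \<forall>z2\<in>HH. \<forall>\<theta>1\<in>HH. \<forall>\<theta>2\<in>HH.
             proc_norm T P (\<lambda>t w. G a z1 \<theta>1 t w - G a z2 \<theta>2 t w)
               \<le> lU * proc_norm T P (\<lambda>t w. z1 t w - z2 t w)
                 + l\<theta> * proc_norm T P (\<lambda>t w. \<theta>1 t w - \<theta>2 t w)"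
    using A1 unfolding cond_utility_def by blast
  have e1: "a + e *\<^sub>R h = (\<lambda>t w. a t w + e * h t w)" for a h :: "'w process" and e by (auto simp: fun_eq_iff fun_apply_simps)
  have e2: "a - h = (\<lambda>t w. a t w - h t w)" for a h :: "'w process" by (auto simp: fun_eq_iff fun_apply_simps)
  show ?thesis
    using G1 G2 unfolding PS.is_gradient_def gateaux_gradient_def e1 e2 nrm_eq
    by (intro exI[of _ G] conjI) blast+
qed

definition best :: "'w process \<Rightarrow> 'w process \<Rightarrow> 'w process \<Rightarrow> bool" where
  "best z \<theta> a \<longleftrightarrow> is_arg_max (\<lambda>b. U b z \<theta>) (\<lambda>b. b \<in> A0) a"

lemma best_iff: "best z \<theta> a \<longleftrightarrow> a \<in> A0 \<and> (\<forall>b\<in>A0. U b z \<theta> \<le> U a z \<theta>)"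
  unfolding best_def is_arg_max_def by (auto simp: not_less)

lemma proc_eq_refl [simp]: "proc_eq T P a a"
  by (simp add: proc_eq_def)

text \<open>Lets the graphon aggregate be exchanged for an a.e. equal process in \<open>HH\<close>,
  where concavity and the gradient bound are available.\<close>

lemma best_cong: "proc_eq T P z z' \<Longrightarrow> proc_eq T P \<theta> \<theta>' \<Longrightarrow> best z \<theta> a \<Longrightarrow> best z' \<theta>' a"
proof -
  assume "proc_eq T P z z'" "proc_eq T P \<theta> \<theta>'" and b: "best z \<theta> a"
  then have "U c z \<theta> = U c z' \<theta>'" for c using respects unfolding respects_proc_eq_def by (meson proc_eq_refl)
  then show ?thesis using b by (simp add: best_iff)
qed

lemma best_exists: assumes "z \<in> HH" "\<theta> \<in> HH" shows "\<exists>a. best z \<theta> a"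
proof -
  obtain G where "PS.is_gradient (\<lambda>a. U a z \<theta>) (\<lambda>a. G a z \<theta>)" using gradient_U assms by blast
  have "\<exists>a\<in>A0. \<forall>b\<in>A0. U b z \<theta> \<le> U a z \<theta>"
    by (rule PS.argmax_exists[OF concave_U[OF assms] \<open>PS.is_gradient _ _\<close> \<alpha>_pos A0_sub A0_ne])
      (use convexA0 closedA0 in blast)+
  then show ?thesis by (auto simp: best_iff)
qed

lemma best_stability:
  assumes H: "z1 \<in> HH" "\<theta>1 \<in> HH" "z2 \<in> HH" "\<theta>2 \<in> HH" and b: "best z1 \<theta>1 a1" "best z2 \<theta>2 a2"
  shows "nrm (a1 - a2) \<le> lU / \<alpha> * nrm (z1 - z2) + l\<theta> / \<alpha> * nrm (\<theta>1 - \<theta>2)"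
proof -
  obtain G where G: "\<And>z \<theta>. z \<in> HH \<Longrightarrow> \<theta> \<in> HH \<Longrightarrow> PS.is_gradient (\<lambda>a. U a z \<theta>) (\<lambda>a. G a z \<theta>)"
    and L: "\<And>a z1 z2 \<theta>1 \<theta>2. \<lbrakk>a \<in> HH; z1 \<in> HH; z2 \<in> HH; \<theta>1 \<in> HH; \<theta>2 \<in> HH\<rbrakk> \<Longrightarrow>
        nrm (G a z1 \<theta>1 - G a z2 \<theta>2) \<le> lU * nrm (z1 - z2) + l\<theta> * nrm (\<theta>1 - \<theta>2)"
    using gradient_U by blast
  have "\<alpha> * nrm (a1 - a2) \<le> nrm (G a2 z1 \<theta>1 - G a2 z2 \<theta>2)"
    by (rule PS.argmax_stability[OF concave_U[OF H(1,2)] G[OF H(1,2)] G[OF H(3,4)] \<alpha>_pos A0_sub convexA0])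
      (use b in \<open>auto simp: best_iff\<close>)
  also have "\<dots> \<le> lU * nrm (z1 - z2) + l\<theta> * nrm (\<theta>1 - \<theta>2)"
    using b H by (intro L) (auto simp: best_iff)
  finally show ?thesis using \<alpha>_pos by (simp add: field_simps)
qed

lemma const_HH: "(\<lambda>t w. c) \<in> HH"
proof -
  have 0: "case_prod (\<lambda>t w. c) = (\<lambda>p. c)" by auto
  then have "(\<lambda>t w. c) \<in> L2" by (simp add: L2_def)
  then show ?thesis unfolding proc_space_iff progressively_measurable_def 0 by auto
qed

text \<open>The assumptions give no sign. Testing the Lipschitz bound on the constant processes 1
  and 0, which are at positive distance, forces both constants to be nonnegative.\<close>

lemma lipschitz_nonneg: "0 \<le> lU" "0 \<le> l\<theta>"
proof -
  let ?o = "(\<lambda>t w. 1) :: 'w process"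
  have o: "?o \<in> HH" "?o \<in> L2" "0 \<in> HH" using const_HH[of 1] by auto
  have "measure Z (space Z) = T" using emeasure_Z T_pos by (simp add: measure_def)
  then have "(nrm ?o)\<^sup>2 = T" using nrm_sq_eq[OF o(2)] by (simp add: case_prod_unfold)
  then have p: "nrm ?o > 0" using T_pos L2.nrm_nonneg[OF o(2)] by (cases "nrm ?o = 0") auto
  have z: "nrm (0 :: 'w process) = 0" using L2.nrm_scale[of 0 0] by simp
  obtain G where G: "\<And>z \<theta>. z \<in> HH \<Longrightarrow> \<theta> \<in> HH \<Longrightarrow> PS.is_gradient (\<lambda>a. U a z \<theta>) (\<lambda>a. G a z \<theta>)"
    and L: "\<And>a z1 z2 \<theta>1 \<theta>2. \<lbrakk>a \<in> HH; z1 \<in> HH; z2 \<in> HH; \<theta>1 \<in> HH; \<theta>2 \<in> HH\<rbrakk> \<Longrightarrow>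
        nrm (G a z1 \<theta>1 - G a z2 \<theta>2) \<le> lU * nrm (z1 - z2) + l\<theta> * nrm (\<theta>1 - \<theta>2)"
    using gradient_U by blast
  have GH: "G 0 z \<theta> \<in> HH" if "z \<in> HH" "\<theta> \<in> HH" for z \<theta>
    using G[OF that] o unfolding PS.is_gradient_def by blast
  have "0 \<le> nrm (G 0 ?o 0 - G 0 0 0)" "0 \<le> nrm (G 0 0 ?o - G 0 0 0)"
    by (rule L2.nrm_nonneg, rule L2.closedS, (rule HH_L2, rule GH, (rule o)+)+)+
  then have "0 \<le> lU * nrm ?o" "0 \<le> l\<theta> * nrm ?o"
    using L[of 0 ?o 0 0 0] L[of 0 0 0 ?o 0] o by (simp_all add: z)
  then show "0 \<le> lU" "0 \<le> l\<theta>" using p by (simp_all add: zero_le_mult_iff)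
qed

text \<open>The Lipschitz constant of the best response in the aggregate, below 1 by
  \<open>A5\<close>.\<close>

definition rr :: real where "rr = lU / \<alpha>"

lemma rr: "0 \<le> rr" "rr < 1"
  using lipschitz_nonneg \<alpha>_pos A5 by (auto simp: rr_def)

section \<open>Network aggregates and the best-response contraction\<close>

definition agg :: "nat \<Rightarrow> (nat \<Rightarrow> nat \<Rightarrow> real) \<Rightarrow> (nat \<Rightarrow> 'w process) \<Rightarrow> nat \<Rightarrow> 'w process" where
  "agg N H a i = (\<Sum>j=1..N. (H i j / real N) *\<^sub>R a j)"

lemma agg_eq: "(\<lambda>t w. 1 / real N * (\<Sum>j=1..N. H i j * a j t w)) = agg N H a i"
  by (simp add: agg_def fun_eq_iff fun_apply_simps sum_distrib_left)

lemma network_nash_iff: "network_nash A0 U N \<theta> H a \<longleftrightarrow> (\<forall>i\<in>{1..N}. best (agg N H a i) (\<theta> i) (a i))"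
  unfolding network_nash_def best_def agg_eq ..

lemma agg_HH: "(\<And>j. j \<in> {1..N} \<Longrightarrow> a j \<in> HH) \<Longrightarrow> agg N H a i \<in> HH"
  unfolding agg_def using PS.subH by (intro subspace_sum subspace_scale) auto

lemma agg_diff: "agg N H a i - agg N H b i = agg N H (\<lambda>j. a j - b j) i"
  by (simp add: agg_def scaleR_diff_right sum_subtractf)

lemma agg_diff_matrix: "agg N H a i - agg N H' a i = agg N (\<lambda>i j. H i j - H' i j) a i"
  by (simp add: agg_def diff_divide_distrib scaleR_diff_left sum_subtractf)

text \<open>An upper bound for the Euclidean operator norm of \<open>H / N\<close>. A relation
  instead of the norm itself, so that convenient bounds can be inserted and added.\<close>

definition op_bound :: "nat \<Rightarrow> (nat \<Rightarrow> nat \<Rightarrow> real) \<Rightarrow> real \<Rightarrow> bool" where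
  "op_bound N H \<tau> \<longleftrightarrow> 0 \<le> \<tau> \<and> (\<forall>u :: nat \<Rightarrow> real.
     (\<Sum>i=1..N. (\<Sum>j=1..N. H i j / real N * u j)\<^sup>2) \<le> \<tau>\<^sup>2 * (\<Sum>j=1..N. (u j)\<^sup>2))"

abbreviation vnorm :: "nat \<Rightarrow> (nat \<Rightarrow> 'w process) \<Rightarrow> real" where
  "vnorm N a \<equiv> L2_set (\<lambda>i. nrm (a i)) {1..N}"

lemma vnorm_agg:
  assumes "op_bound N H \<tau>" "\<And>j. j \<in> {1..N} \<Longrightarrow> a j \<in> L2"
  shows "vnorm N (agg N H a) \<le> \<tau> * vnorm N a"
proof -
  have "(\<Sum>i=1..N. (nrm (agg N H a i))\<^sup>2) \<le> \<tau>\<^sup>2 * (\<Sum>j=1..N. (nrm (a j))\<^sup>2)"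
    unfolding agg_def by (rule matrix_nrm_bound) (use assms in \<open>auto simp: op_bound_def\<close>)
  then have "sqrt (\<Sum>i=1..N. (nrm (agg N H a i))\<^sup>2) \<le> sqrt (\<tau>\<^sup>2 * (\<Sum>j=1..N. (nrm (a j))\<^sup>2))" by simp
  then show ?thesis using assms by (simp add: L2_set_def real_sqrt_mult op_bound_def)
qed

lemma nrm_sum_le: "finite J \<Longrightarrow> (\<And>j. j \<in> J \<Longrightarrow> a j \<in> L2) \<Longrightarrow> nrm (\<Sum>j\<in>J. a j) \<le> (\<Sum>j\<in>J. nrm (a j))"
proof (induction J rule: finite_induct)
  case empty
  show ?case unfolding sum.empty by (rule eq_refl, rule nrm_zero)
next
  case (insert x J)
  have "(\<Sum>j\<in>J. a j) \<in> L2" using insert by (intro subspace_sum[OF subspace_L2]) auto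
  then have "nrm (a x + (\<Sum>j\<in>J. a j)) \<le> nrm (a x) + nrm (\<Sum>j\<in>J. a j)"
    using insert by (intro L2.nrm_triangle) auto
  also have "\<dots> \<le> nrm (a x) + (\<Sum>j\<in>J. nrm (a j))" using insert by (intro add_left_mono) auto
  finally show ?case unfolding sum.insert[OF insert(1,2)] .
qed

lemma agg_entry_bound:
  assumes "\<And>j. j \<in> {1..N} \<Longrightarrow> a j \<in> A0" "\<And>j. j \<in> {1..N} \<Longrightarrow> \<bar>H i j\<bar> \<le> e" "N \<ge> 1"
  shows "nrm (agg N H a i) \<le> M * e"
proof -
  have "nrm (agg N H a i) \<le> (\<Sum>j=1..N. nrm ((H i j / real N) *\<^sub>R a j))"
    unfolding agg_def using assms by (intro nrm_sum_le) auto
  also have "\<dots> \<le> (\<Sum>j=1..N. M * e / real N)"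
  proof (rule sum_mono)
    fix j assume j: "j \<in> {1..N}"
    have "nrm ((H i j / real N) *\<^sub>R a j) = \<bar>H i j\<bar> / real N * nrm (a j)"
      using assms j by (simp add: L2.nrm_scale)
    also have "\<dots> \<le> e / real N * M"
      using assms(2)[OF j] A0_nrm[OF assms(1)[OF j]] assms(1)[OF j] by (intro mult_mono divide_right_mono) auto
    finally show "nrm ((H i j / real N) *\<^sub>R a j) \<le> M * e / real N" by (simp add: mult.commute)
  qed
  also have "\<dots> = M * e" using assms(3) by simp
  finally show ?thesis .
qed

lemma vnorm_best_diff:
  assumes "\<And>i. i \<in> {1..N} \<Longrightarrow> z i \<in> HH" "\<And>i. i \<in> {1..N} \<Longrightarrow> z' i \<in> HH" "\<And>i. i \<in> {1..N} \<Longrightarrow> \<theta> i \<in> HH"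
    "\<And>i. i \<in> {1..N} \<Longrightarrow> best (z i) (\<theta> i) (a i)" "\<And>i. i \<in> {1..N} \<Longrightarrow> best (z' i) (\<theta> i) (a' i)"
  shows "vnorm N (\<lambda>i. a i - a' i) \<le> rr * vnorm N (\<lambda>i. z i - z' i)"
proof -
  have "vnorm N (\<lambda>i. a i - a' i) \<le> L2_set (\<lambda>i. rr * nrm (z i - z' i)) {1..N}"
  proof (rule L2_set_mono)
    fix i assume i: "i \<in> {1..N}"
    have "nrm (\<theta> i - \<theta> i) = 0" using L2.nrm_scale[of 0 0] by simp
    then show "nrm (a i - a' i) \<le> rr * nrm (z i - z' i)"
      using best_stability[OF assms(1,3,2,3,4,5)[OF i]] by (simp add: rr_def)
    have "a i \<in> A0" "a' i \<in> A0" using assms(4,5)[OF i] by (auto simp: best_iff)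
    then show "0 \<le> nrm (a i - a' i)" by (intro L2.nrm_nonneg) auto
  qed
  then show ?thesis unfolding L2_set_right_distrib[OF rr(1)] .
qed

text \<open>The aggregates differ by \<open>H\<close> applied to \<open>a - a'\<close>, absorbed
  since \<open>rr * \<tau> < 1\<close>, and by \<open>H - H'\<close> applied to \<open>a'\<close>,
  small since actions are bounded by \<open>M\<close>. With \<open>e = 0\<close> this is uniqueness;
  for general \<open>e\<close> it makes equilibria depend continuously on the matrix, which later
  gives measurability.\<close>

lemma network_perturbation:
  assumes N: "N \<ge> 1" and \<theta>: "\<And>i. i \<in> {1..N} \<Longrightarrow> \<theta> i \<in> HH"
    and H: "op_bound N H \<tau>" "rr * \<tau> < 1"
    and d: "\<And>i j. i \<in> {1..N} \<Longrightarrow> j \<in> {1..N} \<Longrightarrow> \<bar>H i j - H' i j\<bar> \<le> e"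
    and a: "network_nash A0 U N \<theta> H a" and a': "network_nash A0 U N \<theta> H' a'"
  shows "vnorm N (\<lambda>i. a i - a' i) \<le> rr * M * sqrt N / (1 - rr * \<tau>) * e"
proof -
  have A: "a i \<in> A0" "a' i \<in> A0" if "i \<in> {1..N}" for i
    using a a' that by (auto simp: network_nash_iff best_iff)
  have e: "0 \<le> e" using d[of 1 1] N by auto
  let ?D = "vnorm N (\<lambda>i. a i - a' i)"
  have 1: "?D \<le> rr * vnorm N (\<lambda>i. agg N H a i - agg N H' a' i)"
    by (rule vnorm_best_diff[of N _ _ \<theta>]) (use a a' A \<theta> in \<open>auto simp: network_nash_iff intro!: agg_HH\<close>)
  have "vnorm N (\<lambda>i. agg N H a i - agg N H' a' i) \<le>
      L2_set (\<lambda>i. nrm (agg N H (\<lambda>j. a j - a' j) i) + nrm (agg N (\<lambda>i j. H i j - H' i j) a' i)) {1..N}"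
  proof (rule L2_set_mono)
    fix i assume i: "i \<in> {1..N}"
    have h: "agg N H a i \<in> L2" "agg N H a' i \<in> L2" "agg N H' a' i \<in> L2"
      using A by (auto intro!: HH_L2 agg_HH)
    show "nrm (agg N H a i - agg N H' a' i) \<le> nrm (agg N H (\<lambda>j. a j - a' j) i) + nrm (agg N (\<lambda>i j. H i j - H' i j) a' i)"
      using L2.nrm_diff_triangle[OF h(1,2,3)] by (simp add: agg_diff agg_diff_matrix)
    show "0 \<le> nrm (agg N H a i - agg N H' a' i)" using h by (intro L2.nrm_nonneg) auto
  qed
  also have "\<dots> \<le> vnorm N (agg N H (\<lambda>j. a j - a' j)) + vnorm N (agg N (\<lambda>i j. H i j - H' i j) a')"
    by (rule L2_set_triangle_ineq)
  also have "vnorm N (agg N H (\<lambda>j. a j - a' j)) \<le> \<tau> * ?D"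
    using A by (intro vnorm_agg H) auto
  also have "vnorm N (agg N (\<lambda>i j. H i j - H' i j) a') \<le> L2_set (\<lambda>i. M * e) {1..N}"
    using A d N by (intro L2_set_mono agg_entry_bound L2.nrm_nonneg HH_L2 agg_HH) auto
  also have "L2_set (\<lambda>i. M * e) {1..N} = sqrt N * (M * e)"
    using M_nonneg e by (simp add: L2_set_constant)
  finally have 2: "vnorm N (\<lambda>i. agg N H a i - agg N H' a' i) \<le> \<tau> * ?D + sqrt N * (M * e)"
    by (rule order_trans) auto
  have "?D \<le> rr * (\<tau> * ?D + sqrt N * (M * e))"
    by (rule order_trans[OF 1 mult_left_mono[OF 2 rr(1)]])
  then have "?D * (1 - rr * \<tau>) \<le> rr * M * sqrt N * e" by (simp add: algebra_simps)
  then show ?thesis using H(2) by (simp add: field_simps)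
qed

lemma network_nash_unique:
  assumes N: "N \<ge> 1" and \<theta>: "\<And>i. i \<in> {1..N} \<Longrightarrow> \<theta> i \<in> HH"
    and H: "op_bound N H \<tau>" "rr * \<tau> < 1"
    and a: "network_nash A0 U N \<theta> H a"
  shows "unique_network_nash T P A0 U N \<theta> H a"
  unfolding unique_network_nash_def
proof (intro conjI allI impI ballI a)
  fix b i assume b: "network_nash A0 U N \<theta> H b" and i: "i \<in> {1..N}"
  have A: "a i \<in> A0" "b i \<in> A0" if "i \<in> {1..N}" for i
    using a b that by (auto simp: network_nash_iff best_iff)
  have "vnorm N (\<lambda>i. b i - a i) \<le> rr * M * sqrt N / (1 - rr * \<tau>) * 0"
    by (rule network_perturbation[OF N \<theta> H _ b a]) auto
  moreover have "nrm (b i - a i) \<le> vnorm N (\<lambda>i. b i - a i)"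
    using i by (intro member_le_L2_set) auto
  moreover have "0 \<le> nrm (b i - a i)" using A[OF i] by (intro L2.nrm_nonneg) auto
  ultimately have "nrm (b i - a i) = 0" by simp
  then show "proc_eq T P (b i) (a i)" using nrm_0_iff_proc_eq A[OF i] by simp
qed

text \<open>Banach iteration of a chosen best response \<open>B\<close>. The iterates converge in
  the seminorm, so the limit agrees with its best response only a.e., and optimality is transferred
  through \<open>respects\<close>.\<close>

lemma network_nash_exists:
  assumes N: "N \<ge> 1" and \<theta>: "\<And>i. i \<in> {1..N} \<Longrightarrow> \<theta> i \<in> HH"
    and H: "op_bound N H \<tau>" "rr * \<tau> < 1"
  shows "\<exists>a. network_nash A0 U N \<theta> H a"
proof -
  define B where "B a i = (SOME b. best (agg N H a i) (\<theta> i) b)" for a i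
  have B: "best (agg N H a i) (\<theta> i) (B a i)" if "i \<in> {1..N}" "\<And>j. j \<in> {1..N} \<Longrightarrow> a j \<in> A0" for a i
    unfolding B_def by (rule someI_ex[of "best (agg N H a i) (\<theta> i)"], rule best_exists)
      (use that \<theta> in \<open>auto intro!: agg_HH\<close>)
  obtain c0 where c0: "c0 \<in> A0" using A0_ne by blast
  define s where "s k = (B ^^ k) (\<lambda>_. c0)" for k
  have sA: "s k j \<in> A0" if "j \<in> {1..N}" for k j
    using that
  proof (induction k arbitrary: j)
    case (Suc k)
    then show ?case using B[of j "s k"] by (auto simp: best_iff s_def)
  qed (simp add: s_def c0)
  have sS: "s (Suc k) = B (s k)" for k by (simp add: s_def)
  define q where "q = rr * \<tau>"
  have q: "0 \<le> q" "q < 1" using rr H by (auto simp: q_def op_bound_def)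
  have contr: "vnorm N (\<lambda>i. B a i - B a' i) \<le> q * vnorm N (\<lambda>i. a i - a' i)"
    if "\<And>j. j \<in> {1..N} \<Longrightarrow> a j \<in> A0" "\<And>j. j \<in> {1..N} \<Longrightarrow> a' j \<in> A0" for a a'
  proof -
    have "vnorm N (\<lambda>i. B a i - B a' i) \<le> rr * vnorm N (\<lambda>i. agg N H a i - agg N H a' i)"
      by (rule vnorm_best_diff[of N _ _ \<theta>]) (use that \<theta> in \<open>auto intro!: agg_HH B\<close>)
    also have "\<dots> \<le> rr * (\<tau> * vnorm N (\<lambda>i. a i - a' i))"
      unfolding agg_diff using that rr by (intro mult_left_mono vnorm_agg H) auto
    finally show ?thesis by (simp add: q_def mult.assoc)
  qed
  define D where "D = vnorm N (\<lambda>i. s 1 i - s 0 i)"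
  have geo: "vnorm N (\<lambda>i. s (Suc k) i - s k i) \<le> q ^ k * D" for k
  proof (induction k)
    case (Suc k)
    have "vnorm N (\<lambda>i. s (Suc (Suc k)) i - s (Suc k) i) \<le> q * vnorm N (\<lambda>i. s (Suc k) i - s k i)"
      using contr[of "s (Suc k)" "s k", OF sA sA] by (simp only: sS)
    also have "\<dots> \<le> q * (q ^ k * D)" using Suc q by (intro mult_left_mono)
    finally show ?case by (simp add: mult.assoc)
  qed (simp add: D_def)
  have "\<exists>a\<in>HH. (\<lambda>k. nrm (s k i - a)) \<longlonglongrightarrow> 0" if i: "i \<in> {1..N}" for i
  proof (rule proc_space_complete)
    show "s k i \<in> HH" for k using sA i by auto
    fix e :: real assume "e > 0"
    show "\<exists>M. \<forall>m\<ge>M. \<forall>n\<ge>M. nrm (s m i - s n i) < e"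
    proof (rule L2.geometric_imp_Cauchy[where s = "\<lambda>k. s k i", OF _ q _ _ \<open>e > 0\<close>])
      show "s k i \<in> L2" for k using sA i by auto
      show "0 \<le> D" by (simp add: D_def)
      show "nrm (s (Suc k) i - s k i) \<le> q ^ k * D" for k
        by (rule order_trans[OF member_le_L2_set geo[of k]]) (use i in auto)
    qed
  qed
  then obtain a where a: "\<And>i. i \<in> {1..N} \<Longrightarrow> a i \<in> HH" "\<And>i. i \<in> {1..N} \<Longrightarrow> (\<lambda>k. nrm (s k i - a i)) \<longlonglongrightarrow> 0"
    by metis
  have aA: "a i \<in> A0" if "i \<in> {1..N}" for i
    by (rule closedA0[of "\<lambda>k. s k i"]) (use sA a that in auto)
  have lim0: "(\<lambda>k. vnorm N (\<lambda>i. s k i - a i)) \<longlonglongrightarrow> 0"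
  proof -
    have "(\<lambda>k. sqrt (\<Sum>i=1..N. (nrm (s k i - a i))\<^sup>2)) \<longlonglongrightarrow> sqrt (\<Sum>i=1..N. 0\<^sup>2)"
      by (intro tendsto_intros a(2)) auto
    then show ?thesis by (simp add: L2_set_def)
  qed
  \<comment> \<open>Both terms on the right tend to 0 as \<open>k\<close> grows, so \<open>a\<close>
    is a fixed point up to seminorm 0.\<close>
  have "vnorm N (\<lambda>i. B a i - a i) \<le> q * vnorm N (\<lambda>i. s k i - a i) + vnorm N (\<lambda>i. s (Suc k) i - a i)" for k
  proof -
    have BA: "B a i \<in> A0" if "i \<in> {1..N}" for i using B[OF that aA] by (auto simp: best_iff)
    have "vnorm N (\<lambda>i. B a i - a i) \<le> L2_set (\<lambda>i. nrm (B (s k) i - B a i) + nrm (s (Suc k) i - a i)) {1..N}"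
    proof (rule L2_set_mono)
      fix i assume i: "i \<in> {1..N}"
      have m: "B a i \<in> L2" "a i \<in> L2" "s (Suc k) i \<in> L2" using BA aA sA i by auto
      show "0 \<le> nrm (B a i - a i)" using m by (intro L2.nrm_nonneg) auto
      show "nrm (B a i - a i) \<le> nrm (B (s k) i - B a i) + nrm (s (Suc k) i - a i)"
        using L2.nrm_diff_triangle[OF m(1,3,2)] L2.nrm_minus[OF m(1,3)] by (simp add: s_def)
    qed
    also have "\<dots> \<le> vnorm N (\<lambda>i. B (s k) i - B a i) + vnorm N (\<lambda>i. s (Suc k) i - a i)"
      by (rule L2_set_triangle_ineq)
    also have "vnorm N (\<lambda>i. B (s k) i - B a i) \<le> q * vnorm N (\<lambda>i. s k i - a i)"
      using sA aA by (intro contr) auto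
    finally show ?thesis by simp
  qed
  moreover have "(\<lambda>k. q * vnorm N (\<lambda>i. s k i - a i) + vnorm N (\<lambda>i. s (Suc k) i - a i)) \<longlonglongrightarrow> q * 0 + 0"
    by (intro tendsto_intros lim0 LIMSEQ_Suc)
  ultimately have v0: "vnorm N (\<lambda>i. B a i - a i) \<le> 0"
    using LIMSEQ_le_const[of _ "q * 0 + 0"] by auto
  have "best (agg N H a i) (\<theta> i) (a i)" if i: "i \<in> {1..N}" for i
  proof -
    have b: "best (agg N H a i) (\<theta> i) (B a i)" using B[OF i aA] .
    then have BA: "B a i \<in> A0" by (simp add: best_iff)
    have "nrm (B a i - a i) \<le> 0"
      using v0 member_le_L2_set[of "{1..N}" i "\<lambda>i. nrm (B a i - a i)"] i by auto
    moreover have "0 \<le> nrm (B a i - a i)" using BA aA[OF i] by (intro L2.nrm_nonneg) auto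
    ultimately have "proc_eq T P (B a i) (a i)" using nrm_0_iff_proc_eq BA aA[OF i] by simp
    \<comment> \<open>\<open>a i\<close> need not be the representative selected by
      \<open>SOME\<close>, but it has the same utility.\<close>
    then have "U (B a i) (agg N H a i) (\<theta> i) = U (a i) (agg N H a i) (\<theta> i)"
      using respects unfolding respects_proc_eq_def by (meson proc_eq_refl)
    then show ?thesis using b aA[OF i] by (simp add: best_iff)
  qed
  then show ?thesis unfolding network_nash_iff by blast
qed

text \<open>The Frobenius norm of \<open>H / N\<close> is at most 1.\<close>

lemma op_bound_unit:
  assumes "\<And>i j. i \<in> {1..N} \<Longrightarrow> j \<in> {1..N} \<Longrightarrow> \<bar>H i j\<bar> \<le> 1"
  shows "op_bound N H 1"
  unfolding op_bound_def
proof (intro conjI allI)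
  fix u :: "nat \<Rightarrow> real"
  have "(\<Sum>j=1..N. H i j / real N * u j)\<^sup>2 \<le> (\<Sum>j=1..N. (u j)\<^sup>2) / real N" if "i \<in> {1..N}" for i
  proof -
    have "(\<Sum>j=1..N. H i j / real N * u j)\<^sup>2 \<le> (\<Sum>j=1..N. (H i j / real N)\<^sup>2) * (\<Sum>j=1..N. (u j)\<^sup>2)"
      by (rule Cauchy_Schwarz_ineq_sum)
    also have "(\<Sum>j=1..N. (H i j / real N)\<^sup>2) \<le> (\<Sum>j=1..N. 1 / (real N)\<^sup>2)"
      using assms[OF that] by (intro sum_mono) (auto simp: power_divide abs_square_le_1 divide_right_mono)
    also have "\<dots> = 1 / real N" by (simp add: power2_eq_square)
    finally show ?thesis by (simp add: mult_right_mono sum_nonneg)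
  qed
  then have "(\<Sum>i=1..N. (\<Sum>j=1..N. H i j / real N * u j)\<^sup>2) \<le> (\<Sum>i=1..N. (\<Sum>j=1..N. (u j)\<^sup>2) / real N)"
    by (intro sum_mono) auto
  also have "\<dots> \<le> 1\<^sup>2 * (\<Sum>j=1..N. (u j)\<^sup>2)" by (simp add: sum_nonneg)
  finally show "(\<Sum>i=1..N. (\<Sum>j=1..N. H i j / real N * u j)\<^sup>2) \<le> 1\<^sup>2 * (\<Sum>j=1..N. (u j)\<^sup>2)" .
qed simp

end

section \<open>Graphon aggregates and stability\<close>

lemma cell_subset: "i \<in> {1..N} \<Longrightarrow> cell N i \<subseteq> {0..1}"
proof -
  assume i: "i \<in> {1..N}"
  then have b: "0 \<le> (real i - 1) / real N" "real i / real N \<le> 1" by auto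
  show ?thesis
  proof
    fix x assume "x \<in> cell N i"
    then have "x \<ge> (real i - 1) / real N \<and> (x < real i / real N \<or> x \<le> 1)" using i by (auto simp: cell_def split: if_splits)
    then have "x \<ge> (real i - 1) / real N \<and> x \<le> 1" using b(2) by linarith
    then show "x \<in> {0..1}" using b(1) by auto
  qed
qed

lemma cell_cover: assumes "N \<ge> 1" "x \<in> {0..1}" shows "\<exists>i\<in>{1..N}. x \<in> cell N i"
proof -
  \<comment> \<open>The floor of \<open>N * x\<close> identifies the cell, except near 1, where the
    closed last cell takes over.\<close>
  define k where "k = nat \<lfloor>real N * x\<rfloor>"
  have k: "real k \<le> real N * x" "real N * x < real k + 1"
    using assms by (auto simp: k_def)
  show ?thesis
  proof (cases "k + 1 < N")
    case True
    then show ?thesis using k assms by (intro bexI[of _ "k + 1"]) (auto simp: cell_def field_simps)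
  next
    case False
    then have "real N \<le> real k + 1" by linarith
    then have "real N - 1 \<le> real N * x" using k by linarith
    then show ?thesis using k assms by (intro bexI[of _ N]) (auto simp: cell_def field_simps)
  qed
qed

lemma cell_disjoint: assumes "i \<in> {1..N}" "j \<in> {1..N}" "x \<in> cell N i" "x \<in> cell N j" shows "i = j"
proof -
  have *: False if "i < j" "j \<le> N" "x \<in> cell N i" "x \<in> cell N j" for i j
  proof -
    have "x < real i / real N" "(real j - 1) / real N \<le> x" using that by (auto simp: cell_def split: if_splits)
    moreover have "real i / real N \<le> (real j - 1) / real N" using that by (intro divide_right_mono) auto
    ultimately show False by linarith
  qed
  show ?thesis using *[of i j] *[of j i] assms by (cases i j rule: linorder_cases) auto
qed

lemma sum_indicator_cell:
  fixes g :: "nat \<Rightarrow> real"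
  assumes "i \<in> {1..N}" "x \<in> cell N i"
  shows "(\<Sum>j=1..N. indicator (cell N j) x * g j) = g i"
proof -
  have "(\<Sum>j=1..N. indicator (cell N j) x * g j) = (\<Sum>j=1..N. if j = i then g i else 0)"
    using assms cell_disjoint by (intro sum.cong) (auto simp: indicator_def)
  then show ?thesis using assms by simp
qed

lemma step_profile_cell: "i \<in> {1..N} \<Longrightarrow> x \<in> cell N i \<Longrightarrow> step_profile N a x = a i"
  unfolding step_profile_def by (intro ext) (rule sum_indicator_cell)

lemma cell_borel: "cell N i \<in> sets borel" by (simp add: cell_def)

lemma measure_cell: "i \<in> {1..N} \<Longrightarrow> emeasure lborel (cell N i) = ennreal (1 / real N)"
  by (auto simp: cell_def divide_right_mono field_simps)

locale graphon_game = game T P F U \<alpha> lU l\<theta> M A0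
  for T :: real and P :: "'w measure" and F U \<alpha> lU l\<theta> M A0 +
  fixes \<nu> :: "real measure"
  assumes ext_nu: "extends_lebesgue_unit_interval \<nu>"
begin

sublocale nu: prob_space \<nu> using ext_nu by (simp add: extends_lebesgue_unit_interval_def)

lemma space_nu: "space \<nu> = {0..1}" using ext_nu by (simp add: extends_lebesgue_unit_interval_def)

lemma borel_nu: assumes "A \<in> sets borel" "A \<subseteq> {0..1}" shows "A \<in> sets \<nu>" "emeasure \<nu> A = emeasure lborel A"
proof -
  have "A \<in> sets (lebesgue_on {0..1})" using assms by (auto simp: sets_restrict_space_iff)
  then show "A \<in> sets \<nu>" "emeasure \<nu> A = emeasure lborel A"
    using ext_nu assms by (auto simp: extends_lebesgue_unit_interval_def emeasure_completion)
qed

lemma measurable_nu: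
  fixes f :: "real \<Rightarrow> 'c::topological_space"
  assumes "f \<in> borel_measurable (restrict_space borel {0..1::real})" shows "f \<in> borel_measurable \<nu>"
proof (rule measurableI)
  fix A :: "'c set" assume A: "A \<in> sets borel"
  have "f -` A \<inter> {0..1} \<in> sets (restrict_space borel {0..1::real})"
    using measurable_sets[OF assms A] by (simp add: space_restrict_space)
  then show "f -` A \<inter> space \<nu> \<in> sets \<nu>" unfolding space_nu
    by (intro borel_nu) (auto simp: sets_restrict_space_iff)
qed simp

lemma cell_nu [measurable]: "i \<in> {1..N} \<Longrightarrow> cell N i \<in> sets \<nu>"
  using borel_nu[OF cell_borel cell_subset] by blast

lemma measure_nu_cell: "i \<in> {1..N} \<Longrightarrow> measure \<nu> (cell N i) = 1 / real N"
  using borel_nu(2)[OF cell_borel cell_subset] measure_cell[of i N] by (simp add: measure_def)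

section \<open>Square integrable profiles and rows of the graphon operator\<close>

sublocale NZ: pair_sigma_finite \<nu> Z ..

definition L2P :: "'w profile set" where
  "L2P = {f. (\<forall>x\<in>{0..1}. f x \<in> L2) \<and> (\<lambda>(x, p). case_prod (f x) p) \<in> borel_measurable (\<nu> \<Otimes>\<^sub>M Z) \<and>
     (\<integral>\<^sup>+x. ennreal ((nrm (f x))\<^sup>2) \<partial>\<nu>) < \<infinity>}"

lemma L2P_L2: "f \<in> L2P \<Longrightarrow> x \<in> {0..1} \<Longrightarrow> f x \<in> L2"
  and L2P_meas [measurable_dest]: "f \<in> L2P \<Longrightarrow> (\<lambda>(x, p). case_prod (f x) p) \<in> borel_measurable (\<nu> \<Otimes>\<^sub>M Z)"
  by (auto simp: L2P_def)

lemma action_profile_L2P: assumes "a \<in> action_profiles T P F \<nu>" shows "a \<in> L2P" "\<And>x. x \<in> {0..1} \<Longrightarrow> a x \<in> HH"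
proof -
  show H: "a x \<in> HH" if "x \<in> {0..1}" for x using assms that by (auto simp: action_profiles_def)
  have L: "a x \<in> L2" if "x \<in> {0..1}" for x using H[OF that] by simp
  have e: "(\<lambda>(x, t, w). a x t w) = (\<lambda>(x, p). case_prod (a x) p)" by auto
  have m: "(\<lambda>(x, p). case_prod (a x) p) \<in> borel_measurable (\<nu> \<Otimes>\<^sub>M Z)"
  proof -
    have "sets (\<nu> \<Otimes>\<^sub>M Z) = sets (\<nu> \<Otimes>\<^sub>M (restrict_space borel {0..T} \<Otimes>\<^sub>M P))"
      by (rule sets_pair_measure_cong[OF refl sets_Z])
    moreover have "(\<lambda>(x, t, w). a x t w) \<in> borel_measurable (\<nu> \<Otimes>\<^sub>M (restrict_space borel {0..T} \<Otimes>\<^sub>M P))"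
      using assms by (simp add: action_profiles_def)
    ultimately show ?thesis using measurable_cong_sets[OF _ refl] e by metis
  qed
  have "(\<integral>\<^sup>+x. (\<integral>\<^sup>+t\<in>{0..T}. (\<integral>\<^sup>+w. ennreal ((a x t w)\<^sup>2) \<partial>P) \<partial>lborel) \<partial>\<nu>) = (\<integral>\<^sup>+x. ennreal ((nrm (a x))\<^sup>2) \<partial>\<nu>)"
    by (intro nn_integral_cong) (simp add: space_nu nn_Z_iterated[OF L2_measurable[OF L]] nn_nrm_sq[OF L])
  then show "a \<in> L2P" using assms L m unfolding L2P_def action_profiles_def by auto
qed

lemma L2P_nrm_measurable: assumes "f \<in> L2P" shows "(\<lambda>x. nrm (f x)) \<in> borel_measurable \<nu>"
proof -
  have [measurable]: "(\<lambda>(x, p). case_prod (f x) p) \<in> borel_measurable (\<nu> \<Otimes>\<^sub>M Z)" using assms by (rule L2P_meas)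
  have "(\<lambda>x. sqrt (\<integral>p. (case_prod (f x) p)\<^sup>2 \<partial>Z)) \<in> borel_measurable \<nu>" by measurable
  moreover have "nrm (f x) = sqrt (\<integral>p. (case_prod (f x) p)\<^sup>2 \<partial>Z)" if "x \<in> space \<nu>" for x
    using L2P_L2[OF assms, of x] that L2.nrm_nonneg[of "f x"] by (simp add: space_nu nrm_sq_eq[symmetric])
  ultimately show ?thesis using measurable_cong[of \<nu>] by (metis (no_types, lifting))
qed

lemma L2P_nrm_sq_integrable: assumes "f \<in> L2P" shows "integrable \<nu> (\<lambda>x. (nrm (f x))\<^sup>2)"
  using L2P_nrm_measurable[OF assms] assms by (auto simp: integrable_iff_bounded L2P_def)

lemma L2P_nrm_integrable: assumes "f \<in> L2P" shows "integrable \<nu> (\<lambda>x. nrm (f x))"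
  using nu.square_integrable_imp_integrable[OF L2P_nrm_measurable[OF assms] L2P_nrm_sq_integrable[OF assms]] .

lemma profile_norm_eq: assumes "f \<in> L2P" shows "profile_norm T P \<nu> f = sqrt (\<integral>x. (nrm (f x))\<^sup>2 \<partial>\<nu>)"
proof -
  have "(\<integral>x. (nrm (f x))\<^sup>2 \<partial>\<nu>) = (LINT x|\<nu>. (LINT t:{0..T}|lborel. (LINT w|P. (f x t w)\<^sup>2)))"
    using L2P_L2[OF assms]
    by (intro Bochner_Integration.integral_cong refl)
      (simp add: space_nu L2.nrm_sq proc_inner_def power2_eq_square[of "f _ _ _"])
  then show ?thesis by (simp add: profile_norm_def)
qed

lemma L2P_diff: assumes "f \<in> L2P" "g \<in> L2P" shows "(\<lambda>x. f x - g x) \<in> L2P"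
proof -
  have L: "f x - g x \<in> L2" if "x \<in> {0..1}" for x using L2P_L2 that assms by auto
  have e: "(\<lambda>(x, p). case_prod (f x - g x) p) = (\<lambda>q. (\<lambda>(x, p). case_prod (f x) p) q - (\<lambda>(x, p). case_prod (g x) p) q)"
    by (auto simp: fun_apply_simps)
  have m: "(\<lambda>(x, p). case_prod (f x - g x) p) \<in> borel_measurable (\<nu> \<Otimes>\<^sub>M Z)"
    unfolding e by (intro borel_measurable_diff L2P_meas assms)
  have "(\<integral>\<^sup>+x. ennreal ((nrm (f x - g x))\<^sup>2) \<partial>\<nu>) < \<infinity>"
  proof -
    have "(nrm (f x - g x))\<^sup>2 \<le> 2 * (nrm (f x))\<^sup>2 + 2 * (nrm (g x))\<^sup>2" if "x \<in> {0..1}" for x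
    proof -
      have l: "f x \<in> L2" "g x \<in> L2" using L2P_L2 that assms by auto
      have z: "(0 :: 'w process) \<in> L2" by auto
      have "nrm (f x - g x) \<le> nrm (f x) + nrm (g x)"
        using L2.nrm_diff_triangle[OF l(1) z l(2)] L2.nrm_minus[OF z l(2)] by simp
      then have "(nrm (f x - g x))\<^sup>2 \<le> (nrm (f x) + nrm (g x))\<^sup>2" using L[OF that] by (intro power_mono) auto
      then show ?thesis using sum_power2_le[of "nrm (f x)" "nrm (g x)"] by linarith
    qed
    then have "(\<integral>\<^sup>+x. ennreal ((nrm (f x - g x))\<^sup>2) \<partial>\<nu>) \<le> (\<integral>\<^sup>+x. ennreal (2 * (nrm (f x))\<^sup>2 + 2 * (nrm (g x))\<^sup>2) \<partial>\<nu>)"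
      by (intro nn_integral_mono ennreal_leI) (simp add: space_nu)
    also have "\<dots> < \<infinity>"
      using assms[THEN L2P_nrm_sq_integrable] by (subst nn_integral_eq_integral) auto
    finally show ?thesis .
  qed
  then show ?thesis using L m unfolding L2P_def by blast
qed

lemma step_profile_L2P:
  assumes N: "N \<ge> 1" and a: "\<And>i. i \<in> {1..N} \<Longrightarrow> a i \<in> L2" shows "step_profile N a \<in> L2P"
proof -
  have L: "step_profile N a x \<in> L2" if x: "x \<in> {0..1}" for x
    using cell_cover[OF N x] step_profile_cell a by metis
  have e: "(\<lambda>(x, p). case_prod (step_profile N a x) p) = (\<lambda>q. \<Sum>i=1..N. indicator (cell N i) (fst q) * case_prod (a i) (snd q))"
    by (auto simp: step_profile_def)
  have m: "(\<lambda>(x, p). case_prod (step_profile N a x) p) \<in> borel_measurable (\<nu> \<Otimes>\<^sub>M Z)"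
    unfolding e
  proof (intro borel_measurable_sum borel_measurable_times)
    fix i assume i: "i \<in> {1..N}"
    note [measurable] = cell_nu[OF i] L2_measurable[OF a[OF i]]
    show "(\<lambda>x. indicator (cell N i) (fst x) :: real) \<in> borel_measurable (\<nu> \<Otimes>\<^sub>M Z)" by measurable
    show "(\<lambda>x. case_prod (a i) (snd x)) \<in> borel_measurable (\<nu> \<Otimes>\<^sub>M Z)" by measurable
  qed
  define K where "K = (\<Sum>i=1..N. (nrm (a i))\<^sup>2)"
  have "(nrm (step_profile N a x))\<^sup>2 \<le> K" if x: "x \<in> {0..1}" for x
  proof -
    obtain i where i: "i \<in> {1..N}" "x \<in> cell N i" using cell_cover[OF N x] by blast
    show ?thesis unfolding step_profile_cell[OF i] K_def using i by (intro member_le_sum) auto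
  qed
  then have "(\<integral>\<^sup>+x. ennreal ((nrm (step_profile N a x))\<^sup>2) \<partial>\<nu>) \<le> (\<integral>\<^sup>+x. ennreal K \<partial>\<nu>)"
    by (intro nn_integral_mono ennreal_leI) (simp add: space_nu)
  also have "\<dots> < \<infinity>" by (simp add: nu.emeasure_space_1)
  finally show ?thesis using L m unfolding L2P_def by auto
qed

text \<open>One row of \<open>graphon_op\<close>. The kernel is an argument, so that a row of
  \<open>W\<close> and a row of a step kernel, which reproduces a network aggregate, are treated
  alike.\<close>

definition kernel_op :: "(real \<Rightarrow> real) \<Rightarrow> 'w profile \<Rightarrow> 'w process" where
  "kernel_op k f = (\<lambda>t w. LINT y|\<nu>. k y * f y t w)"

text \<open>Jensen's inequality in \<open>y\<close> and Tonelli give square integrability. Fubini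
  then gives the operator in weak form, tested against \<open>h\<close>; the norm estimate and the
  projection argument below rest on that form.\<close>

lemma kernel_op_L2:
  assumes f: "f \<in> L2P" and k: "k \<in> borel_measurable \<nu>" "\<forall>y\<in>{0..1}. \<bar>k y\<bar> \<le> 1"
  shows "kernel_op k f \<in> L2"
    and "\<And>h. h \<in> L2 \<Longrightarrow> integrable \<nu> (\<lambda>y. k y * proc_inner T P (f y) h)"
    and "\<And>h. h \<in> L2 \<Longrightarrow> proc_inner T P (kernel_op k f) h = (\<integral>y. k y * proc_inner T P (f y) h \<partial>\<nu>)"
proof -
  note [measurable] = k(1) L2P_meas[OF f]
  have ce: "case_prod (kernel_op k f) = (\<lambda>p. LINT y|\<nu>. k y * case_prod (f y) p)"
    by (auto simp: kernel_op_def)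
  have [measurable]: "case_prod (kernel_op k f) \<in> borel_measurable Z" unfolding ce by measurable
  have nnf: "(\<integral>\<^sup>+q. ennreal (((\<lambda>(y, p). case_prod (f y) p) q)\<^sup>2) \<partial>(\<nu> \<Otimes>\<^sub>M Z)) < \<infinity>"
  proof -
    have "(\<integral>\<^sup>+q. ennreal (((\<lambda>(y, p). case_prod (f y) p) q)\<^sup>2) \<partial>(\<nu> \<Otimes>\<^sub>M Z)) = (\<integral>\<^sup>+y. \<integral>\<^sup>+p. ennreal ((case_prod (f y) p)\<^sup>2) \<partial>Z \<partial>\<nu>)"
      by (subst Z.nn_integral_fst[symmetric]) auto
    also have "\<dots> = (\<integral>\<^sup>+y. ennreal ((nrm (f y))\<^sup>2) \<partial>\<nu>)"
      by (intro nn_integral_cong nn_nrm_sq L2P_L2[OF f]) (simp add: space_nu)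
    also have "\<dots> < \<infinity>" using f by (simp add: L2P_def)
    finally show ?thesis .
  qed
  have intf: "integrable (\<nu> \<Otimes>\<^sub>M Z) (\<lambda>q. ((\<lambda>(y, p). case_prod (f y) p) q)\<^sup>2)"
    using nnf by (intro integrableI_bounded) auto
  have pt: "ennreal ((case_prod (kernel_op k f) p)\<^sup>2) \<le> (\<integral>\<^sup>+y. ennreal ((case_prod (f y) p)\<^sup>2) \<partial>\<nu>)" if p: "p \<in> space Z" for p
  proof (cases "(\<integral>\<^sup>+y. ennreal ((case_prod (f y) p)\<^sup>2) \<partial>\<nu>) < \<infinity>")
    case True
    have m [measurable]: "(\<lambda>y. case_prod (f y) p) \<in> borel_measurable \<nu>"
      using measurable_Pair1[OF L2P_meas[OF f] p] by simp
    have i2: "integrable \<nu> (\<lambda>y. (case_prod (f y) p)\<^sup>2)" using True by (intro integrableI_bounded) auto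
    have k2: "integrable \<nu> (\<lambda>y. (k y * case_prod (f y) p)\<^sup>2)"
    proof (rule Bochner_Integration.integrable_bound[OF i2])
      show "AE y in \<nu>. norm ((k y * case_prod (f y) p)\<^sup>2) \<le> norm ((case_prod (f y) p)\<^sup>2)"
        using k(2) by (intro AE_I2) (auto simp: space_nu power_mult_distrib abs_square_le_1 mult_left_le_one_le)
    qed measurable
    have k1: "integrable \<nu> (\<lambda>y. k y * case_prod (f y) p)"
      by (rule nu.square_integrable_imp_integrable[OF _ k2]) measurable
    \<comment> \<open>Nonnegative variance is Jensen's inequality for the square,
      \<open>\<nu>\<close> being a probability measure.\<close>
    have "0 \<le> nu.variance (\<lambda>y. k y * case_prod (f y) p)" by (rule nu.variance_positive)
    then have "(LINT y|\<nu>. k y * case_prod (f y) p)\<^sup>2 \<le> (LINT y|\<nu>. (k y * case_prod (f y) p)\<^sup>2)"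
      by (simp add: nu.variance_eq[OF k1 k2])
    also have "\<dots> \<le> (LINT y|\<nu>. (case_prod (f y) p)\<^sup>2)"
      using k(2) by (intro integral_mono i2 k2) (auto simp: space_nu power_mult_distrib abs_square_le_1 mult_left_le_one_le)
    finally show ?thesis unfolding ce using i2 by (simp add: nn_integral_eq_integral ennreal_leI)
  \<comment> \<open>If the section is not square integrable, the bound is infinite and hence
    trivial.\<close>
  qed (simp add: not_less top_unique)
  have "(\<integral>\<^sup>+p. ennreal ((case_prod (kernel_op k f) p)\<^sup>2) \<partial>Z) \<le> (\<integral>\<^sup>+p. \<integral>\<^sup>+y. ennreal ((case_prod (f y) p)\<^sup>2) \<partial>\<nu> \<partial>Z)"
    by (intro nn_integral_mono pt)
  also have "\<dots> = (\<integral>\<^sup>+q. ennreal (((\<lambda>(y, p). case_prod (f y) p) q)\<^sup>2) \<partial>(\<nu> \<Otimes>\<^sub>M Z))"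
    by (subst NZ.nn_integral_snd[symmetric]) auto
  also note nnf
  finally show "kernel_op k f \<in> L2" unfolding L2_iff_nn by simp
  fix h :: "'w process" assume h: "h \<in> L2"
  note [measurable] = L2_measurable[OF h]
  have inth: "integrable (\<nu> \<Otimes>\<^sub>M Z) (\<lambda>q. (case_prod h (snd q))\<^sup>2)"
  proof (rule integrableI_bounded)
    have "(\<integral>\<^sup>+q. ennreal (norm ((case_prod h (snd q))\<^sup>2)) \<partial>(\<nu> \<Otimes>\<^sub>M Z)) = (\<integral>\<^sup>+y. \<integral>\<^sup>+p. ennreal ((case_prod h p)\<^sup>2) \<partial>Z \<partial>\<nu>)"
      by (subst Z.nn_integral_fst[symmetric]) auto
    also have "\<dots> < \<infinity>" by (simp add: nn_nrm_sq[OF h] nu.emeasure_space_1)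
    finally show "(\<integral>\<^sup>+q. ennreal (norm ((case_prod h (snd q))\<^sup>2)) \<partial>(\<nu> \<Otimes>\<^sub>M Z)) < \<infinity>" .
  qed measurable
  let ?F = "\<lambda>y p. k y * case_prod (f y) p * case_prod h p"
  have intF: "integrable (\<nu> \<Otimes>\<^sub>M Z) (case_prod ?F)"
  proof (rule Bochner_Integration.integrable_bound[OF Bochner_Integration.integrable_add[OF intf inth]])
    show "AE q in \<nu> \<Otimes>\<^sub>M Z. norm (case_prod ?F q) \<le>
       norm (((\<lambda>(y, p). case_prod (f y) p) q)\<^sup>2 + (case_prod h (snd q))\<^sup>2)"
    proof (rule AE_I2)
      fix q assume "q \<in> space (\<nu> \<Otimes>\<^sub>M Z)"
      then obtain y p where q: "q = (y, p)" "y \<in> {0..1}" by (auto simp: space_pair_measure space_nu)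
      have "\<bar>k y * case_prod (f y) p * case_prod h p\<bar> \<le> \<bar>case_prod (f y) p * case_prod h p\<bar>"
        using k(2)[rule_format, OF q(2)] by (simp add: abs_mult mult.assoc mult_left_le_one_le)
      also have "\<dots> \<le> (case_prod (f y) p)\<^sup>2 + (case_prod h p)\<^sup>2" by (rule abs_mult_le_sum_squares)
      finally show "norm (case_prod ?F q) \<le> norm (((\<lambda>(y, p). case_prod (f y) p) q)\<^sup>2 + (case_prod h (snd q))\<^sup>2)"
        unfolding q(1) by simp
    qed
  qed measurable
  have inner: "(\<integral>p. ?F y p \<partial>Z) = k y * proc_inner T P (f y) h" if "y \<in> {0..1}" for y
    using L2P_L2[OF f that] h by (simp add: proc_inner_eq mult.assoc)
  have "integrable \<nu> (\<lambda>y. \<integral>p. ?F y p \<partial>Z)" using NZ.integrable_fst[OF intF] .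
  then show "integrable \<nu> (\<lambda>y. k y * proc_inner T P (f y) h)"
    by (rule Bochner_Integration.integrable_cong[THEN iffD1, rotated -1]) (auto simp: space_nu inner)
  have "proc_inner T P (kernel_op k f) h = (\<integral>p. (\<integral>y. ?F y p \<partial>\<nu>) \<partial>Z)"
    unfolding proc_inner_eq[OF \<open>kernel_op k f \<in> L2\<close> h] unfolding ce by simp
  also have "\<dots> = (\<integral>y. (\<integral>p. ?F y p \<partial>Z) \<partial>\<nu>)" by (rule NZ.Fubini_integral[OF intF])
  also have "\<dots> = (\<integral>y. k y * proc_inner T P (f y) h \<partial>\<nu>)"
    by (intro Bochner_Integration.integral_cong) (auto simp: space_nu inner)
  finally show "proc_inner T P (kernel_op k f) h = (\<integral>y. k y * proc_inner T P (f y) h \<partial>\<nu>)" .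
qed

text \<open>Minkowski's integral inequality: the difference \<open>h\<close> is tested against
  itself, Cauchy-Schwarz is used under the integral, and one factor \<open>nrm h\<close> is
  cancelled.\<close>

lemma kernel_op_diff:
  assumes f: "f1 \<in> L2P" "f2 \<in> L2P"
    and k1: "k1 \<in> borel_measurable \<nu>" "\<forall>y\<in>{0..1}. \<bar>k1 y\<bar> \<le> 1"
    and k2: "k2 \<in> borel_measurable \<nu>" "\<forall>y\<in>{0..1}. \<bar>k2 y\<bar> \<le> 1"
    and b: "integrable \<nu> b" "\<And>y. y \<in> {0..1} \<Longrightarrow> nrm (k1 y *\<^sub>R f1 y - k2 y *\<^sub>R f2 y) \<le> b y"
  shows "nrm (kernel_op k1 f1 - kernel_op k2 f2) \<le> (\<integral>y. b y \<partial>\<nu>)"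
proof -
  note K1 = kernel_op_L2[OF f(1) k1] and K2 = kernel_op_L2[OF f(2) k2]
  define h where "h = kernel_op k1 f1 - kernel_op k2 f2"
  have h: "h \<in> L2" unfolding h_def using K1(1) K2(1) by auto
  have "(nrm h)\<^sup>2 = proc_inner T P (kernel_op k1 f1) h - proc_inner T P (kernel_op k2 f2) h"
    using h K1(1) K2(1) by (subst L2.ip_diff_left[symmetric]) (auto simp: h_def[symmetric] L2.nrm_sq)
  also have "\<dots> = (\<integral>y. k1 y * proc_inner T P (f1 y) h - k2 y * proc_inner T P (f2 y) h \<partial>\<nu>)"
    using K1(2,3)[OF h] K2(2,3)[OF h] by simp
  also have "\<dots> \<le> (\<integral>y. b y * nrm h \<partial>\<nu>)"
  proof (rule integral_mono)
    show "integrable \<nu> (\<lambda>y. k1 y * proc_inner T P (f1 y) h - k2 y * proc_inner T P (f2 y) h)"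
      using K1(2)[OF h] K2(2)[OF h] by simp
    show "integrable \<nu> (\<lambda>y. b y * nrm h)" using b by simp
    fix y assume "y \<in> space \<nu>"
    then have y: "y \<in> {0..1}" by (simp add: space_nu)
    have l: "f1 y \<in> L2" "f2 y \<in> L2" using f y L2P_L2 by auto
    have "k1 y * proc_inner T P (f1 y) h - k2 y * proc_inner T P (f2 y) h = proc_inner T P (k1 y *\<^sub>R f1 y - k2 y *\<^sub>R f2 y) h"
      using l h by (simp add: L2.ip_simps)
    also have "\<dots> \<le> nrm (k1 y *\<^sub>R f1 y - k2 y *\<^sub>R f2 y) * nrm h"
      using l h by (intro L2.cauchy_schwarz) auto
    also have "\<dots> \<le> b y * nrm h" using b(2)[OF y] h by (intro mult_right_mono) auto
    finally show "k1 y * proc_inner T P (f1 y) h - k2 y * proc_inner T P (f2 y) h \<le> b y * nrm h" .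
  qed
  also have "\<dots> = (\<integral>y. b y \<partial>\<nu>) * nrm h" by simp
  finally have *: "nrm h * nrm h \<le> (\<integral>y. b y \<partial>\<nu>) * nrm h" by (simp add: power2_eq_square)
  have "nrm h \<le> (\<integral>y. b y \<partial>\<nu>)"
  proof (cases "nrm h = 0")
    case True
    have "0 \<le> (\<integral>y. b y \<partial>\<nu>)"
    proof (rule integral_nonneg_AE, rule AE_I2)
      fix y assume "y \<in> space \<nu>"
      then have y: "y \<in> {0..1}" by (simp add: space_nu)
      have "k1 y *\<^sub>R f1 y - k2 y *\<^sub>R f2 y \<in> L2" using L2P_L2[OF f(1) y] L2P_L2[OF f(2) y] by auto
      then show "0 \<le> b y" using L2.nrm_nonneg b(2)[OF y] order_trans by blast
    qed
    then show ?thesis using True by simp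
  next
    case False
    then have "0 < nrm h" using L2.nrm_nonneg[OF h] by linarith
    then show ?thesis using * by simp
  qed
  then show ?thesis by (simp add: h_def)
qed

text \<open>
  The aggregate is only known to be jointly measurable; that it has a progressively measurable
  version follows since it is orthogonal to the orthogonal complement of the closed subspace of
  progressively measurable processes.
\<close>

lemma kernel_op_progressive:
  assumes f: "f \<in> L2P" "\<And>y. y \<in> {0..1} \<Longrightarrow> f y \<in> HH"
    and k: "k \<in> borel_measurable \<nu>" "\<forall>y\<in>{0..1}. \<bar>k y\<bar> \<le> 1"
  shows "\<exists>z\<in>HH. proc_eq T P (kernel_op k f) z"
proof -
  note K = kernel_op_L2[OF f(1) k]
  let ?g = "kernel_op k f"
  obtain p where p: "p \<in> HH" "\<And>h. h \<in> HH \<Longrightarrow> proc_inner T P (?g - p) h = 0"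
    using PS.orthogonal_projection[OF K(1)] by blast
  have d: "?g - p \<in> L2" using K(1) p(1) by auto
  have "proc_inner T P ?g (?g - p) = (\<integral>y. k y * proc_inner T P (f y) (?g - p) \<partial>\<nu>)" using K(3)[OF d] .
  also have "\<dots> = (\<integral>y. 0 \<partial>\<nu>)"
    using p(2)[OF f(2)] by (intro Bochner_Integration.integral_cong) (simp_all add: space_nu L2.ip_commute[of "f _"])
  finally have "proc_inner T P ?g (?g - p) = 0" by simp
  moreover have "proc_inner T P p (?g - p) = 0" using p by (simp add: L2.ip_commute[of p])
  ultimately have "proc_inner T P (?g - p) (?g - p) = 0" using K(1) p(1) d by (subst L2.ip_diff_left) auto
  then have "nrm (?g - p) = 0" by (simp add: L2.nrm_def)
  then show ?thesis using nrm_0_iff_proc_eq[OF K(1)] p(1) by auto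
qed

text \<open>The bridge between the two games: the factor \<open>1 / N\<close> of a network aggregate
  is the measure of a cell.\<close>

lemma kernel_op_step:
  assumes N: "N \<ge> 1"
  shows "kernel_op (\<lambda>y. \<Sum>j=1..N. indicator (cell N j) y * c j) (step_profile N a) = (\<Sum>j=1..N. (c j / real N) *\<^sub>R a j)"
proof (intro ext)
  fix t w
  have "kernel_op (\<lambda>y. \<Sum>j=1..N. indicator (cell N j) y * c j) (step_profile N a) t w =
     (LINT y|\<nu>. (\<Sum>j=1..N. indicator (cell N j) y * (c j * a j t w)))"
    unfolding kernel_op_def
  proof (rule Bochner_Integration.integral_cong[OF refl])
    fix y assume "y \<in> space \<nu>"
    then obtain i where i: "i \<in> {1..N}" "y \<in> cell N i" using cell_cover[OF N] unfolding space_nu by blast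
    show "(\<Sum>j=1..N. indicator (cell N j) y * c j) * step_profile N a y t w =
        (\<Sum>j=1..N. indicator (cell N j) y * (c j * a j t w))"
      unfolding sum_indicator_cell[OF i] step_profile_cell[OF i] ..
  qed
  also have "\<dots> = (\<Sum>j=1..N. measure \<nu> (cell N j) * (c j * a j t w))"
    by (subst Bochner_Integration.integral_sum)
      (auto intro!: sum.cong integrable_mult_left integrable_real_indicator cell_nu simp: nu.emeasure_eq_measure)
  also have "\<dots> = (\<Sum>j=1..N. (c j / real N) *\<^sub>R a j) t w"
    by (simp add: fun_apply_simps measure_nu_cell)
  finally show "kernel_op (\<lambda>y. \<Sum>j=1..N. indicator (cell N j) y * c j) (step_profile N a) t w = (\<Sum>j=1..N. (c j / real N) *\<^sub>R a j) t w" .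
qed

lemma sq_integral_le: "integrable \<nu> u \<Longrightarrow> integrable \<nu> (\<lambda>x. (u x)\<^sup>2) \<Longrightarrow> (\<integral>x. u x \<partial>\<nu>)\<^sup>2 \<le> (\<integral>x. (u x :: real)\<^sup>2 \<partial>\<nu>)"
  using nu.variance_positive[of u] nu.variance_eq[of u] by simp

text \<open>For \<open>x\<close> in cell \<open>i\<close> the aggregates differ by three effects:
  \<open>abar\<close> against the step profile, at most \<Delta>; \<open>W\<close> against the step
  kernel of \<open>w\<close>, at most \<open>M * \<beta> x\<close>; and \<open>w\<close> against
  \<open>H\<close>, which is \<open>g x\<close>. Stability of best responses gives
  \<open>nrm (d x) \<le> rr * \<Delta> + u x\<close>, and mean squares over \<open>x\<close> give a
  bound on \<Delta> in which \<open>rr * \<Delta>\<close> is absorbed. The factor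
  \<open>sqrt 3\<close> comes from the square of a sum of three terms. A measurable majorant
  \<open>\<beta>\<close> is carried so that measurability of the row errors themselves is never at
  issue.\<close>

lemma graphon_stability:
  assumes N: "N \<ge> 1"
    and \<theta>: "\<theta> \<in> action_profiles T P F \<nu>" and abar: "graphon_nash T P F \<nu> (\<lambda>_. A0) U \<theta> W abar"
    and \<theta>N: "\<And>i. i \<in> {1..N} \<Longrightarrow> \<theta>N i \<in> HH" and a: "network_nash A0 U N \<theta>N H a"
    and W: "\<And>x. x \<in> {0..1} \<Longrightarrow> (\<lambda>y. W x y) \<in> borel_measurable \<nu>"
      "\<And>x y. x \<in> {0..1} \<Longrightarrow> y \<in> {0..1} \<Longrightarrow> \<bar>W x y\<bar> \<le> 1"
    and w: "\<And>i j. i \<in> {1..N} \<Longrightarrow> j \<in> {1..N} \<Longrightarrow> \<bar>w i j\<bar> \<le> 1"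
    and op: "op_bound N (\<lambda>i j. H i j - w i j) \<eta>"
    and \<beta>: "\<beta> \<in> borel_measurable \<nu>" "\<And>x. x \<in> {0..1} \<Longrightarrow> 0 \<le> \<beta> x \<and> \<beta> x \<le> B"
      "\<And>i x. i \<in> {1..N} \<Longrightarrow> x \<in> cell N i \<Longrightarrow>
         (\<integral>y. \<bar>W x y - (\<Sum>j=1..N. indicator (cell N j) y * w i j)\<bar> \<partial>\<nu>) \<le> \<beta> x"
  shows "profile_dist T P \<nu> abar (step_profile N a) \<le>
    sqrt 3 / (1 - rr) * (M * sqrt (\<integral>x. (\<beta> x)\<^sup>2 \<partial>\<nu>) + M * \<eta> + l\<theta> / \<alpha> * profile_dist T P \<nu> \<theta> (step_profile N \<theta>N))"
proof -
  have abarP: "abar \<in> action_profiles T P F \<nu>" using abar by (simp add: graphon_nash_def)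
  note aL = action_profile_L2P[OF abarP] and \<theta>L = action_profile_L2P[OF \<theta>]
  have aA: "a i \<in> A0" if "i \<in> {1..N}" for i using a that by (auto simp: network_nash_iff best_iff)
  have sa: "step_profile N a \<in> L2P" using aA by (intro step_profile_L2P N) auto
  have s\<theta>: "step_profile N \<theta>N \<in> L2P" using \<theta>N by (intro step_profile_L2P N) auto
  define d where "d x = abar x - step_profile N a x" for x
  define e where "e x = \<theta> x - step_profile N \<theta>N x" for x
  have dP: "d \<in> L2P" unfolding d_def by (rule L2P_diff[OF aL(1) sa])
  have eP: "e \<in> L2P" unfolding e_def by (rule L2P_diff[OF \<theta>L(1) s\<theta>])
  define \<Delta> where "\<Delta> = sqrt (\<integral>x. (nrm (d x))\<^sup>2 \<partial>\<nu>)"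
  have \<Delta>: "\<Delta> = profile_dist T P \<nu> abar (step_profile N a)" "0 \<le> \<Delta>"
  proof -
    have "d = (\<lambda>x t w. abar x t w - step_profile N a x t w)" by (auto simp: d_def fun_eq_iff fun_apply_simps)
    then show "\<Delta> = profile_dist T P \<nu> abar (step_profile N a)"
      using profile_norm_eq[OF dP] by (simp add: \<Delta>_def profile_dist_def)
  qed (simp add: \<Delta>_def)
  have e_norm: "sqrt (\<integral>x. (nrm (e x))\<^sup>2 \<partial>\<nu>) = profile_dist T P \<nu> \<theta> (step_profile N \<theta>N)"
  proof -
    have "e = (\<lambda>x t w. \<theta> x t w - step_profile N \<theta>N x t w)" by (auto simp: e_def fun_eq_iff fun_apply_simps)
    then show ?thesis using profile_norm_eq[OF eP] by (simp add: profile_dist_def)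
  qed
  have \<Delta>1: "(\<integral>x. nrm (d x) \<partial>\<nu>) \<le> \<Delta>"
    unfolding \<Delta>_def by (rule real_le_rsqrt, rule sq_integral_le[OF L2P_nrm_integrable[OF dP] L2P_nrm_sq_integrable[OF dP]])
  \<comment> \<open>The effect of the matrix noise on player \<open>i\<close>. It is not bounded row
    by row; only its mean square is, through \<open>op\<close>.\<close>
  define \<gamma> where "\<gamma> i = nrm (agg N (\<lambda>i j. H i j - w i j) a i)" for i
  define g where "g x = (\<Sum>i=1..N. indicator (cell N i) x * \<gamma> i)" for x
  define u where "u x = rr * M * \<beta> x + rr * g x + l\<theta> / \<alpha> * nrm (e x)" for x
  have \<gamma>0: "0 \<le> \<gamma> i" for i unfolding \<gamma>_def using aA by (intro L2.nrm_nonneg HH_L2 agg_HH) auto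
  have g0: "0 \<le> g x" for x unfolding g_def using \<gamma>0 by (intro sum_nonneg) auto
  have gm [measurable]: "g \<in> borel_measurable \<nu>" unfolding g_def
    by (intro borel_measurable_sum borel_measurable_times borel_measurable_indicator cell_nu) auto
  have gi: "integrable \<nu> g" "integrable \<nu> (\<lambda>x. (g x)\<^sup>2)"
  proof -
    have "g x \<le> (\<Sum>i=1..N. \<gamma> i)" for x unfolding g_def using \<gamma>0 by (intro sum_mono) (auto simp: indicator_def)
    then show "integrable \<nu> g"
      using g0 by (intro nu.integrable_const_bound[of _ "\<Sum>i=1..N. \<gamma> i"]) auto
    show "integrable \<nu> (\<lambda>x. (g x)\<^sup>2)"
      using g0 \<open>\<And>x. g x \<le> (\<Sum>i=1..N. \<gamma> i)\<close>
      by (intro nu.integrable_const_bound[of _ "(\<Sum>i=1..N. \<gamma> i)\<^sup>2"]) (auto intro!: power_mono)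
  qed
  have \<beta>i: "integrable \<nu> \<beta>" "integrable \<nu> (\<lambda>x. (\<beta> x)\<^sup>2)"
  proof -
    show "integrable \<nu> \<beta>"
      using \<beta>(1,2) by (intro nu.integrable_const_bound[of _ B]) (auto simp: space_nu)
    show "integrable \<nu> (\<lambda>x. (\<beta> x)\<^sup>2)"
      using \<beta>(1,2) by (intro nu.integrable_const_bound[of _ "B\<^sup>2"]) (auto simp: space_nu intro!: power_mono)
  qed
  note [measurable] = \<beta>(1) L2P_nrm_measurable[OF eP] L2P_nrm_measurable[OF dP]
  have pw: "nrm (d x) \<le> rr * \<Delta> + u x" if x: "x \<in> {0..1}" for x
  proof -
    obtain i where i: "i \<in> {1..N}" "x \<in> cell N i" using cell_cover[OF N x] by blast
    let ?k2 = "\<lambda>y. \<Sum>j=1..N. indicator (cell N j) y * w i j"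
    have k2m: "?k2 \<in> borel_measurable \<nu>"
      by (intro borel_measurable_sum borel_measurable_times borel_measurable_indicator cell_nu) auto
    have Wb: "\<forall>y\<in>{0..1}. \<bar>W x y\<bar> \<le> 1" using W(2)[OF x] by blast
    have k2b: "\<forall>y\<in>{0..1}. \<bar>?k2 y\<bar> \<le> 1"
    proof
      fix y :: real assume "y \<in> {0..1}"
      then obtain j where j: "j \<in> {1..N}" "y \<in> cell N j" using cell_cover[OF N] by blast
      show "\<bar>?k2 y\<bar> \<le> 1" unfolding sum_indicator_cell[OF j] by (rule w[OF i(1) j(1)])
    qed
    \<comment> \<open>The assumptions on \<open>U\<close> concern processes in \<open>HH\<close>, so
      the aggregate is replaced by its progressive version before best responses are
      compared.\<close>
    obtain z where z: "z \<in> HH" "proc_eq T P (kernel_op (W x) abar) z"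
      using kernel_op_progressive[OF aL(1) _ W(1)[OF x] Wb] aL(2) by blast
    have K: "kernel_op (W x) abar \<in> L2" by (rule kernel_op_L2(1)[OF aL(1) W(1)[OF x] Wb])
    have "best (kernel_op (W x) abar) (\<theta> x) (abar x)"
      using abar x by (simp add: graphon_nash_def best_def kernel_op_def graphon_op_def)
    then have b1: "best z (\<theta> x) (abar x)" using best_cong[OF z(2) proc_eq_refl] by blast
    have b2: "best (agg N H a i) (\<theta>N i) (a i)" using a i by (simp add: network_nash_iff)
    have aggH: "agg N H' a i \<in> HH" for H' using aA by (intro agg_HH) auto
    have "nrm (d x) \<le> rr * nrm (z - agg N H a i) + l\<theta> / \<alpha> * nrm (e x)"
      using best_stability[OF z(1) \<theta>L(2)[OF x] aggH \<theta>N[OF i(1)] b1 b2]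
      by (simp add: d_def e_def step_profile_cell[OF i] rr_def)
    moreover have "nrm (z - agg N H a i) \<le> \<Delta> + M * \<beta> x + g x"
    proof -
      have zL: "z \<in> L2" "agg N H a i \<in> L2" "agg N w a i \<in> L2" using z aggH by auto
      have "nrm (z - agg N H a i) \<le> nrm (z - kernel_op (W x) abar) + nrm (kernel_op (W x) abar - agg N H a i)"
        using L2.nrm_diff_triangle[OF zL(1) K zL(2)] .
      also have "nrm (z - kernel_op (W x) abar) = 0"
        using nrm_0_iff_proc_eq[OF K zL(1)] z(2) L2.nrm_minus[OF zL(1) K] by simp
      also have "nrm (kernel_op (W x) abar - agg N H a i) \<le> nrm (kernel_op (W x) abar - agg N w a i) + nrm (agg N w a i - agg N H a i)"
        using L2.nrm_diff_triangle[OF K zL(3) zL(2)] .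
      also have "nrm (agg N w a i - agg N H a i) = g x"
        using L2.nrm_minus[OF zL(3,2)] unfolding g_def sum_indicator_cell[OF i] \<gamma>_def by (simp add: agg_diff_matrix)
      also have "nrm (kernel_op (W x) abar - agg N w a i) \<le> \<Delta> + M * \<beta> x"
      proof -
        have agg: "agg N w a i = kernel_op ?k2 (step_profile N a)"
          unfolding agg_def using kernel_op_step[OF N, of "w i" a] by simp
        let ?b = "\<lambda>y. nrm (d y) + M * \<bar>W x y - ?k2 y\<bar>"
        have ib: "integrable \<nu> (\<lambda>y. \<bar>W x y - ?k2 y\<bar>)"
        proof (rule nu.integrable_const_bound[of _ 2], rule AE_I2)
          fix y assume "y \<in> space \<nu>"
          then have "y \<in> {0..1}" by (simp add: space_nu)
          then show "norm \<bar>W x y - ?k2 y\<bar> \<le> 2" using W(2)[OF x, of y] bspec[OF k2b, of y] by auto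
        qed (use W(1)[OF x] k2m in measurable)
        have "nrm (kernel_op (W x) abar - agg N w a i) \<le> (\<integral>y. ?b y \<partial>\<nu>)"
          unfolding agg
        proof (rule kernel_op_diff[OF aL(1) sa W(1)[OF x] Wb k2m k2b])
          show "integrable \<nu> ?b" using ib L2P_nrm_integrable[OF dP] by simp
          fix y :: real assume y: "y \<in> {0..1}"
          obtain j where j: "j \<in> {1..N}" "y \<in> cell N j" using cell_cover[OF N y] by blast
          have l: "abar y \<in> L2" "step_profile N a y \<in> L2" "d y \<in> L2" using aL(1) sa dP y L2P_L2 by auto
          \<comment> \<open>The kernel error is made to multiply the step profile, whose values are
            bounded by \<open>M\<close>.\<close>
          have "W x y *\<^sub>R abar y - ?k2 y *\<^sub>R step_profile N a y = W x y *\<^sub>R d y + (W x y - ?k2 y) *\<^sub>R step_profile N a y"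
            by (simp add: d_def algebra_simps)
          then have "nrm (W x y *\<^sub>R abar y - ?k2 y *\<^sub>R step_profile N a y) \<le> nrm (W x y *\<^sub>R d y) + nrm ((W x y - ?k2 y) *\<^sub>R step_profile N a y)"
            using l L2.nrm_triangle[of "W x y *\<^sub>R d y" "(W x y - ?k2 y) *\<^sub>R step_profile N a y"] by simp
          also have "\<dots> = \<bar>W x y\<bar> * nrm (d y) + \<bar>W x y - ?k2 y\<bar> * nrm (step_profile N a y)"
            using l by (simp add: L2.nrm_scale)
          also have "\<dots> \<le> 1 * nrm (d y) + \<bar>W x y - ?k2 y\<bar> * M"
          proof -
            have "nrm (step_profile N a y) \<le> M" unfolding step_profile_cell[OF j] by (rule A0_nrm[OF aA[OF j(1)]])
            then show ?thesis using W(2)[OF x y] l by (intro add_mono mult_right_mono mult_left_mono) auto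
          qed
          finally show "nrm (W x y *\<^sub>R abar y - ?k2 y *\<^sub>R step_profile N a y) \<le> ?b y" by (simp add: mult.commute)
        qed
        also have "\<dots> = (\<integral>y. nrm (d y) \<partial>\<nu>) + M * (\<integral>y. \<bar>W x y - ?k2 y\<bar> \<partial>\<nu>)"
          using ib L2P_nrm_integrable[OF dP] by simp
        also have "\<dots> \<le> \<Delta> + M * \<beta> x"
          using \<Delta>1 \<beta>(3)[OF i] M_nonneg by (intro add_mono mult_left_mono) auto
        finally show ?thesis .
      qed
      finally show ?thesis by simp
    qed
    ultimately have "nrm (d x) \<le> rr * (\<Delta> + M * \<beta> x + g x) + l\<theta> / \<alpha> * nrm (e x)"
      using mult_left_mono[OF _ rr(1)] by fastforce
    then show ?thesis by (simp add: u_def algebra_simps)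
  qed
  have c0: "0 \<le> l\<theta> / \<alpha>" using lipschitz_nonneg \<alpha>_pos by simp
  have ui: "integrable \<nu> u" unfolding u_def using \<beta>i gi L2P_nrm_integrable[OF eP] by simp
  have u3: "(u x)\<^sup>2 \<le> 3 * (M\<^sup>2 * (\<beta> x)\<^sup>2 + (g x)\<^sup>2 + (l\<theta> / \<alpha>)\<^sup>2 * (nrm (e x))\<^sup>2)" for x
  proof -
    have s3: "(p + q + r)\<^sup>2 \<le> 3 * (p\<^sup>2 + q\<^sup>2 + r\<^sup>2)" for p q r :: real
      using sum_squares_bound[of p q] sum_squares_bound[of p r] sum_squares_bound[of q r]
      by (simp add: power2_eq_square algebra_simps)
    have rr2: "rr\<^sup>2 \<le> 1" using rr by (simp add: power_le_one)
    have "(u x)\<^sup>2 \<le> 3 * ((rr * M * \<beta> x)\<^sup>2 + (rr * g x)\<^sup>2 + (l\<theta> / \<alpha> * nrm (e x))\<^sup>2)" unfolding u_def by (rule s3)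
    also have "\<dots> \<le> 3 * (M\<^sup>2 * (\<beta> x)\<^sup>2 + (g x)\<^sup>2 + (l\<theta> / \<alpha>)\<^sup>2 * (nrm (e x))\<^sup>2)"
      using rr2 mult_left_le_one_le[of "M\<^sup>2 * (\<beta> x)\<^sup>2" "rr\<^sup>2"] mult_left_le_one_le[of "(g x)\<^sup>2" "rr\<^sup>2"]
      by (simp add: power_mult_distrib power_divide mult.assoc)
    finally show ?thesis .
  qed
  have bi: "integrable \<nu> (\<lambda>x. 3 * (M\<^sup>2 * (\<beta> x)\<^sup>2 + (g x)\<^sup>2 + (l\<theta> / \<alpha>)\<^sup>2 * (nrm (e x))\<^sup>2))"
    using \<beta>i gi L2P_nrm_sq_integrable[OF eP] by simp
  have u2i: "integrable \<nu> (\<lambda>x. (u x)\<^sup>2)"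
  proof (rule Bochner_Integration.integrable_bound[OF bi])
    show "(\<lambda>x. (u x)\<^sup>2) \<in> borel_measurable \<nu>" using ui by measurable
    show "AE x in \<nu>. norm ((u x)\<^sup>2) \<le> norm (3 * (M\<^sup>2 * (\<beta> x)\<^sup>2 + (g x)\<^sup>2 + (l\<theta> / \<alpha>)\<^sup>2 * (nrm (e x))\<^sup>2))"
    proof (rule AE_I2)
      fix x
      show "norm ((u x)\<^sup>2) \<le> norm (3 * (M\<^sup>2 * (\<beta> x)\<^sup>2 + (g x)\<^sup>2 + (l\<theta> / \<alpha>)\<^sup>2 * (nrm (e x))\<^sup>2))"
        using u3[of x] zero_le_power2[of "u x"] unfolding real_norm_def by linarith
    qed
  qed
  define \<Upsilon> where "\<Upsilon> = sqrt (\<integral>x. (u x)\<^sup>2 \<partial>\<nu>)"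
  have \<Upsilon>0: "0 \<le> \<Upsilon>" by (simp add: \<Upsilon>_def)
  have \<Upsilon>2: "\<Upsilon>\<^sup>2 = (\<integral>x. (u x)\<^sup>2 \<partial>\<nu>)" by (simp add: \<Upsilon>_def)
  have \<Upsilon>1: "(\<integral>x. u x \<partial>\<nu>) \<le> \<Upsilon>" unfolding \<Upsilon>_def by (rule real_le_rsqrt[OF sq_integral_le[OF ui u2i]])
  have "\<Delta>\<^sup>2 = (\<integral>x. (nrm (d x))\<^sup>2 \<partial>\<nu>)" by (simp add: \<Delta>_def)
  also have "\<dots> \<le> (\<integral>x. (rr * \<Delta>)\<^sup>2 + 2 * (rr * \<Delta>) * u x + (u x)\<^sup>2 \<partial>\<nu>)"
  proof (rule integral_mono[OF L2P_nrm_sq_integrable[OF dP]])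
    show "integrable \<nu> (\<lambda>x. (rr * \<Delta>)\<^sup>2 + 2 * (rr * \<Delta>) * u x + (u x)\<^sup>2)" using ui u2i by simp
    fix x assume "x \<in> space \<nu>"
    then have x: "x \<in> {0..1}" by (simp add: space_nu)
    have "(nrm (d x))\<^sup>2 \<le> (rr * \<Delta> + u x)\<^sup>2" using pw[OF x] L2P_L2[OF dP x] by (intro power_mono) auto
    then show "(nrm (d x))\<^sup>2 \<le> (rr * \<Delta>)\<^sup>2 + 2 * (rr * \<Delta>) * u x + (u x)\<^sup>2" by (simp add: power2_sum algebra_simps)
  qed
  also have "\<dots> = (rr * \<Delta>)\<^sup>2 + 2 * (rr * \<Delta>) * (\<integral>x. u x \<partial>\<nu>) + \<Upsilon>\<^sup>2" using ui u2i by (simp add: \<Upsilon>2 nu.prob_space)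
  also have "\<dots> \<le> (rr * \<Delta>)\<^sup>2 + 2 * (rr * \<Delta>) * \<Upsilon> + \<Upsilon>\<^sup>2"
    using \<Upsilon>1 rr \<Delta>(2) by (intro add_mono mult_left_mono) auto
  also have "\<dots> = (rr * \<Delta> + \<Upsilon>)\<^sup>2" by (simp add: power2_sum)
  finally have "\<Delta> \<le> rr * \<Delta> + \<Upsilon>" by (rule power2_le_imp_le) (use rr \<Delta>(2) \<Upsilon>0 in auto)
  then have fin: "\<Delta> \<le> \<Upsilon> / (1 - rr)" using rr by (simp add: field_simps)
  \<comment> \<open>The cell measure \<open>1 / N\<close> cancels against the \<open>N\<close>
    players, each of norm at most \<open>M\<close>.\<close>
  have g2: "(\<integral>x. (g x)\<^sup>2 \<partial>\<nu>) \<le> (M * \<eta>)\<^sup>2"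
  proof -
    have "(\<integral>x. (g x)\<^sup>2 \<partial>\<nu>) = (\<integral>x. (\<Sum>i=1..N. indicator (cell N i) x * (\<gamma> i)\<^sup>2) \<partial>\<nu>)"
    proof (rule Bochner_Integration.integral_cong[OF refl])
      fix x assume "x \<in> space \<nu>"
      then obtain i where i: "i \<in> {1..N}" "x \<in> cell N i" using cell_cover[OF N] unfolding space_nu by blast
      show "(g x)\<^sup>2 = (\<Sum>i=1..N. indicator (cell N i) x * (\<gamma> i)\<^sup>2)"
        unfolding g_def sum_indicator_cell[OF i] ..
    qed
    also have "\<dots> = (\<Sum>i=1..N. measure \<nu> (cell N i) * (\<gamma> i)\<^sup>2)"
      by (subst Bochner_Integration.integral_sum)
        (auto intro!: sum.cong integrable_mult_left integrable_real_indicator cell_nu simp: nu.emeasure_eq_measure)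
    also have "\<dots> = (\<Sum>i=1..N. (\<gamma> i)\<^sup>2) / real N" by (simp add: measure_nu_cell sum_divide_distrib)
    also have "\<dots> \<le> (\<eta>\<^sup>2 * (\<Sum>j=1..N. (nrm (a j))\<^sup>2)) / real N"
      unfolding \<gamma>_def agg_def using op aA by (intro divide_right_mono matrix_nrm_bound) (auto simp: op_bound_def)
    also have "\<dots> \<le> (\<eta>\<^sup>2 * (\<Sum>j=1..N. M\<^sup>2)) / real N"
      using A0_nrm aA by (intro divide_right_mono mult_left_mono sum_mono power_mono) auto
    also have "\<dots> = (M * \<eta>)\<^sup>2" using N by (simp add: power_mult_distrib)
    finally show ?thesis .
  qed
  have \<eta>: "0 \<le> \<eta>" using op by (simp add: op_bound_def)
  have nn3: "0 \<le> M * sqrt (\<integral>x. (\<beta> x)\<^sup>2 \<partial>\<nu>)" "0 \<le> M * \<eta>" "0 \<le> l\<theta> / \<alpha> * sqrt (\<integral>x. (nrm (e x))\<^sup>2 \<partial>\<nu>)"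
    using M_nonneg \<eta> mult_nonneg_nonneg[OF c0, of "sqrt (\<integral>x. (nrm (e x))\<^sup>2 \<partial>\<nu>)"] by auto
  have "\<Upsilon>\<^sup>2 \<le> (\<integral>x. 3 * (M\<^sup>2 * (\<beta> x)\<^sup>2 + (g x)\<^sup>2 + (l\<theta> / \<alpha>)\<^sup>2 * (nrm (e x))\<^sup>2) \<partial>\<nu>)"
    unfolding \<Upsilon>2 by (rule integral_mono[OF u2i bi u3])
  also have "\<dots> = 3 * (M\<^sup>2 * (\<integral>x. (\<beta> x)\<^sup>2 \<partial>\<nu>) + (\<integral>x. (g x)\<^sup>2 \<partial>\<nu>) + (l\<theta> / \<alpha>)\<^sup>2 * (\<integral>x. (nrm (e x))\<^sup>2 \<partial>\<nu>))"
    using \<beta>i gi L2P_nrm_sq_integrable[OF eP] by simp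
  also have "\<dots> \<le> 3 * ((M * sqrt (\<integral>x. (\<beta> x)\<^sup>2 \<partial>\<nu>))\<^sup>2 + (M * \<eta>)\<^sup>2 + (l\<theta> / \<alpha> * sqrt (\<integral>x. (nrm (e x))\<^sup>2 \<partial>\<nu>))\<^sup>2)"
    using g2 by (simp add: power_mult_distrib power_divide)
  also have "\<dots> \<le> (sqrt 3 * (M * sqrt (\<integral>x. (\<beta> x)\<^sup>2 \<partial>\<nu>) + M * \<eta> + l\<theta> / \<alpha> * sqrt (\<integral>x. (nrm (e x))\<^sup>2 \<partial>\<nu>)))\<^sup>2"
  proof -
    have "p\<^sup>2 + q\<^sup>2 + r\<^sup>2 \<le> (p + q + r)\<^sup>2" if "0 \<le> p" "0 \<le> q" "0 \<le> r" for p q r :: real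
      using that by (simp add: power2_eq_square algebra_simps)
    note pqr = this[of "M * sqrt (\<integral>x. (\<beta> x)\<^sup>2 \<partial>\<nu>)" "M * \<eta>" "l\<theta> / \<alpha> * sqrt (\<integral>x. (nrm (e x))\<^sup>2 \<partial>\<nu>)"]
    note pqr = pqr[OF nn3]
    have 3: "(sqrt 3 :: real)\<^sup>2 = 3" by simp
    show ?thesis unfolding power_mult_distrib[of "sqrt 3"] 3 by (rule mult_left_mono[OF pqr]) simp
  qed
  finally have "\<Upsilon> \<le> sqrt 3 * (M * sqrt (\<integral>x. (\<beta> x)\<^sup>2 \<partial>\<nu>) + M * \<eta> + l\<theta> / \<alpha> * sqrt (\<integral>x. (nrm (e x))\<^sup>2 \<partial>\<nu>))"
    by (rule power2_le_imp_le) (intro mult_nonneg_nonneg[of "sqrt 3"] add_nonneg_nonneg nn3, simp)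
  then have "\<Upsilon> / (1 - rr) \<le> (sqrt 3 * (M * sqrt (\<integral>x. (\<beta> x)\<^sup>2 \<partial>\<nu>) + M * \<eta> + l\<theta> / \<alpha> * sqrt (\<integral>x. (nrm (e x))\<^sup>2 \<partial>\<nu>))) / (1 - rr)"
    using rr by (intro divide_right_mono) auto
  then show ?thesis using fin unfolding \<Delta>(1) e_norm by simp
qed

end

section \<open>Concentration of uniform order statistics\<close>

text \<open>Turns statements on order statistics into statements on sums of indicators; both
  measurability and Hoeffding's inequality are applied to these sums. The offset
  \<open>i - 1\<close> is due to lists being indexed from 0.\<close>

lemma ordered_points_le_iff:
  assumes "i \<in> {1..N}"
  shows "ordered_points N Y i \<omega> \<le> t \<longleftrightarrow> i \<le> card {k \<in> {1..N}. Y k \<omega> \<le> t}"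
proof -
  define l where "l = map (\<lambda>j. Y j \<omega>) [1..<Suc N]"
  define xs where "xs = sort l"
  have len: "length xs = N" by (simp add: xs_def l_def)
  have "card {k \<in> {1..N}. Y k \<omega> \<le> t} = length (filter (\<lambda>k. Y k \<omega> \<le> t) [1..<Suc N])"
    by (subst distinct_card[symmetric]) (auto intro!: arg_cong[where f = card])
  also have "\<dots> = length (filter (\<lambda>y. y \<le> t) l)" by (simp add: l_def filter_map o_def)
  also have "\<dots> = length (filter (\<lambda>y. y \<le> t) xs)"
    by (metis (no_types, lifting) mset_filter mset_sort size_mset xs_def)
  also have "\<dots> = card {k. k < N \<and> xs ! k \<le> t}" by (simp add: length_filter_conv_card len)
  finally have c: "card {k \<in> {1..N}. Y k \<omega> \<le> t} = card {k. k < N \<and> xs ! k \<le> t}" .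
  have mono: "xs ! k \<le> xs ! m" if "k \<le> m" "m < N" for k m
    using that len by (intro sorted_nth_mono) (auto simp: xs_def)
  have o: "ordered_points N Y i \<omega> = xs ! (i - 1)" by (simp add: ordered_points_def xs_def l_def)
  show ?thesis unfolding o c
  proof
    assume "xs ! (i - 1) \<le> t"
    have "{..<i} \<subseteq> {k. k < N \<and> xs ! k \<le> t}"
    proof
      fix k assume "k \<in> {..<i}"
      then have "k \<le> i - 1" "i - 1 < N" "k < N" using assms by auto
      then show "k \<in> {k. k < N \<and> xs ! k \<le> t}"
        using mono[of k "i - 1"] \<open>xs ! (i - 1) \<le> t\<close> by auto
    qed
    then show "i \<le> card {k. k < N \<and> xs ! k \<le> t}" using card_mono[of "{k. k < N \<and> xs ! k \<le> t}" "{..<i}"] by simp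
  next
    assume i: "i \<le> card {k. k < N \<and> xs ! k \<le> t}"
    show "xs ! (i - 1) \<le> t"
    proof (rule ccontr)
      assume "\<not> xs ! (i - 1) \<le> t"
      then have "{k. k < N \<and> xs ! k \<le> t} \<subseteq> {..<i - 1}"
        using mono[of "i - 1"] by (auto simp: not_less) (meson leI order_trans)
      then have "card {k. k < N \<and> xs ! k \<le> t} \<le> i - 1" using card_mono[of "{..<i - 1}"] by fastforce
      then show False using i assms by auto
    qed
  qed
qed

lemma ordered_points_range:
  assumes "i \<in> {1..N}" "\<And>k. k \<in> {1..N} \<Longrightarrow> Y k \<omega> \<in> A"
  shows "ordered_points N Y i \<omega> \<in> A"
proof -
  have "ordered_points N Y i \<omega> \<in> set (sort (map (\<lambda>j. Y j \<omega>) [1..<Suc N]))"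
    unfolding ordered_points_def using assms(1) by (intro nth_mem) auto
  then show ?thesis using assms(2) by auto
qed

text \<open>Counts are controlled at the grid points only, so that a finite union bound suffices. If
  the \<open>i\<close>-th point is too large, the grid point just above \<open>i / N + s\<close> has
  too few sample points to its left; the lower bound is symmetric. Rounding to the grid costs
  \<open>1 / N\<close>.\<close>

lemma ordered_points_near_grid:
  assumes i: "i \<in> {1..N}" and Y: "\<And>k. k \<in> {1..N} \<Longrightarrow> Y k \<omega> \<in> {0..1}" and s: "s \<ge> 0"
    and c: "\<And>j. j \<in> {0..N} \<Longrightarrow> \<bar>real (card {k \<in> {1..N}. Y k \<omega> \<le> real j / real N}) - real j\<bar> < real N * s"
  shows "\<bar>ordered_points N Y i \<omega> - real i / real N\<bar> \<le> s + 1 / real N"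
proof -
  let ?x = "ordered_points N Y i \<omega>"
  let ?c = "\<lambda>j. card {k \<in> {1..N}. Y k \<omega> \<le> real j / real N}"
  have N: "real N > 0" using i by auto
  have x: "0 \<le> ?x" "?x \<le> 1" using ordered_points_range[OF i, of Y \<omega> "{0..1}"] Y by auto
  have "?x \<le> real i / real N + s + 1 / real N"
  proof (rule ccontr)
    assume "\<not> ?thesis"
    then have gt: "real i + real N * s + 1 < real N * ?x" using N by (simp add: field_simps)
    define j where "j = nat \<lceil>real i + real N * s\<rceil>"
    have j: "real i + real N * s \<le> real j" "real j < real i + real N * s + 1"
    proof -
      have "0 \<le> real i + real N * s" using s by simp
      then have "real j = of_int \<lceil>real i + real N * s\<rceil>" by (simp add: j_def)
      then show "real i + real N * s \<le> real j" "real j < real i + real N * s + 1"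
        using ceiling_correct[of "real i + real N * s"] by linarith+
    qed
    have "real N * ?x \<le> real N" using x N by simp
    then have jN: "j \<in> {0..N}" using j gt by auto
    have "\<not> ?x \<le> real j / real N" using j gt N by (simp add: field_simps)
    then have "?c j < i" unfolding ordered_points_le_iff[OF i] by simp
    then show False using c[OF jN] j by auto
  qed
  moreover have "real i / real N \<le> ?x + s + 1 / real N"
  proof (rule ccontr)
    assume "\<not> ?thesis"
    then have gt: "real N * ?x < real i - real N * s - 1" using N by (simp add: field_simps)
    define j where "j = nat \<lfloor>real i - real N * s\<rfloor>"
    have "0 \<le> real N * ?x" using x N by simp
    then have j: "real j \<le> real i - real N * s" "real i - real N * s - 1 < real j"
      using gt by (auto simp: j_def)
    have jN: "j \<in> {0..N}" using j i s by auto (smt (verit) mult_nonneg_nonneg of_nat_0_le_iff of_nat_le_iff)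
    have "?x \<le> real j / real N" using j gt N by (simp add: field_simps)
    then have "i \<le> ?c j" unfolding ordered_points_le_iff[OF i] .
    then show False using c[OF jN] j by linarith
  qed
  ultimately show ?thesis by linarith
qed

lemma iid_uniform_measurable:
  assumes "prob_space Q" "iid_uniform Q N Y" "i \<in> {1..N}" shows "Y i \<in> borel_measurable Q"
proof -
  interpret prob_space Q by fact
  show ?thesis using assms unfolding iid_uniform_def indep_vars_def by auto
qed

lemma card_as_sum_indicator:
  fixes N :: nat
  shows
  "real (card {k \<in> {1..N}. Y k \<omega> \<le> t}) = (\<Sum>k=1..N. indicator {..t} (Y k \<omega>))"
proof -
  have "(\<Sum>k=1..N. indicator {..t} (Y k \<omega>)) = (\<Sum>k\<in>{1..N}. if Y k \<omega> \<le> t then 1 else 0 :: real)"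
    by (intro sum.cong) (auto simp: indicator_def)
  also have "\<dots> = real (card ({1..N} \<inter> {k. Y k \<omega> \<le> t}))" by (simp add: sum.If_cases)
  finally show ?thesis by (simp add: Int_def)
qed

lemma ordered_points_measurable:
  assumes "prob_space Q" "iid_uniform Q N Y" "i \<in> {1..N}"
  shows "ordered_points N Y i \<in> borel_measurable Q"
proof (rule borel_measurableI_le)
  fix t
  have [measurable]: "Y k \<in> borel_measurable Q" if "k \<in> {1..N}" for k
    using iid_uniform_measurable[OF assms(1,2) that] .
  have "{\<omega> \<in> space Q. ordered_points N Y i \<omega> \<le> t} = {\<omega> \<in> space Q. real i \<le> (\<Sum>k=1..N. indicator {..t} (Y k \<omega>))}"
    unfolding ordered_points_le_iff[OF assms(3)] card_as_sum_indicator[symmetric] by simp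
  also have "\<dots> \<in> sets Q" by measurable
  finally show "{\<omega> \<in> space Q. ordered_points N Y i \<omega> \<le> t} \<in> sets Q" .
qed

lemma empirical_cdf_Hoeffding:
  assumes Q: "prob_space Q" and Y: "iid_uniform Q N Y" and N: "N \<ge> 1" and t: "0 \<le> t" "t \<le> 1" and e: "\<epsilon> \<ge> 0"
  shows "measure Q {\<omega> \<in> space Q. \<bar>real (card {k \<in> {1..N}. Y k \<omega> \<le> t}) - real N * t\<bar> \<ge> \<epsilon>} \<le> 2 * exp (- 2 * \<epsilon>\<^sup>2 / real N)"
proof -
  interpret prob_space Q by fact
  have m: "Y k \<in> borel_measurable Q" if "k \<in> {1..N}" for k using iid_uniform_measurable[OF Q Y that] .
  have ex: "expectation (\<lambda>\<omega>. indicator {..t} (Y k \<omega>)) = t" if k: "k \<in> {1..N}" for k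
  proof -
    have d: "distr Q borel (Y k) = uniform_measure lborel {0..1}" using Y k by (auto simp: iid_uniform_def)
    have "expectation (\<lambda>\<omega>. indicator {..t} (Y k \<omega>)) = (\<integral>x. (indicator {..t} x :: real) \<partial>distr Q borel (Y k))"
      using integral_distr[OF m[OF k], of "indicator {..t} :: real \<Rightarrow> real"] by simp
    also have "\<dots> = measure (uniform_measure lborel {0..1}) {..t}" by (simp add: d)
    also have "\<dots> = measure lborel ({0..1} \<inter> {..t})" by (subst measure_uniform_measure) auto
    also have "{0..1} \<inter> {..t} = {0..t}" using t by auto
    finally show ?thesis using t by simp
  qed
  interpret Hoeffding_ineq Q "{1..N}" "\<lambda>k \<omega>. indicator {..t} (Y k \<omega>)" "\<lambda>_. 0" "\<lambda>_. 1" "real N * t"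
  proof unfold_locales
    have "indep_vars (\<lambda>_. borel) Y {1..N}" using Y by (simp add: iid_uniform_def)
    then show "indep_vars (\<lambda>_. borel) (\<lambda>k \<omega>. indicator {..t} (Y k \<omega>) :: real) {1..N}"
      by (rule indep_vars_compose2) auto
    show "real N * t \<equiv> (\<Sum>i=1..N. expectation (\<lambda>\<omega>. indicator {..t} (Y i \<omega>)))"
      using ex by (intro eq_reflection) simp
  qed (auto simp: indicator_def)
  have "prob {\<omega> \<in> space Q. \<bar>(\<Sum>k=1..N. indicator {..t} (Y k \<omega>)) - real N * t\<bar> \<ge> \<epsilon>} \<le> 2 * exp (- 2 * \<epsilon>\<^sup>2 / (\<Sum>k=1..N. (1 - 0)\<^sup>2))"
    by (rule Hoeffding_ineq_abs_ge) (use e N in auto)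
  then show ?thesis unfolding card_as_sum_indicator by simp
qed

text \<open>The deviation squared, \<open>2 * ln N / N\<close>, makes each Hoeffding tail
  \<open>2 / N ^ 4\<close>. The union over \<open>N + 1\<close> grid points still leaves a summable
  bound.\<close>

lemma order_statistics_concentration:
  assumes Q: "prob_space Q" and Y: "iid_uniform Q N Y" and N: "N \<ge> 2"
  shows "\<exists>B\<in>sets Q. measure Q B \<le> 4 / (real N)\<^sup>2 \<and>
     (\<forall>\<omega>\<in>space Q - B. \<forall>i\<in>{1..N}. \<bar>ordered_points N Y i \<omega> - real i / real N\<bar> \<le> sqrt (2 * ln (real N) / real N) + 1 / real N)"
proof -
  interpret prob_space Q by fact
  define s where "s = sqrt (2 * ln (real N) / real N)"
  define A where "A j = {\<omega> \<in> space Q. \<bar>real (card {k \<in> {1..N}. Y k \<omega> \<le> real j / real N}) - real j\<bar> \<ge> real N * s}" for j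
  have s: "s \<ge> 0" "s\<^sup>2 = 2 * ln (real N) / real N" using N by (auto simp: s_def)
  have [measurable]: "Y k \<in> borel_measurable Q" if "k \<in> {1..N}" for k using iid_uniform_measurable[OF Q Y that] .
  have A: "A j \<in> sets Q" for j unfolding A_def card_as_sum_indicator by measurable
  have pA: "prob (A j) \<le> 2 / real N ^ 4" if "j \<in> {0..N}" for j
  proof -
    have "prob (A j) \<le> 2 * exp (- 2 * (real N * s)\<^sup>2 / real N)"
      using empirical_cdf_Hoeffding[OF Q Y, of "real j / real N" "real N * s"] N s(1) that by (simp add: A_def)
    also have "- 2 * (real N * s)\<^sup>2 / real N = - (4 * ln (real N))"
      using N s(2) by (simp add: power_mult_distrib power2_eq_square field_simps)
    also have "exp \<dots> = 1 / real N ^ 4"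
      using N exp_of_nat_mult[of 4 "ln (real N)"] by (simp add: exp_minus inverse_eq_divide)
    finally show ?thesis by simp
  qed
  have "prob (\<Union>j\<in>{0..N}. A j) \<le> (\<Sum>j\<in>{0..N}. prob (A j))"
    using A by (intro finite_measure_subadditive_finite) auto
  also have "\<dots> \<le> (\<Sum>j\<in>{0..N}. 2 / real N ^ 4)" by (rule sum_mono[OF pA])
  also have "\<dots> = 2 * (real N + 1) / real N ^ 4" by simp
  also have "\<dots> \<le> 2 * (2 * (real N)\<^sup>2) / real N ^ 4"
  proof (intro divide_right_mono mult_left_mono)
    have "real N * 2 \<le> real N * real N" using N by (intro mult_left_mono) auto
    then show "real N + 1 \<le> 2 * (real N)\<^sup>2" unfolding power2_eq_square using N by linarith
  qed auto
  also have "\<dots> = 4 / (real N)\<^sup>2" using N by (simp add: field_simps flip: power_add)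
  finally have "prob (\<Union>j\<in>{0..N}. A j) \<le> 4 / (real N)\<^sup>2" .
  moreover have "\<bar>ordered_points N Y i \<omega> - real i / real N\<bar> \<le> s + 1 / real N"
    if "\<omega> \<in> space Q - (\<Union>j\<in>{0..N}. A j)" "i \<in> {1..N}" for \<omega> i
    by (rule ordered_points_near_grid[OF that(2) _ s(1)])
      (use that Y in \<open>auto simp: iid_uniform_def A_def not_le\<close>)
  ultimately show ?thesis using A unfolding s_def by (intro bexI[of _ "\<Union>j\<in>{0..N}. A j"]) auto
qed

section \<open>Blockwise Lipschitz graphons\<close>

text \<open>An interval is the open interval between its infimum and supremum plus at most these two
  points.\<close>

lemma bounded_interval_borel:
  fixes I :: "real set"
  assumes "is_interval I" "I \<subseteq> {a..b}" shows "I \<in> sets borel"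
proof (cases "I = {}")
  case False
  have bdd: "bdd_above I" "bdd_below I" using assms(2) by (auto intro: bdd_above_mono bdd_below_mono)
  have "I = {Inf I<..<Sup I} \<union> (I \<inter> {Inf I, Sup I})"
  proof (intro equalityI subsetI)
    fix x assume x: "x \<in> I"
    then have "Inf I \<le> x" "x \<le> Sup I" using bdd by (auto intro: cInf_lower cSup_upper)
    then show "x \<in> {Inf I<..<Sup I} \<union> (I \<inter> {Inf I, Sup I})" using x by auto
  next
    fix x assume "x \<in> {Inf I<..<Sup I} \<union> (I \<inter> {Inf I, Sup I})"
    moreover have "x \<in> I" if "Inf I < x" "x < Sup I"
    proof -
      obtain y where y: "y \<in> I" "y < x" using \<open>Inf I < x\<close> unfolding cInf_less_iff[OF False bdd(2)] by blast
      obtain z where z: "z \<in> I" "x < z" using \<open>x < Sup I\<close> unfolding less_cSup_iff[OF False bdd(1)] by blast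
      show ?thesis using assms(1) y z unfolding is_interval_1 by (meson less_imp_le)
    qed
    ultimately show "x \<in> I" by auto
  qed
  moreover have "finite (I \<inter> {Inf I, Sup I})" by simp
  ultimately show ?thesis
    by (metis borel_closed borel_open finite_imp_closed open_greaterThanLessThan sets.Un)
qed simp

text \<open>A graphon is only Lebesgue measurable by definition. Continuity on finitely many Borel
  rectangles upgrades this to Borel, which makes the sections measurable for \<open>\<nu>\<close>
  and the sampled weights random variables.\<close>

lemma blockwise_lipschitz_borel:
  assumes "blockwise_lipschitz W"
  shows "(\<lambda>(x, y). W x y) \<in> borel_measurable (restrict_space borel ({0..1} \<times> {0..1}))"
proof -
  obtain L \<I> where \<I>0: "finite \<I>" "partition_on {0..1} \<I>" "\<forall>I\<in>\<I>. is_interval I"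
    and L0: "\<forall>I\<in>\<I>. \<forall>J\<in>\<I>. \<forall>x\<in>I. \<forall>x'\<in>I. \<forall>y\<in>J. \<forall>y'\<in>J. \<bar>W x y - W x' y'\<bar> \<le> L * (\<bar>x - x'\<bar> + \<bar>y - y'\<bar>)"
    using assms unfolding blockwise_lipschitz_def by (elim exE conjE) (rule that)
  note \<I> = \<I>0(1,2) \<I>0(3)[rule_format]
  have L: "\<bar>W x y - W x' y'\<bar> \<le> L * (\<bar>x - x'\<bar> + \<bar>y - y'\<bar>)"
    if "I \<in> \<I>" "J \<in> \<I>" "x \<in> I" "x' \<in> I" "y \<in> J" "y' \<in> J" for I J x x' y y'
    by (rule L0[rule_format, OF that])
  define D where "D = (\<lambda>(I, J). I \<times> J) ` (\<I> \<times> \<I>)"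
  have U: "\<Union>\<I> = {0..1}" using \<I>(2) by (simp add: partition_on_def)
  have borelI: "I \<in> sets borel" if "I \<in> \<I>" for I
    by (rule bounded_interval_borel) (use \<I>(3)[OF that] that U in auto)
  show ?thesis
  proof (rule measurable_piecewise_restrict[of D])
    show "countable D" using \<I>(1) by (simp add: D_def countable_finite)
    show "space (restrict_space borel ({0..1} \<times> {0..1})) \<subseteq> \<Union> D"
    proof
      fix q :: "real \<times> real" assume "q \<in> space (restrict_space borel ({0..1} \<times> {0..1 :: real}))"
      then have "fst q \<in> \<Union>\<I>" "snd q \<in> \<Union>\<I>" unfolding U by (auto simp: space_restrict_space)
      then obtain I J where "I \<in> \<I>" "J \<in> \<I>" "q \<in> I \<times> J" by (cases q) auto
      then show "q \<in> \<Union> D" unfolding D_def by blast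
    qed
    fix \<Omega> assume "\<Omega> \<in> D"
    then obtain I J where IJ: "I \<in> \<I>" "J \<in> \<I>" "\<Omega> = I \<times> J" by (auto simp: D_def)
    have sub: "\<Omega> \<subseteq> {0..1} \<times> {0..1}" using IJ U by auto
    have b: "\<Omega> \<in> sets borel" unfolding IJ(3) borel_prod[symmetric] using borelI IJ by auto
    show "\<Omega> \<inter> space (restrict_space borel ({0..1} \<times> {0..1})) \<in> sets (restrict_space borel ({0..1} \<times> {0..1}))"
      using sub b by (auto simp: sets_restrict_space space_restrict_space)
    have L0: "0 \<le> \<bar>L\<bar>" by simp
    have "continuous_on \<Omega> (\<lambda>(x, y). W x y)"
    proof (rule continuous_onI)
      fix p e assume p: "p \<in> \<Omega>" and "e > (0::real)"
      show "\<exists>d>0. \<forall>q\<in>\<Omega>. dist q p < d \<longrightarrow> dist (case q of (x, y) \<Rightarrow> W x y) (case p of (x, y) \<Rightarrow> W x y) \<le> e"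
      \<comment> \<open>The factor 2 pays for two coordinate distances; the added 1 keeps the radius
        meaningful for \<open>L = 0\<close>.\<close>
      proof (intro exI[of _ "e / (2 * \<bar>L\<bar> + 1)"] conjI ballI impI)
        show "0 < e / (2 * \<bar>L\<bar> + 1)" using \<open>e > 0\<close> by simp
        fix q assume q: "q \<in> \<Omega>" "dist q p < e / (2 * \<bar>L\<bar> + 1)"
        obtain x y x' y' where xy: "p = (x, y)" "q = (x', y')" by (cases p, cases q) auto
        have "\<bar>W x' y' - W x y\<bar> \<le> L * (\<bar>x' - x\<bar> + \<bar>y' - y\<bar>)"
          using L[OF IJ(1,2)] p q xy IJ(3) by auto
        also have "\<dots> \<le> \<bar>L\<bar> * (\<bar>x' - x\<bar> + \<bar>y' - y\<bar>)" by (intro mult_right_mono) auto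
        also have "\<dots> \<le> \<bar>L\<bar> * (dist q p + dist q p)"
          using dist_fst_le[of q p] dist_snd_le[of q p] by (intro mult_left_mono add_mono) (auto simp: xy dist_real_def)
        also have "\<dots> \<le> (2 * \<bar>L\<bar> + 1) * dist q p" by (simp add: algebra_simps)
        also have "\<dots> \<le> e" using q(2) by (simp add: field_simps)
        finally show "dist (case q of (x, y) \<Rightarrow> W x y) (case p of (x, y) \<Rightarrow> W x y) \<le> e"
          unfolding xy dist_real_def prod.case .
      qed
    qed
    then have "(\<lambda>(x, y). W x y) \<in> borel_measurable (restrict_space borel \<Omega>)"
      by (rule borel_measurable_continuous_on_restrict)
    moreover have "restrict_space (restrict_space borel ({0..1} \<times> {0..1})) \<Omega> = restrict_space borel \<Omega>"
      using sub b borel_closed[OF closed_Times, of "{0..1::real}" "{0..1::real}"]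
      by (subst restrict_restrict_space) (auto simp: Int_absorb1 Int_absorb2)
    ultimately show "(\<lambda>(x, y). W x y) \<in> borel_measurable (restrict_space (restrict_space borel ({0..1} \<times> {0..1})) \<Omega>)"
      by simp
  qed
qed

lemma blockwise_lipschitz_section:
  assumes "blockwise_lipschitz W" "x \<in> {0..1}"
  shows "(\<lambda>y. W x y) \<in> borel_measurable (restrict_space borel {0..1})"
proof -
  have "(\<lambda>y. (x, y)) \<in> measurable (restrict_space borel {0..1}) (restrict_space borel ({0..1} \<times> {0..1}))"
    using assms(2)
    by (intro measurable_restrict_space2 measurable_restrict_space1 borel_measurable_continuous_onI continuous_intros)
      (auto simp: space_restrict_space)
  from measurable_compose[OF this blockwise_lipschitz_borel[OF assms(1)]] show ?thesis by simp
qed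

text \<open>
  Two points in different blocks are separated by an end point of a block, so the graphon is
  Lipschitz away from a neighbourhood of the finitely many end points.
\<close>

definition near :: "real set \<Rightarrow> real \<Rightarrow> real set" where
  "near C d = {x \<in> {0..1}. \<exists>c\<in>C. \<bar>x - c\<bar> \<le> d}"

lemma blockwise_lipschitz_off_boundary:
  assumes "blockwise_lipschitz W"
  shows "\<exists>C L. finite C \<and> L \<ge> 0 \<and> (\<forall>x\<in>{0..1}. \<forall>y\<in>{0..1}. \<forall>x'\<in>{0..1}. \<forall>y'\<in>{0..1}. \<forall>d.
     \<bar>x - x'\<bar> \<le> d \<longrightarrow> \<bar>y - y'\<bar> \<le> d \<longrightarrow> x \<notin> near C d \<longrightarrow> y \<notin> near C d \<longrightarrow> \<bar>W x y - W x' y'\<bar> \<le> 2 * L * d)"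
proof -
  obtain L \<I> where \<I>0: "finite \<I>" "partition_on {0..1} \<I>" "\<forall>I\<in>\<I>. is_interval I"
    and L0: "\<forall>I\<in>\<I>. \<forall>J\<in>\<I>. \<forall>x\<in>I. \<forall>x'\<in>I. \<forall>y\<in>J. \<forall>y'\<in>J. \<bar>W x y - W x' y'\<bar> \<le> L * (\<bar>x - x'\<bar> + \<bar>y - y'\<bar>)"
    using assms unfolding blockwise_lipschitz_def by (elim exE conjE) (rule that)
  note \<I> = \<I>0(1,2) \<I>0(3)[rule_format]
  have L: "\<bar>W x y - W x' y'\<bar> \<le> L * (\<bar>x - x'\<bar> + \<bar>y - y'\<bar>)"
    if "I \<in> \<I>" "J \<in> \<I>" "x \<in> I" "x' \<in> I" "y \<in> J" "y' \<in> J" for I J x x' y y'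
    by (rule L0[rule_format, OF that])
  define C where "C = Sup ` \<I> \<union> Inf ` \<I>"
  have U: "\<Union>\<I> = {0..1}" using \<I>(2) by (simp add: partition_on_def)
  \<comment> \<open>A point outside the block of \<open>x\<close> lies beyond the supremum or
    infimum of that block; if it is within \<open>d\<close> of \<open>x\<close>, so is this end
    point.\<close>
  have same: "x' \<in> I" if I: "I \<in> \<I>" "x \<in> I" and x: "x' \<in> {0..1}" "\<bar>x - x'\<bar> \<le> d" "x \<notin> near C d" for I x x' d
  proof (rule ccontr)
    assume x': "x' \<notin> I"
    have I01: "I \<subseteq> {0..1}" using I U by auto
    then have bdd: "bdd_above I" "bdd_below I" by (auto intro: bdd_above_mono bdd_below_mono)
    have "x \<noteq> x'" using x' I by auto
    then consider "x < x'" | "x' < x" by linarith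
    then have "\<exists>c\<in>C. \<bar>x - c\<bar> \<le> d"
    proof cases
      case 1
      have "z \<le> x'" if "z \<in> I" for z
      proof (rule ccontr)
        assume "\<not> z \<le> x'"
        then have "x' \<in> I" using \<I>(3)[OF I(1)] I(2) that 1 unfolding is_interval_1 by (meson less_imp_le not_le)
        then show False using x' by simp
      qed
      then have "Sup I \<le> x'" using I(2) by (intro cSup_least) auto
      moreover have "x \<le> Sup I" using I(2) bdd by (intro cSup_upper)
      ultimately show ?thesis using x(2) I(1) by (intro bexI[of _ "Sup I"]) (auto simp: C_def)
    next
      case 2
      have "x' \<le> z" if "z \<in> I" for z
      proof (rule ccontr)
        assume "\<not> x' \<le> z"
        then have "x' \<in> I" using \<I>(3)[OF I(1)] I(2) that 2 unfolding is_interval_1 by (meson less_imp_le not_le)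
        then show False using x' by simp
      qed
      then have "x' \<le> Inf I" using I(2) by (intro cInf_greatest) auto
      moreover have "Inf I \<le> x" using I(2) bdd by (intro cInf_lower)
      ultimately show ?thesis using x(2) I(1) by (intro bexI[of _ "Inf I"]) (auto simp: C_def)
    qed
    then show False using x(3) I I01 by (auto simp: near_def)
  qed
  have "\<bar>W x y - W x' y'\<bar> \<le> 2 * max L 0 * d"
    if h: "x \<in> {0..1}" "y \<in> {0..1}" "x' \<in> {0..1}" "y' \<in> {0..1}" "\<bar>x - x'\<bar> \<le> d" "\<bar>y - y'\<bar> \<le> d"
      "x \<notin> near C d" "y \<notin> near C d" for x y x' y' d
  proof -
    obtain I J where IJ: "I \<in> \<I>" "J \<in> \<I>" "x \<in> I" "y \<in> J" using h(1,2) U by (metis Union_iff)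
    have "\<bar>W x y - W x' y'\<bar> \<le> L * (\<bar>x - x'\<bar> + \<bar>y - y'\<bar>)"
      using IJ same[OF IJ(1,3) h(3,5,7)] same[OF IJ(2,4) h(4,6,8)] by (intro L) auto
    also have "\<dots> \<le> max L 0 * (d + d)" using h(5,6) by (intro mult_mono) auto
    finally show ?thesis by simp
  qed
  moreover have "finite C" using \<I>(1) by (simp add: C_def)
  ultimately show ?thesis by (intro exI[of _ C] exI[of _ "max L 0"]) auto
qed

section \<open>Mean-square error of the sampled step kernel\<close>

context graphon_game
begin

lemma near_measure:
  assumes "finite C" "d \<ge> 0" shows "near C d \<in> sets \<nu>" "measure \<nu> (near C d) \<le> 2 * real (card C) * d"
proof -
  have "\<bar>x - c\<bar> \<le> d \<longleftrightarrow> x \<in> {c - d..c + d}" for x c by auto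
  then have e: "near C d = (\<Union>c\<in>C. {c - d..c + d} \<inter> {0..1})" unfolding near_def by blast
  have s: "{c - d..c + d} \<inter> {0..1} \<in> sets \<nu>" "measure \<nu> ({c - d..c + d} \<inter> {0..1}) \<le> 2 * d" for c
  proof -
    have b: "{c - d..c + d} \<inter> {0..1} \<in> sets borel" by simp
    show "{c - d..c + d} \<inter> {0..1} \<in> sets \<nu>" using borel_nu(1)[OF b] by auto
    have "emeasure \<nu> ({c - d..c + d} \<inter> {0..1}) = emeasure lborel ({c - d..c + d} \<inter> {0..1})"
      using borel_nu(2)[OF b] by auto
    also have "\<dots> \<le> emeasure lborel {c - d..c + d}" by (intro emeasure_mono) auto
    also have "\<dots> = ennreal (2 * d)" using assms by simp
    finally show "measure \<nu> ({c - d..c + d} \<inter> {0..1}) \<le> 2 * d"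
      using assms by (simp add: measure_def enn2real_leI)
  qed
  show "near C d \<in> sets \<nu>" unfolding e using assms s by (intro sets.finite_UN) auto
  have "measure \<nu> (near C d) \<le> (\<Sum>c\<in>C. measure \<nu> ({c - d..c + d} \<inter> {0..1}))"
    unfolding e using assms s by (intro nu.finite_measure_subadditive_finite) auto
  also have "\<dots> \<le> (\<Sum>c\<in>C. 2 * d)" by (intro sum_mono s)
  finally show "measure \<nu> (near C d) \<le> 2 * real (card C) * d" by simp
qed

text \<open>For \<open>x\<close> near an end point the row error is bounded trivially by 1. For
  other \<open>x\<close>, the bad \<open>y\<close> contribute the measure \<open>m\<close> of the
  neighbourhood and the good \<open>y\<close> contribute \<open>2 * L * d\<close>, together
  \<open>b\<close>. The majorant \<open>\<beta>\<close> adds \<open>b\<close> to the indicator of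
  the neighbourhood, and it is the indicator that makes the squared error of order \<open>d\<close>
  and not \<open>d\<close> squared.\<close>

lemma sampling_error:
  assumes W: "graphon W" "blockwise_lipschitz W"
  shows "\<exists>K\<ge>0. \<forall>N\<ge>1. \<forall>p d. 0 \<le> d \<and> d \<le> 1 \<and> (\<forall>i\<in>{1..N}. p i \<in> {0..1} \<and> (\<forall>x\<in>cell N i. \<bar>x - p i\<bar> \<le> d)) \<longrightarrow>
     (\<exists>\<beta> B. \<beta> \<in> borel_measurable \<nu> \<and> (\<forall>x\<in>{0..1}. 0 \<le> \<beta> x \<and> \<beta> x \<le> B) \<and> (\<integral>x. (\<beta> x)\<^sup>2 \<partial>\<nu>) \<le> K * d \<and>
       (\<forall>i\<in>{1..N}. \<forall>x\<in>cell N i. (\<integral>y. \<bar>W x y - (\<Sum>j=1..N. indicator (cell N j) y * W (p i) (p j))\<bar> \<partial>\<nu>) \<le> \<beta> x))"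
proof -
  obtain C L where C: "finite C" and L: "L \<ge> 0" and WL: "\<And>x y x' y' d. \<lbrakk>x \<in> {0..1}; y \<in> {0..1}; x' \<in> {0..1}; y' \<in> {0..1};
     \<bar>x - x'\<bar> \<le> d; \<bar>y - y'\<bar> \<le> d; x \<notin> near C d; y \<notin> near C d\<rbrakk> \<Longrightarrow> \<bar>W x y - W x' y'\<bar> \<le> 2 * L * d"
    using blockwise_lipschitz_off_boundary[OF W(2)] by blast
  have W01: "0 \<le> W x y" "W x y \<le> 1" if "x \<in> {0..1}" "y \<in> {0..1}" for x y using W(1) that by (auto simp: graphon_def)
  define c where "c = real (card C)"
  \<comment> \<open>From \<open>(\<beta> x)\<^sup>2\<close> at most twice the indicator plus
    \<open>2 * b\<^sup>2\<close>, with \<open>m \<le> 2 * c * d\<close>,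
    \<open>b \<le> (2 * c + 2 * L) * d\<close> and \<open>d\<^sup>2 \<le> d\<close>.\<close>
  define K where "K = 4 * c + 2 * (2 * c + 2 * L)\<^sup>2"
  have c0: "0 \<le> c" by (simp add: c_def)
  show ?thesis
  proof (intro exI[of _ K] conjI allI impI)
    show "K \<ge> 0" using c0 by (simp add: K_def)
    fix N :: nat and p :: "nat \<Rightarrow> real" and d :: real
    assume N: "N \<ge> 1" and "0 \<le> d \<and> d \<le> 1 \<and> (\<forall>i\<in>{1..N}. p i \<in> {0..1} \<and> (\<forall>x\<in>cell N i. \<bar>x - p i\<bar> \<le> d))"
    then have d: "0 \<le> d" "d \<le> 1" and p: "\<And>i. i \<in> {1..N} \<Longrightarrow> p i \<in> {0..1}" "\<And>i x. i \<in> {1..N} \<Longrightarrow> x \<in> cell N i \<Longrightarrow> \<bar>x - p i\<bar> \<le> d"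
      by auto
    define m where "m = measure \<nu> (near C d)"
    have nm [measurable]: "near C d \<in> sets \<nu>" and m: "0 \<le> m" "m \<le> 2 * c * d"
      using near_measure[OF C d(1)] by (auto simp: m_def c_def)
    define b where "b = m + 2 * L * d"
    have b: "0 \<le> b" "b \<le> (2 * c + 2 * L) * d" using m L d by (auto simp: b_def algebra_simps)
    define \<beta> where "\<beta> x = indicator (near C d) x + b" for x
    have in_int: "integrable \<nu> (indicator (near C d) :: real \<Rightarrow> real)"
      using nm by (intro integrable_real_indicator) (auto simp: nu.emeasure_eq_measure)
    show "\<exists>\<beta> B. \<beta> \<in> borel_measurable \<nu> \<and> (\<forall>x\<in>{0..1}. 0 \<le> \<beta> x \<and> \<beta> x \<le> B) \<and> (\<integral>x. (\<beta> x)\<^sup>2 \<partial>\<nu>) \<le> K * d \<and>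
       (\<forall>i\<in>{1..N}. \<forall>x\<in>cell N i. (\<integral>y. \<bar>W x y - (\<Sum>j=1..N. indicator (cell N j) y * W (p i) (p j))\<bar> \<partial>\<nu>) \<le> \<beta> x)"
    proof (intro exI[of _ \<beta>] exI[of _ "1 + b"] conjI ballI)
      show bm: "\<beta> \<in> borel_measurable \<nu>" unfolding \<beta>_def by measurable
      show "0 \<le> \<beta> x" "\<beta> x \<le> 1 + b" for x using b by (auto simp: \<beta>_def indicator_def)
      have "(\<integral>x. (\<beta> x)\<^sup>2 \<partial>\<nu>) \<le> (\<integral>x. 2 * indicator (near C d) x + 2 * b\<^sup>2 \<partial>\<nu>)"
      proof (rule integral_mono)
        show "integrable \<nu> (\<lambda>x. (\<beta> x)\<^sup>2)"
          using bm b by (intro nu.integrable_const_bound[of _ "(1 + b)\<^sup>2"])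
            (auto simp: \<beta>_def indicator_def intro!: power_mono)
        show "integrable \<nu> (\<lambda>x. 2 * indicator (near C d) x + 2 * b\<^sup>2)" using in_int by simp
        show "(\<beta> x)\<^sup>2 \<le> 2 * indicator (near C d) x + 2 * b\<^sup>2" for x
          using sum_power2_le[of 1 b] by (auto simp: \<beta>_def indicator_def)
      qed
      also have "\<dots> = 2 * m + 2 * b\<^sup>2" using in_int by (simp add: m_def nu.prob_space)
      also have "\<dots> \<le> 2 * (2 * c * d) + 2 * ((2 * c + 2 * L) * d)\<^sup>2"
        using m b by (intro add_mono mult_left_mono power_mono) auto
      also have "\<dots> \<le> 4 * c * d + 2 * ((2 * c + 2 * L)\<^sup>2 * d)"
      proof -
        have "d\<^sup>2 \<le> d" using d by (simp add: power2_eq_square mult_left_le_one_le)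
        then show ?thesis by (simp add: power_mult_distrib mult_left_mono)
      qed
      also have "\<dots> = K * d" by (simp add: K_def algebra_simps)
      finally show "(\<integral>x. (\<beta> x)\<^sup>2 \<partial>\<nu>) \<le> K * d" .
      fix i x assume i: "i \<in> {1..N}" "x \<in> cell N i"
      have x: "x \<in> {0..1}" using cell_subset[OF i(1)] i(2) by auto
      let ?k = "\<lambda>y. \<Sum>j=1..N. indicator (cell N j) y * W (p i) (p j)"
      have km: "?k \<in> borel_measurable \<nu>"
        by (intro borel_measurable_sum borel_measurable_times borel_measurable_indicator cell_nu) auto
      have Wm: "(\<lambda>y. W x y) \<in> borel_measurable \<nu>" by (rule measurable_nu[OF blockwise_lipschitz_section[OF W(2) x]])
      have bound: "\<bar>W x y - ?k y\<bar> \<le> 1" "x \<notin> near C d \<Longrightarrow> \<bar>W x y - ?k y\<bar> \<le> indicator (near C d) y + 2 * L * d"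
        if y: "y \<in> {0..1}" for y
      proof -
        obtain j where j: "j \<in> {1..N}" "y \<in> cell N j" using cell_cover[OF N y] by blast
        have k: "?k y = W (p i) (p j)" by (rule sum_indicator_cell[OF j])
        show 1: "\<bar>W x y - ?k y\<bar> \<le> 1" unfolding k
          using W01[OF x y] W01[OF p(1)[OF i(1)] p(1)[OF j(1)]] by auto
        assume xn: "x \<notin> near C d"
        show "\<bar>W x y - ?k y\<bar> \<le> indicator (near C d) y + 2 * L * d"
        proof (cases "y \<in> near C d")
          case True
          then show ?thesis using 1 mult_nonneg_nonneg[OF L d(1)] by simp
        next
          case False
          then show ?thesis unfolding k
            using WL[OF x y p(1)[OF i(1)] p(1)[OF j(1)] p(2)[OF i] p(2)[OF j] xn False] by simp
        qed
      qed
      have ki: "integrable \<nu> (\<lambda>y. \<bar>W x y - ?k y\<bar>)"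
      proof (rule nu.integrable_const_bound[of _ 1], rule AE_I2)
        show "norm \<bar>W x y - ?k y\<bar> \<le> 1" if "y \<in> space \<nu>" for y using bound(1) that by (simp add: space_nu)
      qed (use km Wm in measurable)
      show "(\<integral>y. \<bar>W x y - ?k y\<bar> \<partial>\<nu>) \<le> \<beta> x"
      proof (cases "x \<in> near C d")
        case True
        have "(\<integral>y. \<bar>W x y - ?k y\<bar> \<partial>\<nu>) \<le> (\<integral>y. 1 \<partial>\<nu>)"
          using bound(1) ki by (intro integral_mono) (auto simp: space_nu)
        then show ?thesis using True b by (simp add: \<beta>_def nu.prob_space)
      next
        case False
        have "(\<integral>y. \<bar>W x y - ?k y\<bar> \<partial>\<nu>) \<le> (\<integral>y. indicator (near C d) y + 2 * L * d \<partial>\<nu>)"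
          using bound(2) False ki in_int by (intro integral_mono) (auto simp: space_nu)
        also have "\<dots> = b" using in_int by (simp add: b_def m_def nu.prob_space)
        finally show ?thesis using False by (simp add: \<beta>_def)
      qed
    qed
  qed
qed

end

section \<open>Spectral norm of a symmetric matrix from traces of powers\<close>

primrec mat_pow :: "nat \<Rightarrow> (nat \<Rightarrow> nat \<Rightarrow> real) \<Rightarrow> nat \<Rightarrow> nat \<Rightarrow> nat \<Rightarrow> real" where
  "mat_pow N A 0 i j = of_bool (i = j)"
| "mat_pow N A (Suc k) i j = (\<Sum>l=1..N. A i l * mat_pow N A k l j)"

lemma mat_pow_add:
  assumes "i \<in> {1..N}"
  shows "mat_pow N A (a + b) i j = (\<Sum>l=1..N. mat_pow N A a i l * mat_pow N A b l j)"
  using assms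
proof (induction a arbitrary: i)
  case 0
  have "(\<Sum>l=1..N. mat_pow N A 0 i l * mat_pow N A b l j) = (\<Sum>l\<in>{1..N}. if l = i then mat_pow N A b i j else 0)"
    by (intro sum.cong) auto
  then show ?case using 0 by simp
next
  case (Suc a)
  have "mat_pow N A (Suc a + b) i j = (\<Sum>m=1..N. A i m * (\<Sum>l=1..N. mat_pow N A a m l * mat_pow N A b l j))"
    using Suc.IH by (auto intro!: sum.cong)
  also have "\<dots> = (\<Sum>m=1..N. \<Sum>l=1..N. A i m * mat_pow N A a m l * mat_pow N A b l j)"
    by (simp add: sum_distrib_left mult.assoc)
  also have "\<dots> = (\<Sum>l=1..N. \<Sum>m=1..N. A i m * mat_pow N A a m l * mat_pow N A b l j)" by (rule sum.swap)
  also have "\<dots> = (\<Sum>l=1..N. mat_pow N A (Suc a) i l * mat_pow N A b l j)"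
    by (simp add: sum_distrib_right)
  finally show ?case .
qed

lemma mat_pow_1: "j \<in> {1..N} \<Longrightarrow> mat_pow N A (Suc 0) i j = A i j"
proof -
  assume "j \<in> {1..N}"
  moreover have "(\<Sum>l=1..N. A i l * of_bool (l = j)) = (\<Sum>l\<in>{1..N}. if l = j then A i j else 0)"
    by (intro sum.cong) auto
  ultimately show ?thesis by simp
qed

lemma mat_pow_sym:
  assumes A: "\<And>i j. A i j = A j i" and "i \<in> {1..N}" "j \<in> {1..N}"
  shows "mat_pow N A k i j = mat_pow N A k j i"
  using assms(2,3)
proof (induction k arbitrary: i j)
  case (Suc k)
  have "mat_pow N A (Suc k) i j = (\<Sum>l=1..N. mat_pow N A k j l * A l i)"
    using Suc by (auto intro!: sum.cong simp: A[of i])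
  also have "\<dots> = (\<Sum>l=1..N. mat_pow N A k j l * mat_pow N A (Suc 0) l i)"
    using mat_pow_1[OF Suc.prems(1), of A] by simp
  also have "\<dots> = mat_pow N A (k + Suc 0) j i" using mat_pow_add[OF Suc.prems(2), of A k "Suc 0" i] by simp
  finally show ?case by simp
qed auto

lemma trace_even_power:
  assumes "\<And>i j. A i j = A j i"
  shows "(\<Sum>i=1..N. mat_pow N A (2 * k) i i) = (\<Sum>i=1..N. \<Sum>j=1..N. (mat_pow N A k i j)\<^sup>2)"
proof (rule sum.cong[OF refl])
  fix i assume i: "i \<in> {1..N}"
  have "mat_pow N A (2 * k) i i = (\<Sum>l=1..N. mat_pow N A k i l * mat_pow N A k l i)"
    using mat_pow_add[OF i, of A k k i] by (simp add: mult_2)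
  also have "\<dots> = (\<Sum>l=1..N. (mat_pow N A k i l)\<^sup>2)"
    using mat_pow_sym[OF assms _ i] by (auto intro!: sum.cong simp: power2_eq_square)
  finally show "mat_pow N A (2 * k) i i = (\<Sum>j=1..N. (mat_pow N A k i j)\<^sup>2)" .
qed

text \<open>No eigenvalues are used. The squared norms \<open>b m\<close> of the iterates of
  \<open>A\<close> on \<open>u\<close> are log-convex by Cauchy-Schwarz and symmetry, so the
  \<open>k\<close>-th power of \<open>b 1 / b 0\<close> is at most \<open>b k / b 0\<close>, which
  the squared Frobenius norm of the \<open>k\<close>-th matrix power, that is the trace,
  bounds.\<close>

lemma spectral_bound_from_trace:
  fixes A :: "nat \<Rightarrow> nat \<Rightarrow> real"
  assumes A: "\<And>i j. A i j = A j i" and k: "k \<ge> 1" and c: "c \<ge> 0"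
    and tr: "(\<Sum>i=1..N. mat_pow N A (2 * k) i i) \<le> c ^ k"
  shows "(\<Sum>i=1..N. (\<Sum>j=1..N. A i j * u j)\<^sup>2) \<le> c * (\<Sum>j=1..N. (u j)\<^sup>2)"
proof -
  define v where "v m i = (\<Sum>j=1..N. mat_pow N A m i j * u j)" for m i
  define b where "b m = (\<Sum>i=1..N. (v m i)\<^sup>2)" for m
  have v0: "v 0 i = u i" if "i \<in> {1..N}" for i
  proof -
    have "v 0 i = (\<Sum>j\<in>{1..N}. if j = i then u i else 0)" unfolding v_def by (intro sum.cong) auto
    then show ?thesis using that by simp
  qed
  have vS: "v (Suc m) i = (\<Sum>l=1..N. A i l * v m l)" for m i
  proof -
    have "v (Suc m) i = (\<Sum>j=1..N. \<Sum>l=1..N. A i l * mat_pow N A m l j * u j)"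
      by (simp add: v_def sum_distrib_right)
    also have "\<dots> = (\<Sum>l=1..N. \<Sum>j=1..N. A i l * mat_pow N A m l j * u j)" by (rule sum.swap)
    finally show ?thesis by (simp add: v_def sum_distrib_left mult.assoc)
  qed
  have b0: "0 \<le> b m" for m by (simp add: b_def sum_nonneg)
  have conv: "(b (Suc m))\<^sup>2 \<le> b m * b (Suc (Suc m))" for m
  proof -
    have "b (Suc m) = (\<Sum>i=1..N. \<Sum>l=1..N. A i l * v m l * v (Suc m) i)"
      by (simp add: b_def power2_eq_square sum_distrib_right vS[of m])
    also have "\<dots> = (\<Sum>l=1..N. \<Sum>i=1..N. A i l * v m l * v (Suc m) i)" by (rule sum.swap)
    also have "\<dots> = (\<Sum>l=1..N. v m l * v (Suc (Suc m)) l)"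
      by (simp add: vS[of "Suc m"] sum_distrib_left A[of _ "l" for l] mult_ac)
    finally show ?thesis unfolding b_def using Cauchy_Schwarz_ineq_sum[of "v m" "v (Suc (Suc m))" "{1..N}"] by simp
  qed
  \<comment> \<open>Monotonicity of the quotients \<open>b (Suc m) / b m\<close>, multiplied out
    because \<open>b m\<close> may vanish.\<close>
  have ratio: "b 1 * b m \<le> b 0 * b (Suc m)" for m
  proof (induction m)
    case (Suc m)
    show ?case
    proof (cases "b m = 0")
      case True
      then have "b (Suc m) = 0" using conv[of m] by simp
      then show ?thesis using b0 by simp
    next
      case False
      then have pos: "b m > 0" using b0[of m] by simp
      have "b m * (b 1 * b (Suc m)) \<le> b 0 * b (Suc m) * b (Suc m)"
        using mult_right_mono[OF Suc b0[of "Suc m"]] by (simp add: mult_ac)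
      also have "\<dots> \<le> b 0 * (b m * b (Suc (Suc m)))"
        using mult_left_mono[OF conv[of m] b0[of 0]] by (simp add: power2_eq_square mult.assoc)
      finally have "b m * (b 1 * b (Suc m)) \<le> b m * (b 0 * b (Suc (Suc m)))" by (simp add: mult_ac)
      then show ?thesis using pos by simp
    qed
  qed simp
  have pw: "b 1 ^ Suc m \<le> b (Suc m) * b 0 ^ m" for m
  proof (induction m)
    case (Suc m)
    have "b 1 ^ Suc (Suc m) \<le> b 1 * (b (Suc m) * b 0 ^ m)" using mult_left_mono[OF Suc b0[of 1]] by simp
    also have "\<dots> \<le> (b 0 * b (Suc (Suc m))) * b 0 ^ m"
      using mult_right_mono[OF ratio[of "Suc m"] zero_le_power[OF b0[of 0], of m]] by (simp add: mult.assoc)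
    finally show ?case by (simp add: mult_ac)
  qed simp
  obtain m where m: "k = Suc m" using k by (cases k) auto
  have "b k \<le> (\<Sum>i=1..N. (\<Sum>j=1..N. (mat_pow N A k i j)\<^sup>2) * (\<Sum>j=1..N. (u j)\<^sup>2))"
    unfolding b_def v_def by (intro sum_mono Cauchy_Schwarz_ineq_sum)
  also have "\<dots> = (\<Sum>i=1..N. mat_pow N A (2 * k) i i) * b 0"
    unfolding trace_even_power[OF A] b_def sum_distrib_right[symmetric] using v0 by simp
  also have "\<dots> \<le> c ^ k * b 0" using tr b0 by (intro mult_right_mono) auto
  finally have "b 1 ^ k \<le> c ^ k * b 0 * b 0 ^ m"
    using pw[of m] mult_right_mono[OF _ zero_le_power[OF b0[of 0], of m]] by (fastforce simp: m intro: order_trans)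
  then have "b 1 ^ Suc m \<le> (c * b 0) ^ Suc m" by (simp add: m power_mult_distrib mult_ac)
  then have "b 1 \<le> c * b 0" by (rule power_le_imp_le_base) (use c b0 in simp)
  then show ?thesis using v0 by (simp add: b_def vS)
qed

section \<open>Expansion of matrix powers over walks\<close>

definition walks :: "nat \<Rightarrow> nat \<Rightarrow> nat list set" where
  "walks N k = {w. set w \<subseteq> {1..N} \<and> length w = k}"

definition edge :: "nat \<Rightarrow> nat \<Rightarrow> nat \<times> nat" where
  "edge i j = (min i j, max i j)"

primrec walk_edges :: "nat \<Rightarrow> nat list \<Rightarrow> (nat \<times> nat) list" where
  "walk_edges i [] = []"
| "walk_edges i (l # w) = edge i l # walk_edges l w"

lemma finite_walks [simp]: "finite (walks N k)"
  unfolding walks_def using finite_lists_length_eq[of "{1..N}" k] by simp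

lemma walks_0: "walks N 0 = {[]}" by (auto simp: walks_def)

lemma sum_walks_Cons: "(\<Sum>w\<in>walks N (Suc k). f w) = (\<Sum>l=1..N. \<Sum>w\<in>walks N k. f (l # w))"
proof -
  have "walks N (Suc k) = (\<lambda>(l, w). l # w) ` ({1..N} \<times> walks N k)"
    by (auto simp: walks_def length_Suc_conv image_iff)
  then have "(\<Sum>w\<in>walks N (Suc k). f w) = (\<Sum>(l, w)\<in>{1..N} \<times> walks N k. f (l # w))"
    by (simp add: sum.reindex inj_on_def case_prod_unfold)
  then show ?thesis by (simp add: sum.cartesian_product)
qed

lemma sum_walks_snoc: "(\<Sum>w\<in>walks N (Suc k). f w) = (\<Sum>w\<in>walks N k. \<Sum>l=1..N. f (w @ [l]))"
proof -
  have "walks N (Suc k) = (\<lambda>(w, l). w @ [l]) ` (walks N k \<times> {1..N})"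
  proof (intro equalityI subsetI)
    fix w assume w: "w \<in> walks N (Suc k)"
    then have "w \<noteq> []" by (auto simp: walks_def)
    then have "w = butlast w @ [last w]" by simp
    moreover have "butlast w \<in> walks N k" "last w \<in> {1..N}"
      using w last_in_set[OF \<open>w \<noteq> []\<close>] by (auto simp: walks_def dest: in_set_butlastD)
    ultimately show "w \<in> (\<lambda>(w, l). w @ [l]) ` (walks N k \<times> {1..N})" by (intro image_eqI[of _ _ "(butlast w, last w)"]) auto
  qed (auto simp: walks_def)
  then have "(\<Sum>w\<in>walks N (Suc k). f w) = (\<Sum>(w, l)\<in>walks N k \<times> {1..N}. f (w @ [l]))"
    by (simp add: sum.reindex inj_on_def case_prod_unfold)
  then show ?thesis by (simp add: sum.cartesian_product)
qed

lemma walk_edges_snoc: "walk_edges i (w @ [l]) = walk_edges i w @ [edge (last (i # w)) l]"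
  by (induction w arbitrary: i) auto

lemma length_walk_edges [simp]: "length (walk_edges i w) = length w"
  by (induction w arbitrary: i) auto

lemma mat_pow_walks:
  fixes D :: "nat \<times> nat \<Rightarrow> real"
  shows "mat_pow N (\<lambda>i j. D (edge i j)) k i j = (\<Sum>w\<in>walks N k. prod_list (map D (walk_edges i w)) * of_bool (last (i # w) = j))"
proof (induction k arbitrary: i)
  case (Suc k)
  show ?case
    unfolding mat_pow.simps Suc.IH sum_walks_Cons sum_distrib_left
    by (intro sum.cong refl) (simp add: mult.assoc)
qed (auto simp: walks_0)

text \<open>
  A step along an edge already used ends in a vertex already visited, of which there are at most
  \<open>k + 1\<close> after \<open>k\<close> steps.
\<close>

lemma walk_generating_function:
  fixes z :: real
  assumes z: "z \<ge> 0"
  shows "(\<Sum>w\<in>walks N k. z ^ card (set (walk_edges i w))) \<le> (real N * z + real k) ^ k"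
proof -
  have step: "(\<Sum>l=1..N. z ^ card (set (walk_edges i (w @ [l])))) \<le> (real N * z + real (Suc k)) * z ^ card (set (walk_edges i w))"
    if w: "w \<in> walks N k" for w k
  proof -
    let ?E = "set (walk_edges i w)" and ?x = "last (i # w)"
    have vis: "l \<in> set (i # w)" if "edge a l \<in> set (walk_edges j w')" "set (j # w') \<subseteq> set (i # w)" for a l j w'
      using that
    proof (induction w' arbitrary: j)
      case (Cons m w')
      then show ?case by (auto simp: edge_def min_def max_def split: if_splits)
    qed simp
    have "(\<Sum>l=1..N. z ^ card (set (walk_edges i (w @ [l])))) \<le>
        (\<Sum>l=1..N. z * z ^ card ?E + (if l \<in> set (i # w) then z ^ card ?E else 0))"
    proof (rule sum_mono)
      fix l assume "l \<in> {1..N}"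
      show "z ^ card (set (walk_edges i (w @ [l]))) \<le> z * z ^ card ?E + (if l \<in> set (i # w) then z ^ card ?E else 0)"
      proof (cases "edge ?x l \<in> ?E")
        case True
        then have "l \<in> set (i # w)" using vis[of ?x l i w] by simp
        moreover have "set (walk_edges i (w @ [l])) = ?E" using True by (auto simp: walk_edges_snoc)
        ultimately show ?thesis using z by simp
      next
        case False
        then have "card (set (walk_edges i (w @ [l]))) = Suc (card ?E)" by (simp add: walk_edges_snoc)
        then show ?thesis using z by simp
      qed
    qed
    also have "\<dots> = real N * z * z ^ card ?E + real (card ({1..N} \<inter> set (i # w))) * z ^ card ?E"
      by (simp add: sum.distrib sum.If_cases Int_def)
    also have "\<dots> \<le> real N * z * z ^ card ?E + real (Suc k) * z ^ card ?E"
    proof -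
      have "card ({1..N} \<inter> set (i # w)) \<le> card (set (i # w))" by (intro card_mono) auto
      also have "\<dots> \<le> Suc k" using card_length[of "i # w"] w by (simp add: walks_def)
      finally show ?thesis using z by (intro add_left_mono mult_right_mono) auto
    qed
    finally show ?thesis by (simp add: algebra_simps)
  qed
  \<comment> \<open>The full length \<open>k\<close> stays fixed in the base while the length
    \<open>m\<close> of the walk grows, so every step contributes the same factor.\<close>
  have "(\<Sum>w\<in>walks N m. z ^ card (set (walk_edges i w))) \<le> (real N * z + real k) ^ m" if "m \<le> k" for m
    using that
  proof (induction m)
    case (Suc m)
    have "(\<Sum>w\<in>walks N (Suc m). z ^ card (set (walk_edges i w))) \<le> (\<Sum>w\<in>walks N m. (real N * z + real (Suc m)) * z ^ card (set (walk_edges i w)))"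
      unfolding sum_walks_snoc by (rule sum_mono[OF step])
    also have "\<dots> = (real N * z + real (Suc m)) * (\<Sum>w\<in>walks N m. z ^ card (set (walk_edges i w)))"
      by (simp add: sum_distrib_left)
    also have "\<dots> \<le> (real N * z + real k) * (real N * z + real k) ^ m"
      using Suc z by (intro mult_mono) (auto intro!: sum_nonneg)
    finally show ?case by simp
  qed (simp add: walks_0)
  then show ?thesis by simp
qed

section \<open>Moments of the centred adjacency matrix\<close>

definition edge_set :: "nat \<Rightarrow> (nat \<times> nat) set" where
  "edge_set N = (SIGMA i:{1..N}. {i<..N})"

lemma finite_edge_set [simp]: "finite (edge_set N)" by (simp add: edge_set_def)

text \<open>The kernel is required to be a Borel function with values in \<open>[0,1]\<close> on all
  pairs of reals, so that \<open>pr e\<close> is a probability at every sample point without a side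
  condition; the projected extension of the graphon meets this.\<close>

locale sampled_graph = prob_space Q for Q :: "'q measure" +
  fixes W :: "real \<Rightarrow> real \<Rightarrow> real" and \<kappa> :: real and N :: nat
    and x :: "nat \<Rightarrow> 'q \<Rightarrow> real" and E :: "nat \<Rightarrow> nat \<Rightarrow> 'q \<Rightarrow> bool"
  assumes W_borel [measurable]: "case_prod W \<in> borel_measurable (borel \<Otimes>\<^sub>M borel)"
    and W_range: "0 \<le> W s t" "W s t \<le> 1" and W_sym: "W s t = W t s"
    and \<kappa>: "0 < \<kappa>" "\<kappa> \<le> 1"
    and x_meas: "i \<in> {1..N} \<Longrightarrow> x i \<in> borel_measurable Q"
    and edges: "simple_graph_edges Q W \<kappa> N x E"
begin

definition pr :: "nat \<times> nat \<Rightarrow> 'q \<Rightarrow> real" where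
  "pr e \<omega> = \<kappa> * W (x (fst e) \<omega>) (x (snd e) \<omega>)"

definition ind :: "nat \<times> nat \<Rightarrow> 'q \<Rightarrow> bool" where
  "ind e \<omega> = E (fst e) (snd e) \<omega>"

lemma pr_range: "0 \<le> pr e \<omega>" "pr e \<omega> \<le> \<kappa>" "pr e \<omega> \<le> 1"
proof -
  show "0 \<le> pr e \<omega>" "pr e \<omega> \<le> \<kappa>" using W_range \<kappa> by (auto simp: pr_def mult_left_le)
  then show "pr e \<omega> \<le> 1" using \<kappa> by linarith
qed

lemma W_comp_measurable:
  assumes "f \<in> borel_measurable M" "g \<in> borel_measurable M"
  shows "(\<lambda>\<omega>. W (f \<omega>) (g \<omega>)) \<in> borel_measurable M"
  using measurable_compose[OF measurable_Pair[OF assms] W_borel] by simp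

lemma pr_measurable: "e \<in> edge_set N \<Longrightarrow> pr e \<in> borel_measurable Q"
  unfolding pr_def using x_meas W_comp_measurable by (auto simp: edge_set_def intro!: borel_measurable_times)

lemma ind_measurable: "e \<in> edge_set N \<Longrightarrow> ind e \<in> measurable Q (count_space UNIV)"
  using edges unfolding simple_graph_edges_def ind_def edge_set_def by auto

definition X :: "'q \<Rightarrow> nat \<Rightarrow> real" where "X \<omega> = (\<lambda>i\<in>{1..N}. x i \<omega>)"

lemma X_measurable: "X \<in> measurable Q (PiM {1..N} (\<lambda>_. borel))"
  unfolding X_def by (rule measurable_restrict) (use x_meas in auto)

text \<open>\<open>simple_graph_edges\<close> gives the joint law of points and edge pattern on sets
  \<open>B\<close> only. Weighting \<open>Q\<close> by the pattern indicator and by its conditional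
  probability gives measures with the same image under \<open>X\<close>, hence equal integrals of
  every \<open>g\<close>; this avoids conditional expectations.\<close>

lemma configuration_expectation:
  fixes s :: "nat \<times> nat \<Rightarrow> bool"
  assumes g: "g \<in> borel_measurable (PiM {1..N} (\<lambda>_. borel))"
  shows "expectation (\<lambda>\<omega>. of_bool (\<forall>e\<in>edge_set N. ind e \<omega> = s e) * g (X \<omega>)) =
    expectation (\<lambda>\<omega>. (\<Prod>e\<in>edge_set N. if s e then pr e \<omega> else 1 - pr e \<omega>) * g (X \<omega>))"
proof -
  let ?M = "PiM {1..N} (\<lambda>_. borel :: real measure)"
  define I :: "'q \<Rightarrow> real" where "I \<omega> = of_bool (\<forall>e\<in>edge_set N. ind e \<omega> = s e)" for \<omega>
  define D where "D \<omega> = (\<Prod>e\<in>edge_set N. if s e then pr e \<omega> else 1 - pr e \<omega>)" for \<omega>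
  note [measurable] = X_measurable
  have S: "{\<omega> \<in> space Q. \<forall>e\<in>edge_set N. ind e \<omega> = s e} \<in> sets Q"
  proof (rule sets.sets_Collect_finite_All[OF _ finite_edge_set])
    fix e assume "e \<in> edge_set N"
    then have "ind e -` {s e} \<inter> space Q \<in> sets Q" using measurable_sets[OF ind_measurable] by auto
    moreover have "ind e -` {s e} \<inter> space Q = {\<omega> \<in> space Q. ind e \<omega> = s e}" by auto
    ultimately show "{\<omega> \<in> space Q. ind e \<omega> = s e} \<in> sets Q" by simp
  qed
  have Im [measurable]: "I \<in> borel_measurable Q"
  proof -
    have "indicator {\<omega> \<in> space Q. \<forall>e\<in>edge_set N. ind e \<omega> = s e} \<in> borel_measurable Q" using S by simp
    then show ?thesis by (rule measurable_cong[THEN iffD1, rotated]) (auto simp: I_def indicator_def)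
  qed
  have Dm [measurable]: "D \<in> borel_measurable Q"
    unfolding D_def using pr_measurable by (intro borel_measurable_prod) auto
  have I0: "0 \<le> I \<omega>" "I \<omega> \<le> 1" and D0: "0 \<le> D \<omega>" "D \<omega> \<le> 1" for \<omega>
    using pr_range by (auto simp: I_def D_def intro!: prod_nonneg prod_le_1)
  have eq: "expectation (\<lambda>\<omega>. I \<omega> * indicator B (X \<omega>)) = expectation (\<lambda>\<omega>. D \<omega> * indicator B (X \<omega>))"
    if B: "B \<in> sets ?M" for B
  proof -
    have SB: "{\<omega> \<in> space Q. X \<omega> \<in> B \<and> (\<forall>i\<in>{1..N}. \<forall>j\<in>{i<..N}. E i j \<omega> = s (i, j))} \<in> sets Q"
    proof -
      have "{\<omega> \<in> space Q. X \<omega> \<in> B \<and> (\<forall>i\<in>{1..N}. \<forall>j\<in>{i<..N}. E i j \<omega> = s (i, j))} =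
          (X -` B \<inter> space Q) \<inter> {\<omega> \<in> space Q. \<forall>e\<in>edge_set N. ind e \<omega> = s e}"
        by (auto simp: edge_set_def ind_def)
      then show ?thesis using S measurable_sets[OF X_measurable B] by auto
    qed
    have "expectation (\<lambda>\<omega>. I \<omega> * indicator B (X \<omega>)) =
        expectation (indicator {\<omega> \<in> space Q. X \<omega> \<in> B \<and> (\<forall>i\<in>{1..N}. \<forall>j\<in>{i<..N}. E i j \<omega> = s (i, j))})"
      by (intro Bochner_Integration.integral_cong) (auto simp: I_def indicator_def edge_set_def ind_def)
    also have "\<dots> = prob {\<omega> \<in> space Q. X \<omega> \<in> B \<and> (\<forall>i\<in>{1..N}. \<forall>j\<in>{i<..N}. E i j \<omega> = s (i, j))}"
      using SB by simp
    also have "\<dots> = expectation (\<lambda>\<omega>. indicator B (X \<omega>) * (\<Prod>i=1..N. \<Prod>j\<in>{i<..N}. if s (i, j) then \<kappa> * W (x i \<omega>) (x j \<omega>) else 1 - \<kappa> * W (x i \<omega>) (x j \<omega>)))"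
      using edges[unfolded simple_graph_edges_def, THEN conjunct2, rule_format, OF B, of "\<lambda>i j. s (i, j)"] by (simp only: X_def)
    also have "\<dots> = expectation (\<lambda>\<omega>. D \<omega> * indicator B (X \<omega>))"
      unfolding D_def edge_set_def pr_def by (subst prod.Sigma) (auto simp: mult.commute case_prod_unfold)
    finally show ?thesis .
  qed
  have em: "emeasure (distr (density Q (\<lambda>\<omega>. ennreal (f \<omega>))) ?M X) B = ennreal (expectation (\<lambda>\<omega>. f \<omega> * indicator B (X \<omega>)))"
    if f: "f \<in> borel_measurable Q" "\<And>\<omega>. 0 \<le> f \<omega>" "\<And>\<omega>. f \<omega> \<le> 1" and B: "B \<in> sets ?M" for f B
  proof -
    note [measurable] = f(1) B
    have "emeasure (distr (density Q (\<lambda>\<omega>. ennreal (f \<omega>))) ?M X) B = (\<integral>\<^sup>+\<omega>. ennreal (f \<omega>) * indicator (X -` B \<inter> space Q) \<omega> \<partial>Q)"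
      using measurable_sets[OF X_measurable B] X_measurable B
      by (subst emeasure_distr) (simp_all add: emeasure_density)
    also have "\<dots> = (\<integral>\<^sup>+\<omega>. ennreal (f \<omega> * indicator B (X \<omega>)) \<partial>Q)"
      by (intro nn_integral_cong) (auto simp: indicator_def)
    also have "\<dots> = ennreal (expectation (\<lambda>\<omega>. f \<omega> * indicator B (X \<omega>)))"
    proof (rule nn_integral_eq_integral)
      show "integrable Q (\<lambda>\<omega>. f \<omega> * indicator B (X \<omega>))"
        using f(2,3) by (intro integrable_const_bound[of _ 1]) (auto simp: indicator_def)
    qed (use f(2) in auto)
    finally show ?thesis .
  qed
  have "distr (density Q (\<lambda>\<omega>. ennreal (I \<omega>))) ?M X = distr (density Q (\<lambda>\<omega>. ennreal (D \<omega>))) ?M X"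
  proof (rule measure_eqI)
    fix B assume "B \<in> sets (distr (density Q (\<lambda>\<omega>. ennreal (I \<omega>))) ?M X)"
    then have B: "B \<in> sets ?M" by simp
    show "emeasure (distr (density Q (\<lambda>\<omega>. ennreal (I \<omega>))) ?M X) B = emeasure (distr (density Q (\<lambda>\<omega>. ennreal (D \<omega>))) ?M X) B"
      unfolding em[OF Im I0 B] em[OF Dm D0 B] eq[OF B] ..
  qed simp
  then have "integral\<^sup>L (distr (density Q (\<lambda>\<omega>. ennreal (I \<omega>))) ?M X) g = integral\<^sup>L (distr (density Q (\<lambda>\<omega>. ennreal (D \<omega>))) ?M X) g" by simp
  moreover have "integral\<^sup>L (distr (density Q (\<lambda>\<omega>. ennreal (f \<omega>))) ?M X) g = expectation (\<lambda>\<omega>. f \<omega> * g (X \<omega>))"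
    if "f \<in> borel_measurable Q" "\<And>\<omega>. 0 \<le> f \<omega>" for f
  proof -
    have "integral\<^sup>L (distr (density Q (\<lambda>\<omega>. ennreal (f \<omega>))) ?M X) g = (\<integral>\<omega>. g (X \<omega>) \<partial>density Q (\<lambda>\<omega>. ennreal (f \<omega>)))"
      by (rule integral_distr) (use g X_measurable in simp_all)
    also have "\<dots> = expectation (\<lambda>\<omega>. f \<omega> *\<^sub>R g (X \<omega>))"
      using that measurable_compose[OF X_measurable g] by (intro integral_density) auto
    finally show ?thesis by simp
  qed
  ultimately have "expectation (\<lambda>\<omega>. I \<omega> * g (X \<omega>)) = expectation (\<lambda>\<omega>. D \<omega> * g (X \<omega>))"
    using I0 D0 by simp
  then show ?thesis by (simp add: I_def D_def)
qed

text \<open>The value 0 outside \<open>edge_set N\<close> covers the loops, so that the matrix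
  \<open>M\<close> below has zero diagonal.\<close>

definition dev :: "nat \<times> nat \<Rightarrow> 'q \<Rightarrow> real" where
  "dev e \<omega> = (if e \<in> edge_set N then of_bool (ind e \<omega>) - pr e \<omega> else 0)"

lemma dev_measurable [measurable]: "dev e \<in> borel_measurable Q"
proof (cases "e \<in> edge_set N")
  case True
  have "(\<lambda>\<omega>. of_bool (ind e \<omega>) - pr e \<omega>) \<in> borel_measurable Q"
    using pr_measurable[OF True] measurable_compose[OF ind_measurable[OF True], of "of_bool :: bool \<Rightarrow> real" borel]
    by (intro borel_measurable_diff) auto
  then show ?thesis using True by (simp add: dev_def[abs_def])
qed (simp add: dev_def[abs_def])

lemma dev_bound: "\<bar>dev e \<omega>\<bar> \<le> 1"
  using pr_range[of e \<omega>] by (auto simp: dev_def of_bool_def)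

lemma moment_formula:
  "expectation (\<lambda>\<omega>. \<Prod>e\<in>edge_set N. (of_bool (ind e \<omega>) - pr e \<omega>) ^ c e) =
   expectation (\<lambda>\<omega>. \<Prod>e\<in>edge_set N. pr e \<omega> * (1 - pr e \<omega>) ^ c e + (1 - pr e \<omega>) * (- pr e \<omega>) ^ c e)"
proof -
  define S where "S = (edge_set N \<rightarrow>\<^sub>E (UNIV :: bool set))"
  have fS: "finite S" unfolding S_def by (intro finite_PiE) auto
  define g where "g s y = (\<Prod>e\<in>edge_set N. (of_bool (s e) - \<kappa> * W (y (fst e)) (y (snd e))) ^ c e)"
    for s :: "nat \<times> nat \<Rightarrow> bool" and y :: "nat \<Rightarrow> real"
  have gm: "g s \<in> borel_measurable (PiM {1..N} (\<lambda>_. borel))" for s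
    unfolding g_def
  proof (intro borel_measurable_prod borel_measurable_power borel_measurable_diff borel_measurable_times borel_measurable_const W_comp_measurable)
    fix e assume "e \<in> edge_set N"
    then have e: "fst e \<in> {1..N}" "snd e \<in> {1..N}" by (auto simp: edge_set_def)
    show "(\<lambda>y. y (fst e)) \<in> borel_measurable (PiM {1..N} (\<lambda>_. borel))" "(\<lambda>y. y (snd e)) \<in> borel_measurable (PiM {1..N} (\<lambda>_. borel))"
      using e by (auto intro!: measurable_component_singleton)
  qed
  have gX: "g s (X \<omega>) = (\<Prod>e\<in>edge_set N. (of_bool (s e) - pr e \<omega>) ^ c e)" for s \<omega>
    unfolding g_def pr_def X_def by (intro prod.cong) (auto simp: edge_set_def)
  have gb: "\<bar>g s (X \<omega>)\<bar> \<le> 1" for s \<omega>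
  proof -
    have "\<bar>of_bool (s e) - pr e \<omega>\<bar> \<le> 1" for e using pr_range[of e \<omega>] by (auto simp: of_bool_def)
    then show ?thesis unfolding gX abs_prod power_abs
      by (intro prod_le_1 conjI zero_le_power power_le_one abs_ge_zero)
  qed
  have split: "(\<Prod>e\<in>edge_set N. (of_bool (ind e \<omega>) - pr e \<omega>) ^ c e) = (\<Sum>s\<in>S. of_bool (\<forall>e\<in>edge_set N. ind e \<omega> = s e) * g s (X \<omega>))" for \<omega>
  proof -
    let ?s = "restrict (\<lambda>e. ind e \<omega>) (edge_set N)"
    have s: "?s \<in> S" by (auto simp: S_def)
    have "(\<Sum>s\<in>S. of_bool (\<forall>e\<in>edge_set N. ind e \<omega> = s e) * g s (X \<omega>)) = (\<Sum>s\<in>S. if s = ?s then g ?s (X \<omega>) else 0)"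
    proof (rule sum.cong[OF refl])
      fix s assume "s \<in> S"
      then have "(\<forall>e\<in>edge_set N. ind e \<omega> = s e) \<longleftrightarrow> s = ?s"
        by (auto simp: S_def PiE_def extensional_def fun_eq_iff restrict_def)
      then show "of_bool (\<forall>e\<in>edge_set N. ind e \<omega> = s e) * g s (X \<omega>) = (if s = ?s then g ?s (X \<omega>) else 0)" by auto
    qed
    also have "\<dots> = g ?s (X \<omega>)" using s fS by simp
    also have "\<dots> = (\<Prod>e\<in>edge_set N. (of_bool (ind e \<omega>) - pr e \<omega>) ^ c e)" unfolding gX by (intro prod.cong) auto
    finally show ?thesis by simp
  qed
  have m2: "(\<lambda>\<omega>. g s (X \<omega>)) \<in> borel_measurable Q" for s using measurable_compose[OF X_measurable gm] .
  have mI: "(\<lambda>\<omega>. of_bool (\<forall>e\<in>edge_set N. ind e \<omega> = s e) :: real) \<in> borel_measurable Q" for s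
  proof -
    have "(\<lambda>\<omega>. \<Prod>e\<in>edge_set N. of_bool (ind e \<omega> = s e) :: real) \<in> borel_measurable Q"
    proof (rule borel_measurable_prod)
      fix e assume "e \<in> edge_set N"
      from measurable_compose[OF ind_measurable[OF this], of "\<lambda>b. of_bool (b = s e) :: real" borel]
      show "(\<lambda>\<omega>. of_bool (ind e \<omega> = s e) :: real) \<in> borel_measurable Q" by simp
    qed
    moreover have "(\<Prod>e\<in>edge_set N. of_bool (ind e \<omega> = s e) :: real) = of_bool (\<forall>e\<in>edge_set N. ind e \<omega> = s e)" for \<omega>
      by (cases "\<forall>e\<in>edge_set N. ind e \<omega> = s e") (auto simp: prod_zero_iff)
    ultimately show ?thesis by simp
  qed
  have int1: "integrable Q (\<lambda>\<omega>. of_bool (\<forall>e\<in>edge_set N. ind e \<omega> = s e) * g s (X \<omega>))" for s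
    using gb m2 mI by (intro integrable_const_bound[of _ 1] borel_measurable_times) (auto simp: of_bool_def)
  have int2: "integrable Q (\<lambda>\<omega>. (\<Prod>e\<in>edge_set N. if s e then pr e \<omega> else 1 - pr e \<omega>) * g s (X \<omega>))" for s
  proof (rule integrable_const_bound[of _ 1])
    show "AE \<omega> in Q. norm ((\<Prod>e\<in>edge_set N. if s e then pr e \<omega> else 1 - pr e \<omega>) * g s (X \<omega>)) \<le> 1"
    proof (rule AE_I2)
      fix \<omega>
      have "\<bar>\<Prod>e\<in>edge_set N. if s e then pr e \<omega> else 1 - pr e \<omega>\<bar> \<le> 1"
        unfolding abs_prod using pr_range by (intro prod_le_1) auto
      then show "norm ((\<Prod>e\<in>edge_set N. if s e then pr e \<omega> else 1 - pr e \<omega>) * g s (X \<omega>)) \<le> 1"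
        using gb[of s \<omega>] mult_mono[of "\<bar>\<Prod>e\<in>edge_set N. if s e then pr e \<omega> else 1 - pr e \<omega>\<bar>" 1 "\<bar>g s (X \<omega>)\<bar>" 1]
        by (simp add: abs_mult)
    qed
    show "(\<lambda>\<omega>. (\<Prod>e\<in>edge_set N. if s e then pr e \<omega> else 1 - pr e \<omega>) * g s (X \<omega>)) \<in> borel_measurable Q"
      using pr_measurable m2 by (intro borel_measurable_times borel_measurable_prod) auto
  qed
  have "expectation (\<lambda>\<omega>. \<Prod>e\<in>edge_set N. (of_bool (ind e \<omega>) - pr e \<omega>) ^ c e) =
      (\<Sum>s\<in>S. expectation (\<lambda>\<omega>. of_bool (\<forall>e\<in>edge_set N. ind e \<omega> = s e) * g s (X \<omega>)))"
    unfolding split using int1 by (rule Bochner_Integration.integral_sum)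
  also have "\<dots> = (\<Sum>s\<in>S. expectation (\<lambda>\<omega>. (\<Prod>e\<in>edge_set N. if s e then pr e \<omega> else 1 - pr e \<omega>) * g s (X \<omega>)))"
    unfolding configuration_expectation[OF gm] ..
  also have "\<dots> = expectation (\<lambda>\<omega>. \<Sum>s\<in>S. (\<Prod>e\<in>edge_set N. if s e then pr e \<omega> else 1 - pr e \<omega>) * g s (X \<omega>))"
    using int2 by (rule Bochner_Integration.integral_sum[symmetric])
  also have "\<dots> = expectation (\<lambda>\<omega>. \<Prod>e\<in>edge_set N. pr e \<omega> * (1 - pr e \<omega>) ^ c e + (1 - pr e \<omega>) * (- pr e \<omega>) ^ c e)"
  proof (rule Bochner_Integration.integral_cong[OF refl])
    fix \<omega>
    have "(\<Sum>s\<in>S. (\<Prod>e\<in>edge_set N. if s e then pr e \<omega> else 1 - pr e \<omega>) * g s (X \<omega>)) =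
        (\<Sum>s\<in>S. \<Prod>e\<in>edge_set N. (if s e then pr e \<omega> else 1 - pr e \<omega>) * (of_bool (s e) - pr e \<omega>) ^ c e)"
      unfolding gX by (simp add: prod.distrib)
    also have "\<dots> = (\<Prod>e\<in>edge_set N. \<Sum>b\<in>UNIV. (if b then pr e \<omega> else 1 - pr e \<omega>) * (of_bool b - pr e \<omega>) ^ c e)"
      unfolding S_def by (rule prod_sum_PiE[symmetric]) auto
    also have "\<dots> = (\<Prod>e\<in>edge_set N. pr e \<omega> * (1 - pr e \<omega>) ^ c e + (1 - pr e \<omega>) * (- pr e \<omega>) ^ c e)"
      by (simp add: UNIV_bool add.commute)
    finally show "(\<Sum>s\<in>S. (\<Prod>e\<in>edge_set N. if s e then pr e \<omega> else 1 - pr e \<omega>) * g s (X \<omega>)) =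
      (\<Prod>e\<in>edge_set N. pr e \<omega> * (1 - pr e \<omega>) ^ c e + (1 - pr e \<omega>) * (- pr e \<omega>) ^ c e)" .
  qed
  finally show ?thesis .
qed

text \<open>An edge used exactly once has conditional mean 0 and kills the moment. Otherwise there
  are at most \<open>k\<close> distinct edges, each contributing at most \<kappa>. The slack
  \<open>y ^ (k - card (set es)) \<ge> 1\<close> encodes the constraint on the number of edges as a
  weight, so that the sum over all walks can be taken freely.\<close>

lemma walk_moment:
  fixes es :: "(nat \<times> nat) list"
  assumes len: "length es = 2 * k" and y: "y \<ge> 1"
  shows "expectation (\<lambda>\<omega>. prod_list (map (\<lambda>e. dev e \<omega>) es)) \<le> y ^ k * (\<kappa> / y) ^ card (set es)"
proof (cases "set es \<subseteq> edge_set N")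
  case False
  then obtain e where e: "e \<in> set es" "e \<notin> edge_set N" by blast
  then have "prod_list (map (\<lambda>e. dev e \<omega>) es) = 0" for \<omega>
    by (force simp: prod_list_zero_iff dev_def)
  then show ?thesis using y \<kappa> by simp
next
  case True
  define c where "c e = count_list es e" for e
  have pl: "prod_list (map (\<lambda>e. dev e \<omega>) es) = (\<Prod>e\<in>edge_set N. (of_bool (ind e \<omega>) - pr e \<omega>) ^ c e)" for \<omega>
  proof -
    have "prod_list (map f es) = (\<Prod>e\<in>edge_set N. f e ^ count_list es e)" if "set es \<subseteq> edge_set N" for f :: "nat \<times> nat \<Rightarrow> real" and es
      using that
    proof (induction es)
      case (Cons a es)
      have "(\<Prod>e\<in>edge_set N. f e ^ count_list (a # es) e) = (\<Prod>e\<in>edge_set N. (if e = a then f a else 1) * f e ^ count_list es e)"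
        by (intro prod.cong) auto
      also have "\<dots> = f a * (\<Prod>e\<in>edge_set N. f e ^ count_list es e)"
        using Cons.prems by (simp add: prod.distrib)
      finally show ?case using Cons by simp
    qed simp
    from this[OF True, of "\<lambda>e. dev e \<omega>"] show ?thesis by (simp add: dev_def c_def)
  qed
  define q where "q e \<omega> = pr e \<omega> * (1 - pr e \<omega>) ^ c e + (1 - pr e \<omega>) * (- pr e \<omega>) ^ c e" for e \<omega>
  have E: "expectation (\<lambda>\<omega>. prod_list (map (\<lambda>e. dev e \<omega>) es)) = expectation (\<lambda>\<omega>. \<Prod>e\<in>edge_set N. q e \<omega>)"
    unfolding pl q_def by (rule moment_formula)
  show ?thesis
  proof (cases "\<exists>e\<in>edge_set N. c e = 1")
    case True
    then obtain e where "e \<in> edge_set N" "c e = 1" by blast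
    \<comment> \<open>The first central moment of a Bernoulli variable is 0.\<close>
    then have "(\<Prod>e\<in>edge_set N. q e \<omega>) = 0" for \<omega>
      by (intro prod_zero) (auto simp: q_def intro!: bexI[of _ e] simp: algebra_simps)
    then have "expectation (\<lambda>\<omega>. \<Prod>e\<in>edge_set N. q e \<omega>) = 0" by (simp only:) simp
    then show ?thesis unfolding E using y \<kappa> by simp
  next
    case False
    have c2: "2 \<le> c e" if "e \<in> set es" for e
    proof -
      have "c e \<noteq> 0" using that by (simp add: c_def count_list_0_iff)
      moreover have "c e \<noteq> 1" using False True that by blast
      ultimately show ?thesis by linarith
    qed
    have "(\<Sum>e\<in>set es. c e) = 2 * k" using len by (simp add: c_def sum_count_set)
    moreover have "(\<Sum>e\<in>set es. c e) \<ge> (\<Sum>e\<in>set es. 2)" by (rule sum_mono[OF c2])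
    ultimately have card: "card (set es) \<le> k" by simp
    have qb: "\<bar>q e \<omega>\<bar> \<le> (if e \<in> set es then \<kappa> else 1)" for e \<omega>
    proof (cases "e \<in> set es")
      case True
      let ?p = "pr e \<omega>"
      have p: "0 \<le> ?p" "?p \<le> 1" "?p \<le> \<kappa>" using pr_range by auto
      have "\<bar>q e \<omega>\<bar> \<le> ?p * (1 - ?p) ^ c e + (1 - ?p) * ?p ^ c e"
        unfolding q_def using p abs_triangle_ineq[of "?p * (1 - ?p) ^ c e" "(1 - ?p) * (- ?p) ^ c e"]
        by (simp add: abs_mult power_abs)
      \<comment> \<open>Powers of numbers in \<open>[0,1]\<close> decrease, so the worst
        multiplicity is 2, giving the Bernoulli variance.\<close>
      also have "\<dots> \<le> ?p * (1 - ?p)\<^sup>2 + (1 - ?p) * ?p\<^sup>2"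
        using p c2[OF True] by (intro add_mono mult_left_mono power_decreasing) auto
      also have "\<dots> = ?p * (1 - ?p)" by (simp add: power2_eq_square algebra_simps)
      also have "\<dots> \<le> ?p" using p by (simp add: mult_left_le)
      also have "?p \<le> \<kappa>" by fact
      finally show ?thesis using True by simp
    next
      case False
      then show ?thesis by (simp add: q_def c_def count_list_0_iff)
    qed
    have "\<bar>\<Prod>e\<in>edge_set N. q e \<omega>\<bar> \<le> \<kappa> ^ card (set es)" for \<omega>
    proof -
      have "\<bar>\<Prod>e\<in>edge_set N. q e \<omega>\<bar> \<le> (\<Prod>e\<in>edge_set N. if e \<in> set es then \<kappa> else 1)"
        unfolding abs_prod using qb by (intro prod_mono) auto
      also have "\<dots> = (\<Prod>e\<in>edge_set N \<inter> set es. \<kappa>)"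
        by (rule prod.inter_restrict[symmetric]) simp
      also have "edge_set N \<inter> set es = set es" using True by blast
      finally show ?thesis by simp
    qed
    then have "expectation (\<lambda>\<omega>. \<Prod>e\<in>edge_set N. q e \<omega>) \<le> \<kappa> ^ card (set es)"
      unfolding q_def using pr_measurable
      by (intro integral_le_const integrable_const_bound[of _ "\<kappa> ^ card (set es)"] borel_measurable_prod
          borel_measurable_add borel_measurable_times borel_measurable_power) (auto simp: abs_le_iff)
    also have "\<dots> \<le> y ^ k * (\<kappa> / y) ^ card (set es)"
    proof -
      have "y ^ card (set es) \<le> y ^ k" using y card by (intro power_increasing) auto
      then have "\<kappa> ^ card (set es) * y ^ card (set es) \<le> \<kappa> ^ card (set es) * y ^ k" using \<kappa> by (intro mult_left_mono) auto
      then show ?thesis using y by (simp add: power_divide field_simps)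
    qed
    finally show ?thesis unfolding E .
  qed
qed

definition M :: "'q \<Rightarrow> nat \<Rightarrow> nat \<Rightarrow> real" where
  "M \<omega> i j = dev (edge i j) \<omega>"

lemma M_sym: "M \<omega> i j = M \<omega> j i"
  by (simp add: M_def edge_def min.commute max.commute)

lemma trace_measurable: "(\<lambda>\<omega>. mat_pow N (M \<omega>) k i j) \<in> borel_measurable Q"
proof (induction k arbitrary: i)
  case (Suc k)
  then show ?case unfolding mat_pow.simps M_def by measurable
qed simp

lemma trace_expectation:
  assumes k: "k \<ge> 1" and Nk: "2 * real k \<le> real N * \<kappa>"
  shows "integrable Q (\<lambda>\<omega>. \<Sum>i=1..N. mat_pow N (M \<omega>) (2 * k) i i)"
    and "expectation (\<lambda>\<omega>. \<Sum>i=1..N. mat_pow N (M \<omega>) (2 * k) i i) \<le> real N * (8 * real k * real N * \<kappa>) ^ k"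
proof -
  \<comment> \<open>This choice makes \<open>N * (\<kappa> / y)\<close> equal to the walk length
    \<open>2 * k\<close>, balancing new against repeated edges in the generating function; the
    condition \<open>y \<ge> 1\<close> is the hypothesis \<open>Nk\<close>.\<close>
  define y where "y = real N * \<kappa> / (2 * real k)"
  have y: "y \<ge> 1" using Nk k by (simp add: y_def field_simps)
  have e: "mat_pow N (M \<omega>) (2 * k) i i = (\<Sum>w\<in>walks N (2 * k). prod_list (map (\<lambda>e. dev e \<omega>) (walk_edges i w)) * of_bool (last (i # w) = i))" for \<omega> i
    unfolding M_def by (rule mat_pow_walks)
  have mpl: "(\<lambda>\<omega>. prod_list (map (\<lambda>e. dev e \<omega>) es)) \<in> borel_measurable Q" for es
    by (induction es) auto
  have bpl: "\<bar>prod_list (map (\<lambda>e. dev e \<omega>) es)\<bar> \<le> 1" for es \<omega>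
  proof (induction es)
    case (Cons a es)
    then show ?case using dev_bound[of a \<omega>] mult_mono[of "\<bar>dev a \<omega>\<bar>" 1 "\<bar>prod_list (map (\<lambda>e. dev e \<omega>) es)\<bar>" 1]
      by (simp add: abs_mult)
  qed simp
  have ipl: "integrable Q (\<lambda>\<omega>. prod_list (map (\<lambda>e. dev e \<omega>) es) * of_bool b)" for es b
    using mpl bpl by (intro integrable_mult_left integrable_const_bound[of _ 1]) auto
  show int: "integrable Q (\<lambda>\<omega>. \<Sum>i=1..N. mat_pow N (M \<omega>) (2 * k) i i)"
    unfolding e using ipl by (intro Bochner_Integration.integrable_sum)
  have "expectation (\<lambda>\<omega>. \<Sum>i=1..N. mat_pow N (M \<omega>) (2 * k) i i) =
      (\<Sum>i=1..N. \<Sum>w\<in>walks N (2 * k). expectation (\<lambda>\<omega>. prod_list (map (\<lambda>e. dev e \<omega>) (walk_edges i w)) * of_bool (last (i # w) = i)))"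
    unfolding e using ipl by (simp only: Bochner_Integration.integral_sum Bochner_Integration.integrable_sum)
  also have "\<dots> \<le> (\<Sum>i=1..N. \<Sum>w\<in>walks N (2 * k). y ^ k * (\<kappa> / y) ^ card (set (walk_edges i w)))"
  proof (intro sum_mono)
    fix i w assume w: "w \<in> walks N (2 * k)"
    have "length (walk_edges i w) = 2 * k" using w by (simp add: walks_def)
    note wm = walk_moment[OF this y]
    have nn: "0 \<le> y ^ k * (\<kappa> / y) ^ card (set (walk_edges i w))" using y \<kappa> by simp
    show "expectation (\<lambda>\<omega>. prod_list (map (\<lambda>e. dev e \<omega>) (walk_edges i w)) * of_bool (last (i # w) = i)) \<le> y ^ k * (\<kappa> / y) ^ card (set (walk_edges i w))"
      by (cases "last (i # w) = i") (use wm nn in \<open>auto simp del: last.simps\<close>)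
  qed
  also have "\<dots> = (\<Sum>i=1..N. y ^ k * (\<Sum>w\<in>walks N (2 * k). (\<kappa> / y) ^ card (set (walk_edges i w))))"
    by (simp add: sum_distrib_left)
  also have "\<dots> \<le> (\<Sum>i=1..N. y ^ k * (real N * (\<kappa> / y) + real (2 * k)) ^ (2 * k))"
    using y \<kappa> by (intro sum_mono mult_left_mono walk_generating_function) auto
  also have "real N * (\<kappa> / y) = 2 * real k"
    using y k \<kappa> by (cases "N = 0") (auto simp: y_def field_simps)
  also have "(\<Sum>i=1..N. y ^ k * (2 * real k + real (2 * k)) ^ (2 * k)) = real N * (y * (4 * real k)\<^sup>2) ^ k"
    by (simp add: power_mult_distrib power_mult)
  also have "y * (4 * real k)\<^sup>2 = 8 * real k * real N * \<kappa>"
    using k by (simp add: y_def power2_eq_square)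
  finally show "expectation (\<lambda>\<omega>. \<Sum>i=1..N. mat_pow N (M \<omega>) (2 * k) i i) \<le> real N * (8 * real k * real N * \<kappa>) ^ k" .
qed

text \<open>Markov's inequality at level \<open>N ^ 3 * c ^ k\<close> against an expectation
  \<open>N * c ^ k\<close> leaves \<open>1 / N\<close> squared. Since \<open>k \<ge> ln N\<close>,
  the factor \<open>N ^ 3\<close> is at most the \<open>k\<close>-th power of \<open>exp 3\<close>;
  since \<open>k \<le> 2 * ln N\<close>, the constant 8 becomes 16.\<close>

lemma M_spectral_concentration:
  assumes N: "N \<ge> 3" and Nk: "2 * real (nat \<lceil>ln (real N)\<rceil>) \<le> real N * \<kappa>"
  shows "\<exists>B\<in>sets Q. measure Q B \<le> 1 / (real N)\<^sup>2 \<and> (\<forall>\<omega>\<in>space Q - B. \<forall>u.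
     (\<Sum>i=1..N. (\<Sum>j=1..N. M \<omega> i j * u j)\<^sup>2) \<le> 16 * exp 3 * ln (real N) * real N * \<kappa> * (\<Sum>j=1..N. (u j)\<^sup>2))"
proof -
  define k where "k = nat \<lceil>ln (real N)\<rceil>"
  have "exp 1 \<le> real N" using N exp_le by linarith
  then have ln1: "1 \<le> ln (real N)" using N by (simp add: ln_ge_iff)
  then have k: "k \<ge> 1" "ln (real N) \<le> real k" "real k \<le> 2 * ln (real N)" unfolding k_def by linarith+
  define t where "t \<omega> = (\<Sum>i=1..N. mat_pow N (M \<omega>) (2 * k) i i)" for \<omega>
  define c where "c = 8 * real k * real N * \<kappa>"
  have c0: "c > 0" using k \<kappa> N by (simp add: c_def)
  have t0: "0 \<le> t \<omega>" for \<omega> unfolding t_def trace_even_power[OF M_sym] by (intro sum_nonneg) auto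
  note te = trace_expectation[OF k(1) Nk[folded k_def], folded t_def c_def]
  define B where "B = {\<omega> \<in> space Q. t \<omega> \<ge> real N ^ 3 * c ^ k}"
  have tm: "t \<in> borel_measurable Q" unfolding t_def by (intro borel_measurable_sum trace_measurable)
  have B: "B \<in> sets Q" unfolding B_def using tm by measurable
  have "prob B \<le> expectation t / (real N ^ 3 * c ^ k)"
    unfolding B_def using te(1) t0 c0 N by (intro integral_Markov_inequality_measure[where A = "{}"]) auto
  also have "\<dots> \<le> (real N * c ^ k) / (real N ^ 3 * c ^ k)" using te(2) c0 by (intro divide_right_mono) auto
  also have "\<dots> = 1 / (real N)\<^sup>2" using c0 N by (simp add: field_simps power2_eq_square power3_eq_cube)
  finally have pB: "prob B \<le> 1 / (real N)\<^sup>2" .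
  have "(\<Sum>i=1..N. (\<Sum>j=1..N. M \<omega> i j * u j)\<^sup>2) \<le> 16 * exp 3 * ln (real N) * real N * \<kappa> * (\<Sum>j=1..N. (u j)\<^sup>2)"
    if w: "\<omega> \<in> space Q - B" for \<omega> u
  proof -
    have "real N = exp (ln (real N))" using N by simp
    also have "\<dots> \<le> exp (real k)" using k by simp
    finally have "real N ^ 3 \<le> exp (real k) ^ 3" by (intro power_mono) auto
    also have "\<dots> = exp 3 ^ k" by (simp flip: exp_of_nat_mult add: mult.commute)
    finally have "real N ^ 3 * c ^ k \<le> (exp 3 * c) ^ k" using c0 by (simp add: power_mult_distrib mult_right_mono)
    moreover have "t \<omega> \<le> real N ^ 3 * c ^ k" using w by (auto simp: B_def)
    ultimately have "t \<omega> \<le> (exp 3 * c) ^ k" by linarith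
    then have "(\<Sum>i=1..N. (\<Sum>j=1..N. M \<omega> i j * u j)\<^sup>2) \<le> exp 3 * c * (\<Sum>j=1..N. (u j)\<^sup>2)"
      using c0 by (intro spectral_bound_from_trace[OF M_sym k(1)]) (auto simp: t_def)
    also have "\<dots> \<le> 16 * exp 3 * ln (real N) * real N * \<kappa> * (\<Sum>j=1..N. (u j)\<^sup>2)"
    proof (rule mult_right_mono)
      have "exp 3 * c = (8 * exp 3 * real N * \<kappa>) * real k" by (simp add: c_def)
      also have "\<dots> \<le> (8 * exp 3 * real N * \<kappa>) * (2 * ln (real N))" using k \<kappa> by (intro mult_left_mono) auto
      finally show "exp 3 * c \<le> 16 * exp 3 * ln (real N) * real N * \<kappa>" by (simp add: mult_ac)
    qed (simp add: sum_nonneg)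
    finally show ?thesis .
  qed
  then show ?thesis using B pB by blast
qed

text \<open>The matrix is \<open>M\<close> scaled by \<open>1 / (\<kappa> * N)\<close> minus the
  diagonal weights, because the simple graph has no loops while the weighted graph keeps its
  diagonal. The squared diagonal part is of order \<open>1 / N\<close> squared, below the noise
  level; splitting the square doubles both constants.\<close>

lemma simple_graph_concentration:
  assumes N: "N \<ge> 3" and Nk: "2 * real (nat \<lceil>ln (real N)\<rceil>) \<le> real N * \<kappa>"
  shows "\<exists>B\<in>sets Q. measure Q B \<le> 1 / (real N)\<^sup>2 \<and> (\<forall>\<omega>\<in>space Q - B. \<forall>u :: nat \<Rightarrow> real.
     (\<Sum>i=1..N. (\<Sum>j=1..N. (inverse \<kappa> * simple_graph E \<omega> i j - W (x i \<omega>) (x j \<omega>)) / real N * u j)\<^sup>2)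
       \<le> (32 * exp 3 + 2) * (ln (real N) / (\<kappa> * real N)) * (\<Sum>j=1..N. (u j)\<^sup>2))"
proof -
  obtain B where B: "B \<in> sets Q" "measure Q B \<le> 1 / (real N)\<^sup>2" and
    M: "\<And>\<omega> u. \<omega> \<in> space Q - B \<Longrightarrow> (\<Sum>i=1..N. (\<Sum>j=1..N. M \<omega> i j * u j)\<^sup>2) \<le> 16 * exp 3 * ln (real N) * real N * \<kappa> * (\<Sum>j=1..N. (u j)\<^sup>2)"
    using M_spectral_concentration[OF assms] by blast
  have "exp 1 \<le> real N" using N exp_le by linarith
  then have ln1: "1 \<le> ln (real N)" using N by (simp add: ln_ge_iff)
  have entry: "(inverse \<kappa> * simple_graph E \<omega> i j - W (x i \<omega>) (x j \<omega>)) / real N =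
      M \<omega> i j / (\<kappa> * real N) - of_bool (i = j) * (W (x i \<omega>) (x i \<omega>) / real N)"
    if "i \<in> {1..N}" "j \<in> {1..N}" for \<omega> i j
  proof -
    consider "i < j" | "j < i" | "i = j" by linarith
    then show ?thesis
    proof cases
      case 1
      then show ?thesis using that \<kappa>
        by (simp add: M_def edge_def dev_def edge_set_def simple_graph_def ind_def pr_def min_def max_def field_simps)
    next
      case 2
      then show ?thesis using that \<kappa>
        by (simp add: M_def edge_def dev_def edge_set_def simple_graph_def ind_def pr_def min_def max_def field_simps W_sym[of "x i \<omega>" "x j \<omega>"])
    next
      case 3
      then show ?thesis by (simp add: M_def edge_def dev_def edge_set_def simple_graph_def)
    qed
  qed
  have "(\<Sum>i=1..N. (\<Sum>j=1..N. (inverse \<kappa> * simple_graph E \<omega> i j - W (x i \<omega>) (x j \<omega>)) / real N * u j)\<^sup>2)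
       \<le> (32 * exp 3 + 2) * (ln (real N) / (\<kappa> * real N)) * (\<Sum>j=1..N. (u j)\<^sup>2)"
    if w: "\<omega> \<in> space Q - B" for \<omega> and u :: "nat \<Rightarrow> real"
  proof -
    let ?q = "\<lambda>i. (\<Sum>j=1..N. M \<omega> i j * u j) / (\<kappa> * real N)" and ?r = "\<lambda>i. W (x i \<omega>) (x i \<omega>) / real N * u i"
    define S where "S = (\<Sum>j=1..N. (u j)\<^sup>2)"
    have S0: "0 \<le> S" by (simp add: S_def sum_nonneg)
    have row: "(\<Sum>j=1..N. (inverse \<kappa> * simple_graph E \<omega> i j - W (x i \<omega>) (x j \<omega>)) / real N * u j) = ?q i - ?r i"
      if i: "i \<in> {1..N}" for i
    proof -
      have "(\<Sum>j=1..N. (inverse \<kappa> * simple_graph E \<omega> i j - W (x i \<omega>) (x j \<omega>)) / real N * u j) =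
        (\<Sum>j=1..N. M \<omega> i j * u j / (\<kappa> * real N) - (if j = i then ?r i else 0))"
        by (intro sum.cong refl) (auto simp: entry[OF i] left_diff_distrib)
      then show ?thesis using i by (simp add: sum_subtractf sum_divide_distrib)
    qed
    have "(\<Sum>i=1..N. (\<Sum>j=1..N. (inverse \<kappa> * simple_graph E \<omega> i j - W (x i \<omega>) (x j \<omega>)) / real N * u j)\<^sup>2) = (\<Sum>i=1..N. (?q i - ?r i)\<^sup>2)"
      by (intro sum.cong refl) (simp only: row)
    also have "\<dots> \<le> (\<Sum>i=1..N. 2 * (?q i)\<^sup>2 + 2 * (u i)\<^sup>2 / (real N)\<^sup>2)"
    proof (rule sum_mono)
      fix i
      have "(?q i - ?r i)\<^sup>2 \<le> 2 * (?q i)\<^sup>2 + 2 * (?r i)\<^sup>2" using sum_power2_le[of "?q i" "- ?r i"] by simp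
      also have "(?r i)\<^sup>2 \<le> (u i)\<^sup>2 / (real N)\<^sup>2"
        using W_range[of "x i \<omega>" "x i \<omega>"]
        by (auto simp: power_divide power_mult_distrib abs_square_le_1 intro!: divide_right_mono mult_left_le_one_le)
      finally show "(?q i - ?r i)\<^sup>2 \<le> 2 * (?q i)\<^sup>2 + 2 * (u i)\<^sup>2 / (real N)\<^sup>2" by simp
    qed
    also have "\<dots> = 2 * (\<Sum>i=1..N. (\<Sum>j=1..N. M \<omega> i j * u j)\<^sup>2) / (\<kappa> * real N)\<^sup>2 + 2 * S / (real N)\<^sup>2"
      unfolding sum.distrib power_divide S_def
      by (simp add: sum_distrib_left sum_divide_distrib[of "\<lambda>i. 2 * f i" for f])
    also have "\<dots> \<le> 2 * (16 * exp 3 * ln (real N) * real N * \<kappa> * S) / (\<kappa> * real N)\<^sup>2 + 2 * (ln (real N) / (\<kappa> * real N)) * S"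
    proof (intro add_mono divide_right_mono mult_left_mono)
      show "(\<Sum>i=1..N. (\<Sum>j=1..N. M \<omega> i j * u j)\<^sup>2) \<le> 16 * exp 3 * ln (real N) * real N * \<kappa> * S"
        unfolding S_def by (rule M[OF w])
      have "1 / (real N)\<^sup>2 \<le> 1 / real N" using N by (simp add: field_simps power2_eq_square)
      also have "\<dots> \<le> ln (real N) / (\<kappa> * real N)"
        using ln1 \<kappa> N by (intro frac_le) (auto simp: mult_le_cancel_right1)
      finally have "2 * (1 / (real N)\<^sup>2) * S \<le> 2 * (ln (real N) / (\<kappa> * real N)) * S"
        using S0 by (intro mult_right_mono mult_left_mono) auto
      then show "2 * S / (real N)\<^sup>2 \<le> 2 * (ln (real N) / (\<kappa> * real N)) * S" by simp
    qed auto
    also have "\<dots> = (32 * exp 3 + 2) * (ln (real N) / (\<kappa> * real N)) * S"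
      using N \<kappa> by (simp add: field_simps power2_eq_square)
    finally show ?thesis unfolding S_def .
  qed
  then show ?thesis using B by blast
qed

end

section \<open>Measurability of the equilibrium events\<close>

lemma map_measurable_count_space:
  fixes f :: "'k \<Rightarrow> 'q \<Rightarrow> 'c::countable"
  assumes "\<And>k. k \<in> set ks \<Longrightarrow> f k \<in> measurable Q (count_space UNIV)"
  shows "(\<lambda>\<omega>. map (\<lambda>k. f k \<omega>) ks) \<in> measurable Q (count_space UNIV)"
  using assms
proof (induction ks)
  case (Cons k ks)
  have "(\<lambda>\<omega>. map (\<lambda>k. f k \<omega>) (k # ks)) -` {l} \<inter> space Q \<in> sets Q" for l
  proof (cases l)
    case (Cons c l')
    have "(\<lambda>\<omega>. map (\<lambda>k. f k \<omega>) (k # ks)) -` {l} \<inter> space Q =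
      (f k -` {c} \<inter> space Q) \<inter> ((\<lambda>\<omega>. map (\<lambda>k. f k \<omega>) ks) -` {l'} \<inter> space Q)"
      using Cons by auto
    moreover have "f k -` {c} \<inter> space Q \<in> sets Q" using Cons.prems by (intro measurable_sets) auto
    moreover have "(\<lambda>\<omega>. map (\<lambda>k. f k \<omega>) ks) -` {l'} \<inter> space Q \<in> sets Q"
      using Cons.IH Cons.prems by (intro measurable_sets) auto
    ultimately show ?thesis by auto
  next
    case Nil
    then have "(\<lambda>\<omega>. map (\<lambda>k. f k \<omega>) (k # ks)) -` {l} \<inter> space Q = {}" by auto
    then show ?thesis by (simp only: sets.empty_sets)
  qed
  then show ?case by (simp add: measurable_count_space_eq2_countable)
qed simp

text \<open>Every subset of a count space is measurable, so a union of fibres of \<open>g\<close> is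
  a measurable preimage. This suits sets defined through equilibria, of which only the dependence on
  the graph is known.\<close>

lemma fibre_saturated_measurable:
  fixes g :: "'q \<Rightarrow> 'c"
  assumes "g \<in> measurable Q (count_space UNIV)" "S \<subseteq> space Q"
    and "\<And>\<omega> \<omega>'. \<lbrakk>\<omega> \<in> S; \<omega>' \<in> space Q; g \<omega>' = g \<omega>\<rbrakk> \<Longrightarrow> \<omega>' \<in> S"
  shows "S \<in> sets Q"
proof -
  have "S = g -` (g ` S) \<inter> space Q" using assms(2,3) by auto
  then show ?thesis using measurable_sets[OF assms(1), of "g ` S"] by simp
qed

text \<open>
  Rounding the coordinates \<open>h k\<close> to a grid of mesh \<open>1/m\<close> gives approximations that depend on a
  countably valued measurable map only.
\<close>

lemma lipschitz_factor_measurable: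
  fixes \<phi> :: "'q \<Rightarrow> real" and h :: "'k \<Rightarrow> 'q \<Rightarrow> real"
  assumes h: "\<And>k. k \<in> J \<Longrightarrow> h k \<in> borel_measurable Q" and J: "finite J"
    and lip: "\<And>\<omega> \<omega>' e. \<lbrakk>\<omega> \<in> space Q; \<omega>' \<in> space Q; \<And>k. k \<in> J \<Longrightarrow> \<bar>h k \<omega> - h k \<omega>'\<bar> \<le> e; e \<ge> 0\<rbrakk> \<Longrightarrow> \<bar>\<phi> \<omega> - \<phi> \<omega>'\<bar> \<le> L * e"
  shows "\<phi> \<in> borel_measurable Q"
proof -
  obtain ks where ks: "set ks = J" using finite_list[OF J] by blast
  define g where "g m \<omega> = map (\<lambda>k. \<lfloor>real (Suc m) * h k \<omega>\<rfloor>) ks" for m \<omega>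
  \<comment> \<open>One sample point is chosen per rounding class and \<open>\<phi>\<close> is
    evaluated there, since no extension of \<open>\<phi>\<close> to the grid points themselves is
    available.\<close>
  define rep where "rep m l = (SOME \<omega>. \<omega> \<in> space Q \<and> g m \<omega> = l)" for m l
  have rep: "rep m (g m \<omega>) \<in> space Q" "g m (rep m (g m \<omega>)) = g m \<omega>" if "\<omega> \<in> space Q" for m \<omega>
    using someI_ex[of "\<lambda>\<omega>'. \<omega>' \<in> space Q \<and> g m \<omega>' = g m \<omega>"] that by (auto simp: rep_def)
  have gm: "g m \<in> measurable Q (count_space UNIV)" for m
    unfolding g_def
  proof (rule map_measurable_count_space)
    fix k assume "k \<in> set ks"
    then have [measurable]: "h k \<in> borel_measurable Q" using h ks by auto
    show "(\<lambda>\<omega>. \<lfloor>real (Suc m) * h k \<omega>\<rfloor>) \<in> measurable Q (count_space UNIV)" by measurable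
  qed
  have m: "(\<lambda>\<omega>. \<phi> (rep m (g m \<omega>))) \<in> borel_measurable Q" for m
    using measurable_compose[OF gm[of m], of "\<lambda>l. \<phi> (rep m l)" borel] by simp
  show ?thesis
  proof (rule borel_measurable_LIMSEQ_real[OF _ m])
    fix \<omega> assume w: "\<omega> \<in> space Q"
    have b: "\<bar>\<phi> (rep m (g m \<omega>)) - \<phi> \<omega>\<bar> \<le> \<bar>L\<bar> * (1 / real (Suc m))" for m
    proof -
      have "\<bar>\<phi> (rep m (g m \<omega>)) - \<phi> \<omega>\<bar> \<le> L * (1 / real (Suc m))"
      proof (rule lip[OF rep(1)[OF w] w])
        fix k assume "k \<in> J"
        then have "\<lfloor>real (Suc m) * h k (rep m (g m \<omega>))\<rfloor> = \<lfloor>real (Suc m) * h k \<omega>\<rfloor>"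
          using rep(2)[OF w, of m] ks by (auto simp: g_def)
        then have "\<bar>real (Suc m) * h k (rep m (g m \<omega>)) - real (Suc m) * h k \<omega>\<bar> \<le> 1" by linarith
        then have "real (Suc m) * \<bar>h k (rep m (g m \<omega>)) - h k \<omega>\<bar> \<le> 1"
          by (simp only: right_diff_distrib[symmetric] abs_mult abs_of_nat)
        then show "\<bar>h k (rep m (g m \<omega>)) - h k \<omega>\<bar> \<le> 1 / real (Suc m)"
          by (subst pos_le_divide_eq) (auto simp: mult.commute)
      qed simp
      also have "\<dots> \<le> \<bar>L\<bar> * (1 / real (Suc m))" by (intro mult_right_mono) auto
      finally show ?thesis .
    qed
    have "(\<lambda>m. \<bar>L\<bar> * (1 / real (Suc m))) \<longlonglongrightarrow> \<bar>L\<bar> * 0"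
      by (intro tendsto_intros LIMSEQ_Suc[OF lim_1_over_n])
    then have "(\<lambda>m. \<bar>L\<bar> * (1 / real (Suc m))) \<longlonglongrightarrow> 0" by simp
    moreover have "\<forall>\<^sub>F m in sequentially. norm (\<phi> (rep m (g m \<omega>)) - \<phi> \<omega>) \<le> \<bar>L\<bar> * (1 / real (Suc m))"
      unfolding real_norm_def using b by (rule_tac always_eventually) (rule allI)
    ultimately have "(\<lambda>m. \<phi> (rep m (g m \<omega>)) - \<phi> \<omega>) \<longlonglongrightarrow> 0"
      by (rule Lim_null_comparison[rotated])
    then show "(\<lambda>m. \<phi> (rep m (g m \<omega>))) \<longlonglongrightarrow> \<phi> \<omega>" by (rule LIM_zero_cancel)
  qed
qed

context game
begin

lemma agg_cong: "(\<And>j. j \<in> {1..N} \<Longrightarrow> H i j = H' i j) \<Longrightarrow> agg N H a i = agg N H' a i"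
  unfolding agg_def by (intro sum.cong) auto

lemma network_nash_cong:
  assumes "\<And>i j. \<lbrakk>i \<in> {1..N}; j \<in> {1..N}\<rbrakk> \<Longrightarrow> H i j = H' i j"
  shows "network_nash A0 U N \<theta> H = network_nash A0 U N \<theta> H'"
  unfolding network_nash_iff fun_eq_iff using agg_cong[of N H _ H'] assms by auto

lemma unique_network_nash_cong:
  assumes "\<And>i j. \<lbrakk>i \<in> {1..N}; j \<in> {1..N}\<rbrakk> \<Longrightarrow> H i j = H' i j"
  shows "unique_network_nash T P A0 U N \<theta> H = unique_network_nash T P A0 U N \<theta> H'"
  unfolding unique_network_nash_def fun_eq_iff using network_nash_cong[of N H H', OF assms] by simp

text \<open>Applied to a simple graph written as edge noise plus sampled weights, with bounds \<eta>
  and 1.\<close>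

lemma op_bound_add:
  assumes "op_bound N H1 \<tau>1" "op_bound N H2 \<tau>2" shows "op_bound N (\<lambda>i j. H1 i j + H2 i j) (\<tau>1 + \<tau>2)"
  unfolding op_bound_def
proof (intro conjI allI)
  show "0 \<le> \<tau>1 + \<tau>2" using assms by (simp add: op_bound_def)
  fix u :: "nat \<Rightarrow> real"
  have b: "L2_set (\<lambda>i. \<Sum>j=1..N. H i j / real N * u j) {1..N} \<le> \<tau> * L2_set u {1..N}" if "op_bound N H \<tau>" for H \<tau>
  proof -
    have "L2_set (\<lambda>i. \<Sum>j=1..N. H i j / real N * u j) {1..N} \<le> sqrt (\<tau>\<^sup>2 * (\<Sum>j=1..N. (u j)\<^sup>2))"
      unfolding L2_set_def using that by (intro real_sqrt_le_mono) (auto simp: op_bound_def)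
    then show ?thesis using that by (simp add: L2_set_def real_sqrt_mult op_bound_def)
  qed
  have "L2_set (\<lambda>i. \<Sum>j=1..N. (H1 i j + H2 i j) / real N * u j) {1..N} =
      L2_set (\<lambda>i. (\<Sum>j=1..N. H1 i j / real N * u j) + (\<Sum>j=1..N. H2 i j / real N * u j)) {1..N}"
    by (intro L2_set_cong refl) (simp add: add_divide_distrib distrib_right sum.distrib)
  also have "\<dots> \<le> L2_set (\<lambda>i. \<Sum>j=1..N. H1 i j / real N * u j) {1..N} + L2_set (\<lambda>i. \<Sum>j=1..N. H2 i j / real N * u j) {1..N}"
    by (rule L2_set_triangle_ineq)
  also have "\<dots> \<le> (\<tau>1 + \<tau>2) * L2_set u {1..N}" using b[OF assms(1)] b[OF assms(2)] by (simp add: distrib_right)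
  finally have "(L2_set (\<lambda>i. \<Sum>j=1..N. (H1 i j + H2 i j) / real N * u j) {1..N})\<^sup>2 \<le> ((\<tau>1 + \<tau>2) * L2_set u {1..N})\<^sup>2"
    by (rule power_mono) simp
  then show "(\<Sum>i=1..N. (\<Sum>j=1..N. (H1 i j + H2 i j) / real N * u j)\<^sup>2) \<le> (\<tau>1 + \<tau>2)\<^sup>2 * (\<Sum>j=1..N. (u j)\<^sup>2)"
    by (simp add: L2_set_def power_mult_distrib sum_nonneg)
qed

end

lemma profile_dist_nonneg: "0 \<le> profile_dist T P \<nu> a b"
  unfolding profile_dist_def profile_norm_def set_lebesgue_integral_def
  by (intro real_sqrt_ge_zero Bochner_Integration.integral_nonneg) (auto intro!: Bochner_Integration.integral_nonneg mult_nonneg_nonneg)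

context graphon_game
begin

lemma profile_dist_triangle:
  assumes f: "f \<in> L2P" and N: "N \<ge> 1" and ab: "\<And>i. i \<in> {1..N} \<Longrightarrow> a i \<in> L2" "\<And>i. i \<in> {1..N} \<Longrightarrow> b i \<in> L2"
    and e: "e \<ge> 0" "\<And>i. i \<in> {1..N} \<Longrightarrow> nrm (a i - b i) \<le> e"
  shows "profile_dist T P \<nu> f (step_profile N a) \<le> profile_dist T P \<nu> f (step_profile N b) + e"
proof -
  define da where "da x = f x - step_profile N a x" for x
  define db where "db x = f x - step_profile N b x" for x
  have P: "da \<in> L2P" "db \<in> L2P" unfolding da_def db_def using assms by (auto intro!: L2P_diff step_profile_L2P)
  have "da = (\<lambda>x t w. f x t w - step_profile N a x t w)" "db = (\<lambda>x t w. f x t w - step_profile N b x t w)"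
    by (auto simp: da_def db_def fun_eq_iff fun_apply_simps)
  then have eq: "profile_dist T P \<nu> f (step_profile N a) = sqrt (\<integral>x. (nrm (da x))\<^sup>2 \<partial>\<nu>)"
    "profile_dist T P \<nu> f (step_profile N b) = sqrt (\<integral>x. (nrm (db x))\<^sup>2 \<partial>\<nu>)"
    using profile_norm_eq P by (simp_all add: profile_dist_def)
  define s where "s = sqrt (\<integral>x. (nrm (db x))\<^sup>2 \<partial>\<nu>)"
  have s: "0 \<le> s" "s\<^sup>2 = (\<integral>x. (nrm (db x))\<^sup>2 \<partial>\<nu>)" by (simp_all add: s_def)
  note I = L2P_nrm_integrable[OF P(2)] L2P_nrm_sq_integrable[OF P(2)]
  have s1: "(\<integral>x. nrm (db x) \<partial>\<nu>) \<le> s" unfolding s_def by (rule real_le_rsqrt[OF sq_integral_le[OF I]])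
  have "(\<integral>x. (nrm (da x))\<^sup>2 \<partial>\<nu>) \<le> (\<integral>x. (nrm (db x))\<^sup>2 + 2 * e * nrm (db x) + e\<^sup>2 \<partial>\<nu>)"
  proof (rule integral_mono[OF L2P_nrm_sq_integrable[OF P(1)]])
    show "integrable \<nu> (\<lambda>x. (nrm (db x))\<^sup>2 + 2 * e * nrm (db x) + e\<^sup>2)" using I by simp
    fix x assume "x \<in> space \<nu>"
    then have x: "x \<in> {0..1}" by (simp add: space_nu)
    obtain i where i: "i \<in> {1..N}" "x \<in> cell N i" using cell_cover[OF N x] by blast
    have l: "f x \<in> L2" "a i \<in> L2" "b i \<in> L2" using L2P_L2[OF f x] ab i by auto
    have "nrm (da x) \<le> nrm (db x) + e"
      using L2.nrm_diff_triangle[OF l(1,3,2)] L2.nrm_minus[OF l(3,2)] e(2)[OF i(1)]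
      by (simp add: da_def db_def step_profile_cell[OF i])
    then have "(nrm (da x))\<^sup>2 \<le> (nrm (db x) + e)\<^sup>2" using L2P_L2[OF P(1) x] by (intro power_mono) auto
    then show "(nrm (da x))\<^sup>2 \<le> (nrm (db x))\<^sup>2 + 2 * e * nrm (db x) + e\<^sup>2" by (simp add: power2_sum algebra_simps)
  qed
  also have "\<dots> = s\<^sup>2 + 2 * e * (\<integral>x. nrm (db x) \<partial>\<nu>) + e\<^sup>2" using I by (simp add: s(2) nu.prob_space)
  also have "\<dots> \<le> s\<^sup>2 + 2 * e * s + e\<^sup>2" using s1 e by (intro add_mono mult_left_mono) auto
  also have "\<dots> = (s + e)\<^sup>2" by (simp add: power2_sum algebra_simps)
  finally show ?thesis unfolding eq s_def[symmetric] using s e by (intro real_le_lsqrt) auto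
qed

text \<open>Makes the distance to \<open>f\<close> a Lipschitz function of the matrix entries, for
  \<open>lipschitz_factor_measurable\<close>. The constant grows with \<open>N\<close>, which does
  no harm as \<open>N\<close> is fixed there.\<close>

lemma profile_dist_nash_perturbation:
  assumes f: "f \<in> L2P" and N: "N \<ge> 1" and \<theta>: "\<And>i. i \<in> {1..N} \<Longrightarrow> \<theta> i \<in> HH"
    and H: "op_bound N H \<tau>" "rr * \<tau> < 1"
    and d: "\<And>i j. \<lbrakk>i \<in> {1..N}; j \<in> {1..N}\<rbrakk> \<Longrightarrow> \<bar>H i j - H' i j\<bar> \<le> e"
    and a: "network_nash A0 U N \<theta> H a" and b: "network_nash A0 U N \<theta> H' b"
  shows "\<bar>profile_dist T P \<nu> f (step_profile N a) - profile_dist T P \<nu> f (step_profile N b)\<bar> \<le> rr * M * sqrt N / (1 - rr * \<tau>) * e"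
proof -
  have A: "a i \<in> A0" "b i \<in> A0" if "i \<in> {1..N}" for i
    using a b that by (auto simp: network_nash_iff best_iff)
  let ?e = "rr * M * sqrt N / (1 - rr * \<tau>) * e"
  have v: "vnorm N (\<lambda>i. a i - b i) \<le> ?e" by (rule network_perturbation[OF N \<theta> H d a b])
  have n: "nrm (a i - b i) \<le> ?e" "nrm (b i - a i) \<le> ?e" if "i \<in> {1..N}" for i
  proof -
    show "nrm (a i - b i) \<le> ?e" using member_le_L2_set[of "{1..N}" i "\<lambda>i. nrm (a i - b i)"] that v by simp
    then show "nrm (b i - a i) \<le> ?e" using L2.nrm_minus A[OF that] by auto
  qed
  have e0: "0 \<le> ?e" using v L2_set_nonneg order_trans by blast
  have AL: "a i \<in> L2" "b i \<in> L2" if "i \<in> {1..N}" for i using A[OF that] by auto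
  have "profile_dist T P \<nu> f (step_profile N a) \<le> profile_dist T P \<nu> f (step_profile N b) + ?e"
    by (rule profile_dist_triangle[OF f N _ _ e0]) (use AL n in auto)
  moreover have "profile_dist T P \<nu> f (step_profile N b) \<le> profile_dist T P \<nu> f (step_profile N a) + ?e"
    by (rule profile_dist_triangle[OF f N _ _ e0]) (use AL n in auto)
  ultimately show ?thesis by linarith
qed

end

section \<open>Sampled games\<close>

locale sampled_game = graphon_game T P F U \<alpha> lU l\<theta> M A0 \<nu> + Q: prob_space Q
  for T :: real and P :: "'w measure" and F U \<alpha> lU l\<theta> M A0 \<nu> and Q :: "'q measure" +
  fixes W :: "real \<Rightarrow> real \<Rightarrow> real" and \<theta> abar :: "'w profile" and \<theta>N :: "nat \<Rightarrow> nat \<Rightarrow> 'w process"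
    and \<kappa> :: "nat \<Rightarrow> real" and Y :: "nat \<Rightarrow> nat \<Rightarrow> 'q \<Rightarrow> real" and E :: "nat \<Rightarrow> nat \<Rightarrow> nat \<Rightarrow> 'q \<Rightarrow> bool"
  assumes \<theta>: "\<theta> \<in> action_profiles T P F \<nu>"
    and graphon_W: "graphon W" and lip_W: "blockwise_lipschitz W"
    and nash: "graphon_nash T P F \<nu> (\<lambda>_. A0) U \<theta> W abar"
    and \<kappa>: "N \<ge> 1 \<Longrightarrow> 0 < \<kappa> N" "N \<ge> 1 \<Longrightarrow> \<kappa> N \<le> 1"
    and \<kappa>_lim: "(\<lambda>N. ln (real N) / (\<kappa> N * real N)) \<longlonglongrightarrow> 0"
    and \<theta>N: "\<lbrakk>N \<ge> 1; i \<in> {1..N}\<rbrakk> \<Longrightarrow> \<theta>N N i \<in> proc_space T P F"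
    and \<theta>_lim: "(\<lambda>N. profile_dist T P \<nu> \<theta> (step_profile N (\<theta>N N))) \<longlonglongrightarrow> 0"
    and Y: "N \<ge> 1 \<Longrightarrow> iid_uniform Q N (Y N)"
    and E: "N \<ge> 1 \<Longrightarrow> simple_graph_edges Q W (\<kappa> N) N (ordered_points N (Y N)) (E N)"
begin

abbreviation pts :: "nat \<Rightarrow> nat \<Rightarrow> 'q \<Rightarrow> real" where "pts N \<equiv> ordered_points N (Y N)"
abbreviation Hw :: "nat \<Rightarrow> 'q \<Rightarrow> nat \<Rightarrow> nat \<Rightarrow> real" where "Hw N \<omega> \<equiv> weighted_graph W (pts N) \<omega>"
abbreviation Hs :: "nat \<Rightarrow> 'q \<Rightarrow> nat \<Rightarrow> nat \<Rightarrow> real" where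
  "Hs N \<omega> \<equiv> (\<lambda>i j. inverse (\<kappa> N) * simple_graph (E N) \<omega> i j)"
abbreviation dist\<theta> :: "nat \<Rightarrow> real" where "dist\<theta> N \<equiv> profile_dist T P \<nu> \<theta> (step_profile N (\<theta>N N))"
abbreviation distbar :: "nat \<Rightarrow> (nat \<Rightarrow> 'w process) \<Rightarrow> real" where "distbar N a \<equiv> profile_dist T P \<nu> abar (step_profile N a)"
abbreviation Nash :: "nat \<Rightarrow> (nat \<Rightarrow> nat \<Rightarrow> real) \<Rightarrow> (nat \<Rightarrow> 'w process) \<Rightarrow> bool" where
  "Nash N H a \<equiv> network_nash A0 U N (\<theta>N N) H a"
abbreviation UNash :: "nat \<Rightarrow> (nat \<Rightarrow> nat \<Rightarrow> real) \<Rightarrow> (nat \<Rightarrow> 'w process) \<Rightarrow> bool" where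
  "UNash N H a \<equiv> unique_network_nash T P A0 U N (\<theta>N N) H a"

lemma abarP: "abar \<in> L2P"
  using action_profile_L2P(1) nash by (simp add: graphon_nash_def)

lemma W01: "s \<in> {0..1} \<Longrightarrow> t \<in> {0..1} \<Longrightarrow> 0 \<le> W s t \<and> W s t \<le> 1 \<and> W s t = W t s"
  using graphon_W unfolding graphon_def by blast

lemma pts_range: "\<lbrakk>N \<ge> 1; \<omega> \<in> space Q; i \<in> {1..N}\<rbrakk> \<Longrightarrow> pts N i \<omega> \<in> {0..1}"
  by (rule ordered_points_range) (use Y in \<open>auto simp: iid_uniform_def\<close>)

lemma pts_measurable: "\<lbrakk>N \<ge> 1; i \<in> {1..N}\<rbrakk> \<Longrightarrow> pts N i \<in> borel_measurable Q"
  using ordered_points_measurable[OF Q.prob_space_axioms Y] .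

lemma Hw_range: "\<lbrakk>N \<ge> 1; \<omega> \<in> space Q; i \<in> {1..N}; j \<in> {1..N}\<rbrakk> \<Longrightarrow> \<bar>Hw N \<omega> i j\<bar> \<le> 1"
  using W01[OF pts_range pts_range, of N \<omega> i N \<omega> j] by (simp add: weighted_graph_def)

lemma Hw_op_bound: "\<lbrakk>N \<ge> 1; \<omega> \<in> space Q\<rbrakk> \<Longrightarrow> op_bound N (Hw N \<omega>) 1"
  by (rule op_bound_unit) (rule Hw_range)

lemma nash_imp_unique: "\<lbrakk>N \<ge> 1; op_bound N H \<tau>; rr * \<tau> < 1; Nash N H a\<rbrakk> \<Longrightarrow> UNash N H a"
  by (rule network_nash_unique) (use \<theta>N in auto)

lemma unique_nash_exists: "\<lbrakk>N \<ge> 1; op_bound N H \<tau>; rr * \<tau> < 1\<rbrakk> \<Longrightarrow> \<exists>a. UNash N H a"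
  using network_nash_exists[of N "\<theta>N N" H \<tau>] nash_imp_unique[of N H \<tau>] \<theta>N by blast

lemma UNash_imp_Nash: "UNash N H a \<Longrightarrow> Nash N H a"
  by (simp add: unique_network_nash_def)

lemma weighted_nash_exists: "\<lbrakk>N \<ge> 1; \<omega> \<in> space Q\<rbrakk> \<Longrightarrow> \<exists>a. UNash N (Hw N \<omega>) a"
  using unique_nash_exists[OF _ Hw_op_bound] rr by auto

text \<open>Values of \<open>W\<close> off the unit square are unconstrained; the projection onto the square removes them.\<close>

definition WW :: "real \<Rightarrow> real \<Rightarrow> real" where
  "WW s t = W (max 0 (min 1 s)) (max 0 (min 1 t))"

lemma WW_eq: "s \<in> {0..1} \<Longrightarrow> t \<in> {0..1} \<Longrightarrow> WW s t = W s t"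
  by (simp add: WW_def)

lemma WW_borel: "case_prod WW \<in> borel_measurable (borel \<Otimes>\<^sub>M borel)"
proof -
  have "(\<lambda>p. (max 0 (min 1 (fst p)), max 0 (min 1 (snd p)))) \<in> measurable (borel \<Otimes>\<^sub>M borel) (restrict_space borel ({0..1::real} \<times> {0..1::real}))"
    unfolding borel_prod
    by (intro measurable_restrict_space2 borel_measurable_continuous_onI continuous_intros) auto
  from measurable_compose[OF this blockwise_lipschitz_borel[OF lip_W]]
  show ?thesis by (simp add: WW_def[abs_def] case_prod_unfold)
qed

lemma WW_range: "0 \<le> WW s t" "WW s t \<le> 1" "WW s t = WW t s"
  unfolding WW_def using W01[of "max 0 (min 1 s)" "max 0 (min 1 t)"] by auto

lemma sampled_graph: "N \<ge> 1 \<Longrightarrow> sampled_graph Q WW (\<kappa> N) N (pts N) (E N)"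
proof -
  assume N: "N \<ge> 1"
  have edges: "simple_graph_edges Q WW (\<kappa> N) N (pts N) (E N)"
    unfolding simple_graph_edges_def
  proof (intro conjI ballI allI)
    show "E N i j \<in> measurable Q (count_space UNIV)" if "i \<in> {1..N}" "j \<in> {i<..N}" for i j
      using E[OF N] that unfolding simple_graph_edges_def by blast
    fix B e assume B: "B \<in> sets (PiM {1..N} (\<lambda>_. borel :: real measure))"
    have "Q.prob {\<omega>\<in>space Q. (\<lambda>i\<in>{1..N}. pts N i \<omega>) \<in> B \<and> (\<forall>i\<in>{1..N}. \<forall>j\<in>{i<..N}. E N i j \<omega> = e i j)} =
        (LINT \<omega>|Q. indicator B (\<lambda>i\<in>{1..N}. pts N i \<omega>) *
           (\<Prod>i=1..N. \<Prod>j\<in>{i<..N}. if e i j then \<kappa> N * W (pts N i \<omega>) (pts N j \<omega>) else 1 - \<kappa> N * W (pts N i \<omega>) (pts N j \<omega>)))"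
      using E[OF N, unfolded simple_graph_edges_def, THEN conjunct2, rule_format, OF B, of e] .
    also have "\<dots> = (LINT \<omega>|Q. indicator B (\<lambda>i\<in>{1..N}. pts N i \<omega>) *
           (\<Prod>i=1..N. \<Prod>j\<in>{i<..N}. if e i j then \<kappa> N * WW (pts N i \<omega>) (pts N j \<omega>) else 1 - \<kappa> N * WW (pts N i \<omega>) (pts N j \<omega>)))"
    proof (rule Bochner_Integration.integral_cong[OF refl])
      fix \<omega> assume w: "\<omega> \<in> space Q"
      have "WW (pts N i \<omega>) (pts N j \<omega>) = W (pts N i \<omega>) (pts N j \<omega>)" if "i \<in> {1..N}" "j \<in> {i<..N}" for i j
        using that by (intro WW_eq pts_range[OF N w]) auto
      then show "indicator B (\<lambda>i\<in>{1..N}. pts N i \<omega>) *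
           (\<Prod>i=1..N. \<Prod>j\<in>{i<..N}. if e i j then \<kappa> N * W (pts N i \<omega>) (pts N j \<omega>) else 1 - \<kappa> N * W (pts N i \<omega>) (pts N j \<omega>)) =
         indicator B (\<lambda>i\<in>{1..N}. pts N i \<omega>) *
           (\<Prod>i=1..N. \<Prod>j\<in>{i<..N}. if e i j then \<kappa> N * WW (pts N i \<omega>) (pts N j \<omega>) else 1 - \<kappa> N * WW (pts N i \<omega>) (pts N j \<omega>) :: real)"
        by (intro arg_cong2[where f = "(*)"] refl prod.cong) auto
    qed
    finally show "Q.prob {\<omega>\<in>space Q. (\<lambda>i\<in>{1..N}. pts N i \<omega>) \<in> B \<and> (\<forall>i\<in>{1..N}. \<forall>j\<in>{i<..N}. E N i j \<omega> = e i j)} =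
        (LINT \<omega>|Q. indicator B (\<lambda>i\<in>{1..N}. pts N i \<omega>) *
           (\<Prod>i=1..N. \<Prod>j\<in>{i<..N}. if e i j then \<kappa> N * WW (pts N i \<omega>) (pts N j \<omega>) else 1 - \<kappa> N * WW (pts N i \<omega>) (pts N j \<omega>)))" .
  qed
  show ?thesis
    by (rule sampled_graph.intro[OF Q.prob_space_axioms sampled_graph_axioms.intro])
      (rule WW_borel WW_range \<kappa>[OF N] pts_measurable[OF N] edges | assumption)+
qed

text \<open>The equilibrium chosen by \<open>SOME\<close> carries no measurability of its own, but
  its distance to \<open>abar\<close> depends on the finitely many sampled weights in a Lipschitz
  way.\<close>

lemma weighted_event_measurable:
  assumes N: "N \<ge> 1"
  shows "{\<omega> \<in> space Q. \<exists>a. UNash N (Hw N \<omega>) a \<and> distbar N a \<le> c} \<in> sets Q"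
proof -
  define a where "a \<omega> = (SOME a. UNash N (Hw N \<omega>) a)" for \<omega>
  have a: "UNash N (Hw N \<omega>) (a \<omega>)" if "\<omega> \<in> space Q" for \<omega>
    unfolding a_def by (rule someI_ex[OF weighted_nash_exists[OF N that]])
  define L where "L = rr * M * sqrt N / (1 - rr * 1)"
  have pert: "\<bar>distbar N b - distbar N b'\<bar> \<le> L * e"
    if "\<omega> \<in> space Q" "Nash N (Hw N \<omega>) b" "Nash N H' b'" "\<And>i j. \<lbrakk>i \<in> {1..N}; j \<in> {1..N}\<rbrakk> \<Longrightarrow> \<bar>Hw N \<omega> i j - H' i j\<bar> \<le> e" for \<omega> b b' H' e
    unfolding L_def
    by (rule profile_dist_nash_perturbation[OF abarP N \<theta>N[OF N] Hw_op_bound[OF N that(1)] _ that(4,2,3)]) (use rr in auto)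
  have hm: "(\<lambda>\<omega>. WW (pts N (fst k) \<omega>) (pts N (snd k) \<omega>)) \<in> borel_measurable Q" if "k \<in> {1..N} \<times> {1..N}" for k
    using measurable_compose[OF measurable_Pair[OF pts_measurable[OF N, of "fst k"] pts_measurable[OF N, of "snd k"]] WW_borel] that
    by auto
  have HW: "Hw N \<omega> i j = WW (pts N i \<omega>) (pts N j \<omega>)" if "\<omega> \<in> space Q" "i \<in> {1..N}" "j \<in> {1..N}" for \<omega> i j
    unfolding weighted_graph_def using that by (intro WW_eq[symmetric] pts_range[OF N]) auto
  have [measurable]: "(\<lambda>\<omega>. distbar N (a \<omega>)) \<in> borel_measurable Q"
  proof (rule lipschitz_factor_measurable[OF hm])
    fix \<omega> \<omega>' e
    assume w: "\<omega> \<in> space Q" "\<omega>' \<in> space Q"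
      and d: "\<And>k. k \<in> {1..N} \<times> {1..N} \<Longrightarrow> \<bar>WW (pts N (fst k) \<omega>) (pts N (snd k) \<omega>) - WW (pts N (fst k) \<omega>') (pts N (snd k) \<omega>')\<bar> \<le> e"
    show "\<bar>distbar N (a \<omega>) - distbar N (a \<omega>')\<bar> \<le> L * e"
    proof (rule pert[OF w(1) UNash_imp_Nash[OF a[OF w(1)]] UNash_imp_Nash[OF a[OF w(2)]]])
      fix i j assume ij: "i \<in> {1..N}" "j \<in> {1..N}"
      show "\<bar>Hw N \<omega> i j - Hw N \<omega>' i j\<bar> \<le> e" unfolding HW[OF w(1) ij] HW[OF w(2) ij] using d[of "(i, j)"] ij by simp
    qed
  qed auto
  have "{\<omega> \<in> space Q. \<exists>a. UNash N (Hw N \<omega>) a \<and> distbar N a \<le> c} = {\<omega> \<in> space Q. distbar N (a \<omega>) \<le> c}"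
  proof (intro Collect_cong conj_cong refl iffI)
    fix \<omega> assume w: "\<omega> \<in> space Q"
    { assume "\<exists>a. UNash N (Hw N \<omega>) a \<and> distbar N a \<le> c"
      then obtain b where b: "UNash N (Hw N \<omega>) b" "distbar N b \<le> c" by blast
      \<comment> \<open>The same matrix on both sides: all its equilibria have the same distance, so
        the event does not depend on the choice made.\<close>
      have "\<bar>distbar N b - distbar N (a \<omega>)\<bar> \<le> L * 0"
        by (rule pert[OF w UNash_imp_Nash[OF b(1)] UNash_imp_Nash[OF a[OF w]]]) auto
      then show "distbar N (a \<omega>) \<le> c" using b(2) by simp }
    { assume "distbar N (a \<omega>) \<le> c"
      then show "\<exists>a. UNash N (Hw N \<omega>) a \<and> distbar N a \<le> c" using a[OF w] by blast }
  qed
  also have "\<dots> \<in> sets Q" by measurable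
  finally show ?thesis .
qed

text \<open>The matrix \<open>Hs\<close> is a function of the edge pattern alone, and patterns are
  encoded by Boolean lists; hence any property \<open>R\<close> of the equilibrium is
  allowed.\<close>

lemma simple_event_measurable:
  assumes N: "N \<ge> 1"
  shows "{\<omega> \<in> space Q. \<exists>b. UNash N (Hs N \<omega>) b \<and> R b} \<in> sets Q"
proof -
  obtain ks where ks: "set ks = edge_set N" using finite_list[OF finite_edge_set] by blast
  define g where "g \<omega> = map (\<lambda>k. E N (fst k) (snd k) \<omega>) ks" for \<omega>
  have gm: "g \<in> measurable Q (count_space UNIV)"
    unfolding g_def
  proof (rule map_measurable_count_space)
    fix k assume "k \<in> set ks"
    then show "E N (fst k) (snd k) \<in> measurable Q (count_space UNIV)"
      using E[OF N] unfolding ks simple_graph_edges_def edge_set_def by auto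
  qed
  show ?thesis
  proof (rule fibre_saturated_measurable[OF gm])
    fix \<omega> \<omega>' assume w: "\<omega> \<in> {\<omega> \<in> space Q. \<exists>b. UNash N (Hs N \<omega>) b \<and> R b}" "\<omega>' \<in> space Q" and g: "g \<omega>' = g \<omega>"
    have e: "E N i j \<omega>' = E N i j \<omega>" if "i \<in> {1..N}" "j \<in> {1..N}" "i < j" for i j
    proof -
      have "(i, j) \<in> set ks" using that by (auto simp: ks edge_set_def)
      then show ?thesis using g unfolding g_def map_eq_conv by fastforce
    qed
    have "UNash N (Hs N \<omega>) = UNash N (Hs N \<omega>')"
      by (rule unique_network_nash_cong) (use e in \<open>auto simp: simple_graph_def\<close>)
    then show "\<omega>' \<in> {\<omega> \<in> space Q. \<exists>b. UNash N (Hs N \<omega>) b \<and> R b}" using w by auto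
  qed auto
qed

section \<open>Deterministic error bounds on the good events\<close>

lemma quarter_power: "0 \<le> z \<Longrightarrow> sqrt (sqrt z) = z powr (1/4)" for z :: real
  by (simp add: powr_half_sqrt[symmetric] powr_powr)

text \<open>The matrix error \<eta> is left free: it is 0 for the weighted graph and of order
  \<open>sqrt (ln N / (\<kappa> N * N))\<close> for the simple graph. The constant \<open>D\<close>
  dominates the coefficients of the three error terms.\<close>

lemma stability_on_good_event:
  "\<exists>C\<ge>0. \<forall>N\<ge>3. \<forall>\<omega>\<in>space Q. \<forall>H \<eta> a. 4 * sqrt (ln (real N) / real N) \<le> 1 \<longrightarrow>
     (\<forall>i\<in>{1..N}. \<bar>pts N i \<omega> - real i / real N\<bar> \<le> sqrt (2 * ln (real N) / real N) + 1 / real N) \<longrightarrow>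
     op_bound N (\<lambda>i j. H i j - Hw N \<omega> i j) \<eta> \<longrightarrow> Nash N H a \<longrightarrow>
     distbar N a \<le> C * ((ln (real N) / real N) powr (1/4) + \<eta> + dist\<theta> N)"
proof -
  obtain K where K: "K \<ge> 0" and KB: "\<forall>N\<ge>1. \<forall>p d. 0 \<le> d \<and> d \<le> 1 \<and> (\<forall>i\<in>{1..N}. p i \<in> {0..1} \<and> (\<forall>x\<in>cell N i. \<bar>x - p i\<bar> \<le> d)) \<longrightarrow>
     (\<exists>\<beta> B. \<beta> \<in> borel_measurable \<nu> \<and> (\<forall>x\<in>{0..1}. 0 \<le> \<beta> x \<and> \<beta> x \<le> B) \<and> (\<integral>x. (\<beta> x)\<^sup>2 \<partial>\<nu>) \<le> K * d \<and>
       (\<forall>i\<in>{1..N}. \<forall>x\<in>cell N i. (\<integral>y. \<bar>W x y - (\<Sum>j=1..N. indicator (cell N j) y * W (p i) (p j))\<bar> \<partial>\<nu>) \<le> \<beta> x))"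
    using sampling_error[OF graphon_W lip_W] by (elim exE conjE) (rule that)
  define D where "D = M * (2 * sqrt K) + M + l\<theta> / \<alpha>"
  have c0: "0 \<le> l\<theta> / \<alpha>" using lipschitz_nonneg \<alpha>_pos by simp
  have D0: "0 \<le> D" "M * (2 * sqrt K) \<le> D" "M \<le> D" "l\<theta> / \<alpha> \<le> D"
    using M_nonneg K c0 by (auto simp: D_def)
  have r0: "0 \<le> sqrt 3 / (1 - rr)" using rr by simp
  show ?thesis
  proof (intro exI[of _ "sqrt 3 / (1 - rr) * D"] conjI allI ballI impI)
    show "0 \<le> sqrt 3 / (1 - rr) * D" by (rule mult_nonneg_nonneg[OF r0 D0(1)])
    fix N :: nat and \<omega> H \<eta> a
    assume N: "N \<ge> 3" and w: "\<omega> \<in> space Q" and small: "4 * sqrt (ln (real N) / real N) \<le> 1"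
      and close: "\<forall>i\<in>{1..N}. \<bar>pts N i \<omega> - real i / real N\<bar> \<le> sqrt (2 * ln (real N) / real N) + 1 / real N"
      and op: "op_bound N (\<lambda>i j. H i j - Hw N \<omega> i j) \<eta>" and a: "Nash N H a"
    have N1: "N \<ge> 1" using N by simp
    define z where "z = ln (real N) / real N"
    have "exp 1 \<le> real N" using N exp_le by linarith
    then have ln1: "1 \<le> ln (real N)" using N by (simp add: ln_ge_iff)
    have z0: "0 \<le> z" using ln1 by (simp add: z_def)
    define d where "d = 4 * sqrt z"
    have oneN: "1 / real N \<le> sqrt z"
    proof (rule real_le_rsqrt)
      have "(1 / real N)\<^sup>2 \<le> 1 / real N" using N by (simp add: power2_eq_square field_simps)
      also have "\<dots> \<le> z" unfolding z_def using ln1 N by (intro divide_right_mono) auto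
      finally show "(1 / real N)\<^sup>2 \<le> z" .
    qed
    have "sqrt (2 * z) \<le> 2 * sqrt z" using z0 by (intro real_le_lsqrt) (auto simp: power_mult_distrib)
    \<comment> \<open>Of the two terms \<open>1 / N\<close>, one comes from the concentration bound
      and one from the width of a cell.\<close>
    then have dd: "sqrt (2 * ln (real N) / real N) + 2 / real N \<le> d" using oneN by (simp add: d_def z_def)
    have cl: "\<bar>x - pts N i \<omega>\<bar> \<le> d" if "i \<in> {1..N}" "x \<in> cell N i" for i x
    proof -
      have "(real i - 1) / real N \<le> x \<and> x \<le> real i / real N"
        using that N by (auto simp: cell_def split: if_splits)
      then have "\<bar>x - real i / real N\<bar> \<le> 1 / real N" by (simp add: diff_divide_distrib abs_le_iff)
      then show ?thesis using bspec[OF close that(1)] dd by linarith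
    qed
    have "0 \<le> d \<and> d \<le> 1 \<and> (\<forall>i\<in>{1..N}. pts N i \<omega> \<in> {0..1} \<and> (\<forall>x\<in>cell N i. \<bar>x - pts N i \<omega>\<bar> \<le> d))"
      using z0 small cl pts_range[OF N1 w] by (auto simp: d_def z_def)
    note KB' = KB[rule_format, OF N1, of d "\<lambda>i. pts N i \<omega>", OF this]
    obtain \<beta> B where \<beta>: "\<beta> \<in> borel_measurable \<nu>" "\<And>x. x \<in> {0..1} \<Longrightarrow> 0 \<le> \<beta> x \<and> \<beta> x \<le> B" "(\<integral>x. (\<beta> x)\<^sup>2 \<partial>\<nu>) \<le> K * d"
       "\<And>i x. i \<in> {1..N} \<Longrightarrow> x \<in> cell N i \<Longrightarrow> (\<integral>y. \<bar>W x y - (\<Sum>j=1..N. indicator (cell N j) y * Hw N \<omega> i j)\<bar> \<partial>\<nu>) \<le> \<beta> x"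
      using KB' unfolding weighted_graph_def by blast
    have "distbar N a \<le> sqrt 3 / (1 - rr) * (M * sqrt (\<integral>x. (\<beta> x)\<^sup>2 \<partial>\<nu>) + M * \<eta> + l\<theta> / \<alpha> * dist\<theta> N)"
    proof (rule graphon_stability[OF N1 \<theta> nash \<theta>N[OF N1] a _ _ Hw_range[OF N1 w] op \<beta>(1,2,4)])
      show "(\<lambda>y. W x y) \<in> borel_measurable \<nu>" if "x \<in> {0..1}" for x
        by (rule measurable_nu[OF blockwise_lipschitz_section[OF lip_W that]])
      show "\<bar>W x y\<bar> \<le> 1" if "x \<in> {0..1}" "y \<in> {0..1}" for x y using W01[OF that] by simp
    qed auto
    also have "\<dots> \<le> sqrt 3 / (1 - rr) * (D * (z powr (1/4)) + D * \<eta> + D * dist\<theta> N)"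
    proof (intro mult_left_mono[OF _ r0] add_mono mult_right_mono D0)
      have "sqrt (\<integral>x. (\<beta> x)\<^sup>2 \<partial>\<nu>) \<le> sqrt (K * d)" using \<beta>(3) by simp
      also have "\<dots> = 2 * sqrt K * z powr (1/4)"
        using quarter_power[OF z0] by (simp add: d_def real_sqrt_mult mult.assoc)
      finally have "M * sqrt (\<integral>x. (\<beta> x)\<^sup>2 \<partial>\<nu>) \<le> M * (2 * sqrt K * z powr (1/4))"
        using M_nonneg by (rule mult_left_mono)
      also have "\<dots> \<le> D * z powr (1/4)"
        using mult_right_mono[OF D0(2), of "z powr (1/4)"] by (simp add: mult.assoc)
      finally show "M * sqrt (\<integral>x. (\<beta> x)\<^sup>2 \<partial>\<nu>) \<le> D * z powr (1/4)" .
      show "0 \<le> \<eta>" using op by (simp add: op_bound_def)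
      show "0 \<le> dist\<theta> N" by (rule profile_dist_nonneg)
    qed
    finally show "distbar N a \<le> sqrt 3 / (1 - rr) * D * ((ln (real N) / real N) powr (1/4) + \<eta> + dist\<theta> N)"
      by (simp add: z_def algebra_simps)
  qed
qed

lemma ln_over_nonneg: "0 \<le> ln (real N) / real N" "0 \<le> ln (real N) / (\<kappa> N * real N)"
  using \<kappa>(1)[of N] by (cases "N = 0"; simp)+

lemma ln_over_le: "ln (real N) / real N \<le> ln (real N) / (\<kappa> N * real N)"
proof (cases "N = 0")
  case False
  then have "\<kappa> N * real N \<le> real N" "0 < \<kappa> N * real N" using \<kappa>[of N] by (auto simp: mult_le_cancel_right1)
  then show ?thesis using False by (intro divide_left_mono) auto
qed simp

lemma ln_over_lim: "(\<lambda>N. ln (real N) / real N) \<longlonglongrightarrow> 0"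
  by (rule tendsto_sandwich[OF _ _ tendsto_const \<kappa>_lim]) (auto simp: ln_over_nonneg ln_over_le)

lemma powr_lim: "(\<lambda>N. (ln (real N) / real N) powr (1/4)) \<longlonglongrightarrow> 0"
proof -
  have "(\<lambda>N. sqrt (sqrt (ln (real N) / real N))) \<longlonglongrightarrow> sqrt (sqrt 0)"
    by (intro tendsto_real_sqrt ln_over_lim)
  then show ?thesis by (simp add: quarter_power[OF ln_over_nonneg(1)])
qed

lemma eventually_sampling_regime: "\<forall>\<^sub>F N in sequentially. N \<ge> 3 \<and> 4 * sqrt (ln (real N) / real N) \<le> 1 \<and>
    2 * real (nat \<lceil>ln (real N)\<rceil>) \<le> real N * \<kappa> N"
proof -
  have "(\<lambda>N. 4 * sqrt (ln (real N) / real N)) \<longlonglongrightarrow> 4 * sqrt 0"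
    by (intro tendsto_intros ln_over_lim)
  then have "\<forall>\<^sub>F N in sequentially. 4 * sqrt (ln (real N) / real N) < 1" by (rule order_tendstoD) simp
  \<comment> \<open>The threshold \<open>1/4\<close> fits \<open>2 * k \<le> 4 * ln N\<close> for
    the \<open>k\<close> of the trace method.\<close>
  moreover have "\<forall>\<^sub>F N in sequentially. ln (real N) / (\<kappa> N * real N) < 1/4" using \<kappa>_lim by (rule order_tendstoD) simp
  ultimately show ?thesis using eventually_ge_at_top[of 3]
  proof eventually_elim
    case (elim N)
    have "exp 1 \<le> real N" using elim(3) exp_le by linarith
    then have ln1: "1 \<le> ln (real N)" using elim(3) by (simp add: ln_ge_iff)
    have "0 < \<kappa> N * real N" using \<kappa>(1)[of N] elim(3) by simp
    then have "4 * ln (real N) \<le> \<kappa> N * real N" using elim(2) by (simp add: field_simps)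
    moreover have "real (nat \<lceil>ln (real N)\<rceil>) \<le> 2 * ln (real N)" using ln1 by linarith
    ultimately show ?case using elim by (simp add: mult.commute)
  qed
qed

text \<open>The bound \<open>5 / N\<close> squared is weaker than the available 4 so that it has the
  same form as in \<open>simple_good\<close>.\<close>

lemma weighted_good:
  "\<exists>C\<ge>0. \<forall>\<^sub>F N in sequentially. \<exists>B\<in>sets Q. Q.prob B \<le> 5 / (real N)\<^sup>2 \<and> (\<forall>\<omega>\<in>space Q - B. \<forall>a.
     Nash N (Hw N \<omega>) a \<longrightarrow> distbar N a \<le> C * ((ln (real N) / real N) powr (1/4) + dist\<theta> N))"
proof -
  obtain C where C: "C \<ge> 0" and st: "\<forall>N\<ge>3. \<forall>\<omega>\<in>space Q. \<forall>H \<eta> a. 4 * sqrt (ln (real N) / real N) \<le> 1 \<longrightarrow>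
     (\<forall>i\<in>{1..N}. \<bar>pts N i \<omega> - real i / real N\<bar> \<le> sqrt (2 * ln (real N) / real N) + 1 / real N) \<longrightarrow>
     op_bound N (\<lambda>i j. H i j - Hw N \<omega> i j) \<eta> \<longrightarrow> Nash N H a \<longrightarrow>
     distbar N a \<le> C * ((ln (real N) / real N) powr (1/4) + \<eta> + dist\<theta> N)"
    using stability_on_good_event by (elim exE conjE) (rule that)
  show ?thesis
  proof (intro exI[of _ C] conjI C)
    show "\<forall>\<^sub>F N in sequentially. \<exists>B\<in>sets Q. Q.prob B \<le> 5 / (real N)\<^sup>2 \<and> (\<forall>\<omega>\<in>space Q - B. \<forall>a.
     Nash N (Hw N \<omega>) a \<longrightarrow> distbar N a \<le> C * ((ln (real N) / real N) powr (1/4) + dist\<theta> N))"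
      using eventually_sampling_regime
    proof eventually_elim
      case (elim N)
      then have N: "N \<ge> 3" "N \<ge> 2" "N \<ge> 1" by auto
      obtain B where B: "B \<in> sets Q" "Q.prob B \<le> 4 / (real N)\<^sup>2"
        "\<forall>\<omega>\<in>space Q - B. \<forall>i\<in>{1..N}. \<bar>pts N i \<omega> - real i / real N\<bar> \<le> sqrt (2 * ln (real N) / real N) + 1 / real N"
        using order_statistics_concentration[OF Q.prob_space_axioms Y[OF N(3)] N(2)] by blast
      have "op_bound N (\<lambda>i j. Hw N \<omega> i j - Hw N \<omega> i j) 0" for \<omega> by (simp add: op_bound_def)
      then have "distbar N a \<le> C * ((ln (real N) / real N) powr (1/4) + 0 + dist\<theta> N)"
        if "\<omega> \<in> space Q - B" "Nash N (Hw N \<omega>) a" for \<omega> a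
        using st[rule_format, OF N(1), of \<omega> "Hw N \<omega>" 0 a] B(3) that elim by blast
      moreover have "Q.prob B \<le> 5 / (real N)\<^sup>2" using B(2) by (rule order_trans) (simp add: divide_right_mono)
      ultimately show ?case using B(1) by auto
    qed
  qed
qed

text \<open>The exceptional set joins the bad order statistics and the bad edge noise, with
  probabilities \<open>4 / N\<close> squared and \<open>1 / N\<close> squared. Existence needs the
  second only, the error bound needs both.\<close>

lemma simple_good:
  "\<exists>C\<ge>0. \<forall>\<^sub>F N in sequentially. \<exists>B\<in>sets Q. Q.prob B \<le> 5 / (real N)\<^sup>2 \<and> (\<forall>\<omega>\<in>space Q - B.
     (\<exists>b. UNash N (Hs N \<omega>) b) \<and> (\<forall>b. Nash N (Hs N \<omega>) b \<longrightarrow>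
       distbar N b \<le> C * ((ln (real N) / real N) powr (1/4) + (ln (real N) / (\<kappa> N * real N)) powr (1/2) + dist\<theta> N)))"
proof -
  obtain C where C: "C \<ge> 0" and st: "\<forall>N\<ge>3. \<forall>\<omega>\<in>space Q. \<forall>H \<eta> a. 4 * sqrt (ln (real N) / real N) \<le> 1 \<longrightarrow>
     (\<forall>i\<in>{1..N}. \<bar>pts N i \<omega> - real i / real N\<bar> \<le> sqrt (2 * ln (real N) / real N) + 1 / real N) \<longrightarrow>
     op_bound N (\<lambda>i j. H i j - Hw N \<omega> i j) \<eta> \<longrightarrow> Nash N H a \<longrightarrow>
     distbar N a \<le> C * ((ln (real N) / real N) powr (1/4) + \<eta> + dist\<theta> N)"
    using stability_on_good_event by (elim exE conjE) (rule that)
  define c :: real where "c = sqrt (32 * exp 3 + 2)"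
  define \<eta> where "\<eta> N = c * sqrt (ln (real N) / (\<kappa> N * real N))" for N
  have c0: "0 \<le> c" by (simp add: c_def)
  have \<eta>0: "0 \<le> \<eta> N" for N using c0 ln_over_nonneg by (simp add: \<eta>_def)
  \<comment> \<open>The operator norm of the simple graph is at most \<open>1 + \<eta> N\<close>,
    which tends to 1, so strictness of \<open>rr < 1\<close> keeps the best-response map a
    contraction for large \<open>N\<close>.\<close>
  have "(\<lambda>N. rr * (\<eta> N + 1)) \<longlonglongrightarrow> rr * (c * sqrt 0 + 1)"
    unfolding \<eta>_def by (intro tendsto_intros \<kappa>_lim)
  then have ev: "\<forall>\<^sub>F N in sequentially. rr * (\<eta> N + 1) < 1" by (rule order_tendstoD) (use rr in simp)
  show ?thesis
  proof (intro exI[of _ "C * (1 + c)"] conjI)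
    show "0 \<le> C * (1 + c)" using C c0 by simp
    show "\<forall>\<^sub>F N in sequentially. \<exists>B\<in>sets Q. Q.prob B \<le> 5 / (real N)\<^sup>2 \<and> (\<forall>\<omega>\<in>space Q - B.
     (\<exists>b. UNash N (Hs N \<omega>) b) \<and> (\<forall>b. Nash N (Hs N \<omega>) b \<longrightarrow>
       distbar N b \<le> C * (1 + c) * ((ln (real N) / real N) powr (1/4) + (ln (real N) / (\<kappa> N * real N)) powr (1/2) + dist\<theta> N)))"
      using eventually_sampling_regime ev
    proof eventually_elim
      case (elim N)
      then have N: "N \<ge> 3" "N \<ge> 2" "N \<ge> 1" and small: "4 * sqrt (ln (real N) / real N) \<le> 1" by auto
      obtain B1 where B1: "B1 \<in> sets Q" "Q.prob B1 \<le> 4 / (real N)\<^sup>2"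
        "\<forall>\<omega>\<in>space Q - B1. \<forall>i\<in>{1..N}. \<bar>pts N i \<omega> - real i / real N\<bar> \<le> sqrt (2 * ln (real N) / real N) + 1 / real N"
        using order_statistics_concentration[OF Q.prob_space_axioms Y[OF N(3)] N(2)] by blast
      interpret S: sampled_graph Q WW "\<kappa> N" N "pts N" "E N" by (rule sampled_graph[OF N(3)])
      obtain B2 where B2: "B2 \<in> sets Q" "Q.prob B2 \<le> 1 / (real N)\<^sup>2" and
        conc: "\<forall>\<omega>\<in>space Q - B2. \<forall>u :: nat \<Rightarrow> real.
          (\<Sum>i=1..N. (\<Sum>j=1..N. (Hs N \<omega> i j - WW (pts N i \<omega>) (pts N j \<omega>)) / real N * u j)\<^sup>2)
          \<le> (32 * exp 3 + 2) * (ln (real N) / (\<kappa> N * real N)) * (\<Sum>j=1..N. (u j)\<^sup>2)"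
        using S.simple_graph_concentration[OF N(1)] elim by blast
      have op: "op_bound N (\<lambda>i j. Hs N \<omega> i j - Hw N \<omega> i j) (\<eta> N)" if w: "\<omega> \<in> space Q - B2" for \<omega>
        unfolding op_bound_def
      proof (intro conjI allI \<eta>0)
        fix u :: "nat \<Rightarrow> real"
        have "(\<Sum>i=1..N. (\<Sum>j=1..N. (Hs N \<omega> i j - Hw N \<omega> i j) / real N * u j)\<^sup>2) =
            (\<Sum>i=1..N. (\<Sum>j=1..N. (Hs N \<omega> i j - WW (pts N i \<omega>) (pts N j \<omega>)) / real N * u j)\<^sup>2)"
        proof (intro sum.cong refl arg_cong[where f = "\<lambda>t. t\<^sup>2"])
          fix i j assume ij: "i \<in> {1..N}" "j \<in> {1..N}"
          have "WW (pts N i \<omega>) (pts N j \<omega>) = Hw N \<omega> i j" unfolding weighted_graph_def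
            by (intro WW_eq pts_range[OF N(3)] ij) (use w in auto)
          then show "(Hs N \<omega> i j - Hw N \<omega> i j) / real N * u j = (Hs N \<omega> i j - WW (pts N i \<omega>) (pts N j \<omega>)) / real N * u j"
            by simp
        qed
        also have "\<dots> \<le> (32 * exp 3 + 2) * (ln (real N) / (\<kappa> N * real N)) * (\<Sum>j=1..N. (u j)\<^sup>2)"
          using conc w by blast
        also have "(32 * exp 3 + 2) * (ln (real N) / (\<kappa> N * real N)) = (\<eta> N)\<^sup>2"
          using ln_over_nonneg(2)[of N] by (simp add: \<eta>_def c_def power_mult_distrib)
        finally show "(\<Sum>i=1..N. (\<Sum>j=1..N. (Hs N \<omega> i j - Hw N \<omega> i j) / real N * u j)\<^sup>2) \<le> (\<eta> N)\<^sup>2 * (\<Sum>j=1..N. (u j)\<^sup>2)" .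
      qed
      have ex: "\<exists>b. UNash N (Hs N \<omega>) b" if w: "\<omega> \<in> space Q - B2" for \<omega>
      proof -
        have "op_bound N (\<lambda>i j. (Hs N \<omega> i j - Hw N \<omega> i j) + Hw N \<omega> i j) (\<eta> N + 1)"
          using w by (intro op_bound_add[OF op Hw_op_bound[OF N(3)]]) auto
        then have "op_bound N (Hs N \<omega>) (\<eta> N + 1)" by simp
        then show ?thesis by (rule unique_nash_exists[OF N(3)]) (use elim in simp)
      qed
      have bd: "distbar N b \<le> C * (1 + c) * ((ln (real N) / real N) powr (1/4) + (ln (real N) / (\<kappa> N * real N)) powr (1/2) + dist\<theta> N)"
        if w: "\<omega> \<in> space Q - (B1 \<union> B2)" and b: "Nash N (Hs N \<omega>) b" for \<omega> b
      proof -
        have w': "\<omega> \<in> space Q" "\<omega> \<in> space Q - B1" "\<omega> \<in> space Q - B2" using w by auto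
        have dt: "0 \<le> dist\<theta> N" by (rule profile_dist_nonneg)
        let ?p = "(ln (real N) / real N) powr (1/4)" and ?q = "(ln (real N) / (\<kappa> N * real N)) powr (1/2)"
        have "distbar N b \<le> C * (?p + \<eta> N + dist\<theta> N)"
          by (rule st[rule_format, OF N(1) w'(1) small _ op[OF w'(3)] b]) (use B1(3) w'(2) in blast)
        also have "\<eta> N = c * ?q"
          unfolding \<eta>_def using ln_over_nonneg(2)[of N] by (simp add: powr_half_sqrt)
        also have "C * (?p + c * ?q + dist\<theta> N) \<le> C * ((1 + c) * (?p + ?q + dist\<theta> N))"
          using c0 dt by (intro mult_left_mono[OF _ C]) (simp add: algebra_simps)
        finally show ?thesis by (simp add: mult.assoc)
      qed
      have "Q.prob (B1 \<union> B2) \<le> Q.prob B1 + Q.prob B2" using B1(1) B2(1) by (rule measure_Un_le)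
      also have "\<dots> \<le> 5 / (real N)\<^sup>2" using B1(2) B2(2) by (simp add: field_simps)
      finally show ?case using B1(1) B2(1) ex bd by (intro bexI[of _ "B1 \<union> B2"]) auto
    qed
  qed
qed

lemma five_over_square_lim: "(\<lambda>N. 5 / (real N)\<^sup>2) \<longlonglongrightarrow> 0"
proof -
  have "(\<lambda>N. 5 * (1 / real N)\<^sup>2) \<longlonglongrightarrow> 5 * 0\<^sup>2"
    by (intro tendsto_intros lim_1_over_n)
  then show ?thesis by (simp add: power_divide)
qed

text \<open>For fixed \<epsilon> the bound \<open>5 / N\<close> squared is eventually below
  \<epsilon>. The target event must itself be measurable to dominate the good event in
  measure.\<close>

lemma good_high_probability:
  assumes good: "\<forall>\<^sub>F N in sequentially. \<exists>B\<in>sets Q. Q.prob B \<le> 5 / (real N)\<^sup>2 \<and> (\<forall>\<omega>\<in>space Q - B. \<Phi> N \<omega>)"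
    and m: "\<And>N. N \<ge> 1 \<Longrightarrow> {\<omega> \<in> space Q. \<Psi> N \<omega>} \<in> sets Q"
    and imp: "\<And>N \<omega>. \<lbrakk>N \<ge> 1; \<omega> \<in> space Q; \<Phi> N \<omega>\<rbrakk> \<Longrightarrow> \<Psi> N \<omega>" and \<epsilon>: "\<epsilon> > 0"
  shows "\<forall>\<^sub>F N in sequentially. Q.prob {\<omega> \<in> space Q. \<Psi> N \<omega>} \<ge> 1 - \<epsilon>"
proof -
  have "\<forall>\<^sub>F N in sequentially. 5 / (real N)\<^sup>2 < \<epsilon>" using five_over_square_lim \<epsilon> by (rule order_tendstoD)
  then show ?thesis using good eventually_ge_at_top[of 1]
  proof eventually_elim
    case (elim N)
    then obtain B where B: "B \<in> sets Q" "Q.prob B \<le> 5 / (real N)\<^sup>2" "\<forall>\<omega>\<in>space Q - B. \<Phi> N \<omega>" by blast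
    have "1 - \<epsilon> \<le> Q.prob (space Q - B)" using B(1,2) elim(1) by (simp add: Q.prob_compl)
    also have "\<dots> \<le> Q.prob {\<omega> \<in> space Q. \<Psi> N \<omega>}"
      using B(3) imp[OF elim(3)] by (intro Q.finite_measure_mono m[OF elim(3)]) auto
    finally show ?case .
  qed
qed

text \<open>The first Borel-Cantelli lemma uses only summability of the probabilities, so no
  assumption relates the samples for different \<open>N\<close>.\<close>

lemma good_almost_surely:
  assumes good: "\<forall>\<^sub>F N in sequentially. \<exists>B\<in>sets Q. Q.prob B \<le> 5 / (real N)\<^sup>2 \<and> (\<forall>\<omega>\<in>space Q - B. \<Phi> N \<omega>)"
  shows "AE \<omega> in Q. \<forall>\<^sub>F N in sequentially. \<Phi> N \<omega>"
proof -
  obtain N0 where N0: "\<forall>N\<ge>N0. \<exists>B. B \<in> sets Q \<and> Q.prob B \<le> 5 / (real N)\<^sup>2 \<and> (\<forall>\<omega>\<in>space Q - B. \<Phi> N \<omega>)"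
    using good unfolding eventually_sequentially by blast
  \<comment> \<open>Below \<open>N0\<close> no bad set is available; the empty set keeps the
    sequence total and the probability bound valid.\<close>
  define B where "B N = (if N \<ge> N0 then SOME B. B \<in> sets Q \<and> Q.prob B \<le> 5 / (real N)\<^sup>2 \<and> (\<forall>\<omega>\<in>space Q - B. \<Phi> N \<omega>) else {})" for N
  have B': "B N \<in> sets Q \<and> Q.prob (B N) \<le> 5 / (real N)\<^sup>2 \<and> (\<forall>\<omega>\<in>space Q - B N. \<Phi> N \<omega>)" if "N \<ge> N0" for N
  proof -
    have e: "B N = (SOME B. B \<in> sets Q \<and> Q.prob B \<le> 5 / (real N)\<^sup>2 \<and> (\<forall>\<omega>\<in>space Q - B. \<Phi> N \<omega>))"
      using that unfolding B_def by (rule if_P)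
    show ?thesis unfolding e by (rule someI_ex[OF N0[rule_format, OF that]])
  qed
  have empty: "B N = {}" if "\<not> N0 \<le> N" for N using that unfolding B_def by (rule if_not_P)
  have B: "B N \<in> sets Q" "Q.prob (B N) \<le> 5 * (1 / (real N)\<^sup>2)" "N \<ge> N0 \<Longrightarrow> \<forall>\<omega>\<in>space Q - B N. \<Phi> N \<omega>" for N
    using B'[of N] by (cases "N \<ge> N0"; simp add: empty)+
  have "summable (\<lambda>N. 5 * (1 / (real N)\<^sup>2))"
    using inverse_power_summable[of 2, where 'a = real] by (intro summable_mult) (simp add: field_simps)
  then have "summable (\<lambda>N. Q.prob (B N))"
    by (rule summable_comparison_test'[where N = 0]) (use B(2) in simp)
  then have "AE \<omega> in Q. \<forall>\<^sub>F N in sequentially. \<omega> \<in> space Q - B N"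
    using B(1) by (intro borel_cantelli_AE1) (auto simp: Q.emeasure_eq_measure)
  then show ?thesis
  proof eventually_elim
    case (elim \<omega>)
    then show ?case using eventually_ge_at_top[of N0]
      by eventually_elim (use B(3) in blast)
  qed
qed

text \<open>The estimates proved so far contain \<open>ln N\<close>; as \<open>\<delta> < 1\<close>,
  inserting \<delta> only weakens them.\<close>

lemma powr_ln_mono:
  assumes "0 < \<delta>" "\<delta> < exp (-1)" "N \<ge> 1" "0 < s" "0 < p"
  shows "(ln (real N) / s) powr p \<le> (ln (real N / \<delta>) / s) powr p"
proof (rule powr_mono2)
  have "exp (-1 :: real) < 1" by simp
  then have "\<delta> < 1" using assms by linarith
  then have "real N \<le> real N / \<delta>" using assms by (simp add: field_simps mult_le_cancel_left1)
  then show "ln (real N) / s \<le> ln (real N / \<delta>) / s" using assms by (intro divide_right_mono) auto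
qed (use assms in auto)

section \<open>Probability bounds and almost sure convergence\<close>

lemma weighted_high_probability:
  assumes \<delta>: "0 < \<delta>" "\<delta> < exp (-1)"
  shows "\<exists>C. \<forall>\<^sub>F N in sequentially. Q.prob {\<omega>\<in>space Q. \<exists>a. UNash N (Hw N \<omega>) a \<and>
     distbar N a \<le> C * max ((ln (real N / \<delta>) / real N) powr (1/4)) (dist\<theta> N)} \<ge> 1 - \<delta>"
proof -
  obtain C where C: "C \<ge> 0" and g: "\<forall>\<^sub>F N in sequentially. \<exists>B\<in>sets Q. Q.prob B \<le> 5 / (real N)\<^sup>2 \<and> (\<forall>\<omega>\<in>space Q - B. \<forall>a.
     Nash N (Hw N \<omega>) a \<longrightarrow> distbar N a \<le> C * ((ln (real N) / real N) powr (1/4) + dist\<theta> N))"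
    using weighted_good by (elim exE conjE) (rule that)
  show ?thesis
  proof (rule exI[of _ "2 * C"], rule good_high_probability[OF g weighted_event_measurable _ \<delta>(1)], assumption)
    fix N \<omega> assume N: "N \<ge> 1" and w: "\<omega> \<in> space Q" and
      h: "\<forall>a. Nash N (Hw N \<omega>) a \<longrightarrow> distbar N a \<le> C * ((ln (real N) / real N) powr (1/4) + dist\<theta> N)"
    obtain a where a: "UNash N (Hw N \<omega>) a" using weighted_nash_exists[OF N w] by blast
    let ?m = "max ((ln (real N / \<delta>) / real N) powr (1/4)) (dist\<theta> N)"
    have "distbar N a \<le> C * ((ln (real N) / real N) powr (1/4) + dist\<theta> N)" using h UNash_imp_Nash[OF a] by blast
    also have "\<dots> \<le> C * (?m + ?m)"
      using powr_ln_mono[OF \<delta> N, of "real N" "1/4"] N by (intro mult_left_mono[OF _ C] add_mono) auto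
    finally have "distbar N a \<le> 2 * C * ?m" by simp
    then show "\<exists>a. UNash N (Hw N \<omega>) a \<and> distbar N a \<le> 2 * C * ?m" using a by blast
  qed
qed

lemma simple_high_probability:
  assumes \<delta>: "0 < \<delta>" "\<delta> < exp (-1)"
  shows "\<exists>C. \<forall>\<^sub>F N in sequentially. Q.prob {\<omega>\<in>space Q. \<exists>b. UNash N (Hs N \<omega>) b \<and>
     distbar N b \<le> C * max ((ln (real N / \<delta>) / real N) powr (1/4))
        (max ((ln (real N / \<delta>) / (\<kappa> N * real N)) powr (1/2)) (dist\<theta> N))} \<ge> 1 - 2 * \<delta>"
proof -
  obtain C where C: "C \<ge> 0" and g: "\<forall>\<^sub>F N in sequentially. \<exists>B\<in>sets Q. Q.prob B \<le> 5 / (real N)\<^sup>2 \<and> (\<forall>\<omega>\<in>space Q - B.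
     (\<exists>b. UNash N (Hs N \<omega>) b) \<and> (\<forall>b. Nash N (Hs N \<omega>) b \<longrightarrow>
       distbar N b \<le> C * ((ln (real N) / real N) powr (1/4) + (ln (real N) / (\<kappa> N * real N)) powr (1/2) + dist\<theta> N)))"
    using simple_good by (elim exE conjE) (rule that)
  show ?thesis
  proof (rule exI[of _ "3 * C"], rule good_high_probability[OF g simple_event_measurable], assumption)
    fix N \<omega> assume N: "N \<ge> 1" and w: "\<omega> \<in> space Q" and
      h: "(\<exists>b. UNash N (Hs N \<omega>) b) \<and> (\<forall>b. Nash N (Hs N \<omega>) b \<longrightarrow>
       distbar N b \<le> C * ((ln (real N) / real N) powr (1/4) + (ln (real N) / (\<kappa> N * real N)) powr (1/2) + dist\<theta> N))"
    then obtain b where b: "UNash N (Hs N \<omega>) b" by blast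
    let ?m = "max ((ln (real N / \<delta>) / real N) powr (1/4))
        (max ((ln (real N / \<delta>) / (\<kappa> N * real N)) powr (1/2)) (dist\<theta> N))"
    have "distbar N b \<le> C * ((ln (real N) / real N) powr (1/4) + (ln (real N) / (\<kappa> N * real N)) powr (1/2) + dist\<theta> N)"
      using h UNash_imp_Nash[OF b] by blast
    also have "\<dots> \<le> C * (?m + ?m + ?m)"
    proof (intro mult_left_mono[OF _ C] add_mono)
      show "(ln (real N) / real N) powr (1/4) \<le> ?m"
        using powr_ln_mono[OF \<delta> N, of "real N" "1/4"] N by auto
      show "(ln (real N) / (\<kappa> N * real N)) powr (1/2) \<le> ?m"
        using powr_ln_mono[OF \<delta> N, of "\<kappa> N * real N" "1/2"] N \<kappa>(1)[OF N] by auto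
    qed auto
    finally have "distbar N b \<le> 3 * C * ?m" by simp
    then show "\<exists>b. UNash N (Hs N \<omega>) b \<and> distbar N b \<le> 3 * C * ?m" using b by blast
  qed (use \<delta> in simp)
qed

lemma simple_nash_high_probability:
  assumes \<delta>: "0 < \<delta>"
  shows "\<exists>N\<^sub>\<delta>. \<forall>N\<ge>N\<^sub>\<delta>. Q.prob {\<omega>\<in>space Q. \<exists>b. UNash N (Hs N \<omega>) b} \<ge> 1 - 2 * \<delta>"
proof -
  obtain C where g: "\<forall>\<^sub>F N in sequentially. \<exists>B\<in>sets Q. Q.prob B \<le> 5 / (real N)\<^sup>2 \<and> (\<forall>\<omega>\<in>space Q - B.
     (\<exists>b. UNash N (Hs N \<omega>) b) \<and> (\<forall>b. Nash N (Hs N \<omega>) b \<longrightarrow>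
       distbar N b \<le> C * ((ln (real N) / real N) powr (1/4) + (ln (real N) / (\<kappa> N * real N)) powr (1/2) + dist\<theta> N)))"
    using simple_good by (elim exE conjE) (rule that)
  have m: "{\<omega> \<in> space Q. \<exists>b. UNash N (Hs N \<omega>) b} \<in> sets Q" if "N \<ge> 1" for N
    using simple_event_measurable[OF that, of "\<lambda>_. True"] by simp
  have "\<forall>\<^sub>F N in sequentially. Q.prob {\<omega>\<in>space Q. \<exists>b. UNash N (Hs N \<omega>) b} \<ge> 1 - 2 * \<delta>"
    by (rule good_high_probability[OF g m]) (use \<delta> in auto)
  then show ?thesis unfolding eventually_sequentially .
qed

lemma weighted_almost_surely:
  "AE \<omega> in Q. \<exists>a. (\<forall>N\<ge>1. UNash N (Hw N \<omega>) (a N)) \<and> (\<lambda>N. distbar N (a N)) \<longlonglongrightarrow> 0"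
proof -
  obtain C where g: "\<forall>\<^sub>F N in sequentially. \<exists>B\<in>sets Q. Q.prob B \<le> 5 / (real N)\<^sup>2 \<and> (\<forall>\<omega>\<in>space Q - B. \<forall>a.
     Nash N (Hw N \<omega>) a \<longrightarrow> distbar N a \<le> C * ((ln (real N) / real N) powr (1/4) + dist\<theta> N))"
    using weighted_good by (elim exE conjE) (rule that)
  have lim: "(\<lambda>N. C * ((ln (real N) / real N) powr (1/4) + dist\<theta> N)) \<longlonglongrightarrow> 0"
    using tendsto_mult[OF tendsto_const[of C] tendsto_add[OF powr_lim \<theta>_lim]] by simp
  show ?thesis using good_almost_surely[OF g] AE_space
  proof eventually_elim
    case (elim \<omega>)
    define a where "a N = (SOME a. UNash N (Hw N \<omega>) a)" for N
    have a: "UNash N (Hw N \<omega>) (a N)" if "N \<ge> 1" for N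
      unfolding a_def by (rule someI_ex[OF weighted_nash_exists[OF that elim(2)]])
    have "\<forall>\<^sub>F N in sequentially. norm (distbar N (a N)) \<le> C * ((ln (real N) / real N) powr (1/4) + dist\<theta> N)"
      using elim(1) eventually_ge_at_top[of 1]
    proof eventually_elim
      case (elim N)
      then have "distbar N (a N) \<le> C * ((ln (real N) / real N) powr (1/4) + dist\<theta> N)"
        using UNash_imp_Nash[OF a[OF elim(2)]] by blast
      then show ?case using profile_dist_nonneg[of T P \<nu> abar "step_profile N (a N)"] by simp
    qed
    then have "(\<lambda>N. distbar N (a N)) \<longlonglongrightarrow> 0" using lim by (rule Lim_null_comparison)
    then show ?case using a by blast
  qed
qed

text \<open>For almost every sample equilibria exist from some sample-dependent \<open>N\<close> on;
  for the finitely many earlier \<open>N\<close> the value \<open>b N\<close> may be arbitrary,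
  which the limit ignores.\<close>

lemma simple_almost_surely:
  "AE \<omega> in Q. \<exists>b. (\<forall>\<^sub>F N in sequentially. UNash N (Hs N \<omega>) (b N)) \<and> (\<lambda>N. distbar N (b N)) \<longlonglongrightarrow> 0"
proof -
  obtain C where g: "\<forall>\<^sub>F N in sequentially. \<exists>B\<in>sets Q. Q.prob B \<le> 5 / (real N)\<^sup>2 \<and> (\<forall>\<omega>\<in>space Q - B.
     (\<exists>b. UNash N (Hs N \<omega>) b) \<and> (\<forall>b. Nash N (Hs N \<omega>) b \<longrightarrow>
       distbar N b \<le> C * ((ln (real N) / real N) powr (1/4) + (ln (real N) / (\<kappa> N * real N)) powr (1/2) + dist\<theta> N)))"
    using simple_good by (elim exE conjE) (rule that)
  have "(\<lambda>N. sqrt (ln (real N) / (\<kappa> N * real N))) \<longlonglongrightarrow> sqrt 0"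
    by (intro tendsto_real_sqrt \<kappa>_lim)
  then have "(\<lambda>N. (ln (real N) / (\<kappa> N * real N)) powr (1/2)) \<longlonglongrightarrow> 0"
    by (simp add: powr_half_sqrt[OF ln_over_nonneg(2)])
  from tendsto_mult[OF tendsto_const[of C] tendsto_add[OF tendsto_add[OF powr_lim this] \<theta>_lim]]
  have lim: "(\<lambda>N. C * ((ln (real N) / real N) powr (1/4) + (ln (real N) / (\<kappa> N * real N)) powr (1/2) + dist\<theta> N)) \<longlonglongrightarrow> 0"
    by simp
  show ?thesis using good_almost_surely[OF g]
  proof eventually_elim
    case (elim \<omega>)
    define b where "b N = (SOME b. UNash N (Hs N \<omega>) b)" for N
    have b: "\<forall>\<^sub>F N in sequentially. UNash N (Hs N \<omega>) (b N)"
      using elim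
    proof eventually_elim
      case (elim N)
      then show ?case unfolding b_def by (intro someI_ex[of "UNash N (Hs N \<omega>)"]) blast
    qed
    have "\<forall>\<^sub>F N in sequentially. norm (distbar N (b N)) \<le> C * ((ln (real N) / real N) powr (1/4) + (ln (real N) / (\<kappa> N * real N)) powr (1/2) + dist\<theta> N)"
      using elim b
    proof eventually_elim
      case (elim N)
      then have "distbar N (b N) \<le> C * ((ln (real N) / real N) powr (1/4) + (ln (real N) / (\<kappa> N * real N)) powr (1/2) + dist\<theta> N)"
        using UNash_imp_Nash[OF elim(2)] by blast
      then show ?case using profile_dist_nonneg[of T P \<nu> abar "step_profile N (b N)"] by simp
    qed
    then have "(\<lambda>N. distbar N (b N)) \<longlonglongrightarrow> 0" using lim by (rule Lim_null_comparison)
    then show ?case using b by blast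
  qed
qed

end

theorem theorem2p20:
  fixes T :: real
    and P :: "'w measure"
    and \<nu> :: "real measure"
    and R :: "(real \<times> 'w) measure"
    and F :: "real \<Rightarrow> 'w measure"
    and Q :: "'q measure"
    and U :: "'w utility"
    and \<alpha>\<^sub>U l\<^sub>U l\<^sub>\<theta> :: real
    and A0 :: "'w process set"
    and W :: "real \<Rightarrow> real \<Rightarrow> real"
    and \<theta> abar :: "'w profile"
    and \<theta>N :: "nat \<Rightarrow> nat \<Rightarrow> 'w process"
    and \<kappa> :: "nat \<Rightarrow> real"
    and Y x :: "nat \<Rightarrow> nat \<Rightarrow> 'q \<Rightarrow> real"
    and E :: "nat \<Rightarrow> nat \<Rightarrow> nat \<Rightarrow> 'q \<Rightarrow> bool"
  assumes "T > 0"
    and "prob_space P"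
    and "extends_lebesgue_unit_interval \<nu>"
    and "rich_fubini_extension \<nu> P R"
    and F_def: "F = augmented_filtration P {0..1} \<theta>"
    and "\<theta> \<in> action_profiles T P F \<nu>"
    and "respects_proc_eq T P U"
    and "graphon W"
    and A1: "cond_utility T P F U \<alpha>\<^sub>U l\<^sub>U l\<^sub>\<theta>"
    and A2: "cond_action_sets T P F \<nu> U (\<lambda>_. A0)"
    and A3: "\<exists>M. \<forall>a\<in>A0. proc_norm T P a \<le> M"
    and A4: "blockwise_lipschitz W"
    and A5: "l\<^sub>U < \<alpha>\<^sub>U"
    and "graphon_nash T P F \<nu> (\<lambda>_. A0) U \<theta> W abar"
    and "\<forall>N\<ge>1. 0 < \<kappa> N \<and> \<kappa> N \<le> 1"
    and "(\<lambda>N. ln (real N) / (\<kappa> N * real N)) \<longlonglongrightarrow> 0"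
    and "\<forall>N\<ge>1. \<forall>i\<in>{1..N}. \<theta>N N i \<in> proc_space T P F"
    and "\<forall>N\<ge>1. \<forall>t\<in>{0..T}. sets (augmented_filtration P {1..N} (\<theta>N N) t) \<subseteq> sets (F t)"
    and "(\<lambda>N. profile_dist T P \<nu> \<theta> (step_profile N (\<theta>N N))) \<longlonglongrightarrow> 0"
    and "prob_space Q"
    and "\<forall>N\<ge>1. iid_uniform Q N (Y N)"
    and x_def: "\<forall>N. x N = ordered_points N (Y N)"
    and "\<forall>N\<ge>1. simple_graph_edges Q W (\<kappa> N) N (x N) (E N)"
  shows
      "(\<forall>N\<ge>1. \<forall>\<omega>\<in>space Q. \<exists>a.
         unique_network_nash T P A0 U N (\<theta>N N) (weighted_graph W (x N) \<omega>) a)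
     \<and> (\<forall>\<delta>. 0 < \<delta> \<and> \<delta> < exp (-1) \<longrightarrow> (\<exists>C. \<forall>\<^sub>F N in sequentially.
         measure Q {\<omega>\<in>space Q. \<exists>a.
           unique_network_nash T P A0 U N (\<theta>N N) (weighted_graph W (x N) \<omega>) a \<and>
           profile_dist T P \<nu> abar (step_profile N a)
             \<le> C * max ((ln (real N / \<delta>) / real N) powr (1/4))
                       (profile_dist T P \<nu> \<theta> (step_profile N (\<theta>N N)))} \<ge> 1 - \<delta>))
     \<and> (AE \<omega> in Q. \<exists>a.
         (\<forall>N\<ge>1. unique_network_nash T P A0 U N (\<theta>N N) (weighted_graph W (x N) \<omega>) (a N)) \<and>
         (\<lambda>N. profile_dist T P \<nu> abar (step_profile N (a N))) \<longlonglongrightarrow> 0)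
     \<and> (\<forall>\<delta>. 0 < \<delta> \<and> \<delta> < exp (-1) \<longrightarrow> (\<exists>N\<^sub>\<delta>. \<forall>N\<ge>N\<^sub>\<delta>.
         measure Q {\<omega>\<in>space Q. \<exists>b.
           unique_network_nash T P A0 U N (\<theta>N N)
             (\<lambda>i j. inverse (\<kappa> N) * simple_graph (E N) \<omega> i j) b} \<ge> 1 - 2 * \<delta>))
     \<and> (\<forall>\<delta>. 0 < \<delta> \<and> \<delta> < exp (-1) \<longrightarrow> (\<exists>C. \<forall>\<^sub>F N in sequentially.
         measure Q {\<omega>\<in>space Q. \<exists>b.
           unique_network_nash T P A0 U N (\<theta>N N)
             (\<lambda>i j. inverse (\<kappa> N) * simple_graph (E N) \<omega> i j) b \<and>
           profile_dist T P \<nu> abar (step_profile N b)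
             \<le> C * max ((ln (real N / \<delta>) / real N) powr (1/4))
                     (max ((ln (real N / \<delta>) / (\<kappa> N * real N)) powr (1/2))
                          (profile_dist T P \<nu> \<theta> (step_profile N (\<theta>N N))))} \<ge> 1 - 2 * \<delta>))
     \<and> (AE \<omega> in Q. \<exists>b.
         (\<forall>\<^sub>F N in sequentially. unique_network_nash T P A0 U N (\<theta>N N)
            (\<lambda>i j. inverse (\<kappa> N) * simple_graph (E N) \<omega> i j) (b N)) \<and>
         (\<lambda>N. profile_dist T P \<nu> abar (step_profile N (b N))) \<longlonglongrightarrow> 0)"
  proof -
  obtain M where M: "\<And>a. a \<in> A0 \<Longrightarrow> proc_norm T P a \<le> M" using A3 by blast
  have \<theta>: "\<theta> \<in> action_profiles T P F \<nu>" by fact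
  have nu: "space \<nu> = {0..1}" using assms(3) by (simp add: extends_lebesgue_unit_interval_def)
  have joint: "(\<lambda>(x, t, w). \<theta> x t w) \<in> borel_measurable (\<nu> \<Otimes>\<^sub>M (restrict_space borel {0..T} \<Otimes>\<^sub>M P))"
    using \<theta> by (simp add: action_profiles_def)
  \<comment> \<open>Sections of the jointly measurable \<open>\<theta>\<close> are random variables;
    this is what places the generators of the filtration inside \<open>P\<close>.\<close>
  have \<theta>m: "\<theta> y s \<in> borel_measurable P" if "y \<in> {0..1}" "s \<in> {0..T}" for y s
  proof -
    have "(\<lambda>w. (y, s, w)) \<in> measurable P (\<nu> \<Otimes>\<^sub>M (restrict_space borel {0..T} \<Otimes>\<^sub>M P))"
      using that nu by (intro measurable_Pair measurable_const measurable_ident) (auto simp: space_restrict_space)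
    from measurable_compose[OF this joint] show ?thesis by simp
  qed
  have F_space: "space (F t) = space P" for t
    by (simp add: F_def augmented_filtration_def space_measure_of_conv)
  \<comment> \<open>\<open>sigma\<close> yields the generated sets only when the generators are
    subsets of the space, which is checked through their membership in \<open>sets P\<close>; null
    sets are measurable by definition.\<close>
  have F_sets: "sets (F t) \<subseteq> sets P" if t: "t \<in> {0..T}" for t
  proof -
    let ?G = "{\<theta> x s -` B \<inter> space P | x s B. x \<in> {0..1} \<and> 0 \<le> s \<and> s \<le> t \<and> B \<in> sets borel} \<union> null_sets P"
    have G: "?G \<subseteq> sets P"
    proof
      fix X assume "X \<in> ?G"
      then consider y s B where "X = \<theta> y s -` B \<inter> space P" "y \<in> {0..1}" "0 \<le> s" "s \<le> t" "B \<in> sets borel"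
        | "X \<in> null_sets P" by blast
      then show "X \<in> sets P"
      proof cases
        case 1
        then show ?thesis using \<theta>m[of y s] t by (auto intro: measurable_sets)
      qed auto
    qed
    have "?G \<subseteq> Pow (space P)" using G sets.space_closed by blast
    then have "sets (F t) = sigma_sets (space P) ?G"
      unfolding F_def augmented_filtration_def by (rule sets_measure_of)
    also have "\<dots> \<subseteq> sets P" by (rule sets.sigma_sets_subset[OF G])
    finally show ?thesis .
  qed
  \<comment> \<open>The action sets form a constant family, so the index 0 already yields the
    properties of \<open>A0\<close>.\<close>
  have A0: "A0 \<subseteq> proc_space T P F" "A0 \<noteq> {}" "proc_convex A0" "proc_closed T P F A0"
    using A2[unfolded cond_action_sets_def, THEN conjunct1, rule_format, of 0] by auto
  interpret S: sampled_game T P F U \<alpha>\<^sub>U l\<^sub>U l\<^sub>\<theta> M A0 \<nu> Q W \<theta> abar \<theta>N \<kappa> Y E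
  proof (intro sampled_game.intro graphon_game.intro game.intro process_space.intro
      graphon_game_axioms.intro game_axioms.intro sampled_game_axioms.intro)
    show "simple_graph_edges Q W (\<kappa> N) N (ordered_points N (Y N)) (E N)" if "N \<ge> 1" for N
      using assms(23) x_def that by metis
  qed (use assms M F_space F_sets A0 in \<open>auto\<close>)
  have x: "x N = ordered_points N (Y N)" for N using x_def by simp
  show ?thesis
    unfolding x
    using S.weighted_nash_exists S.weighted_high_probability S.weighted_almost_surely
      S.simple_nash_high_probability S.simple_high_probability S.simple_almost_surely
    by (intro conjI) blast+
qed

end
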